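(* Let $A$ be a semilattice of groups. Up to identification of isomorphic groups and semigroups, there is a one-to-one correspondence between twisted partial actions of groups on $A$ and Sieben twisted module structures on $A$ over $E$-unitary inverse semigroups, given by $\Theta\mapsto\Lambda^\Theta$ and $\Lambda\mapsto\Theta^\Lambda$; that is: for every Sieben twisted $S$-module structure $\Lambda$ on $A$ with $S$ $E$-unitary there is an isomorphism $\nu:S\to E(A)*_{\theta}\mathcal G(S)$ (where $\Theta^\Lambda=(\theta,w)$) with $\Lambda=\Lambda^{\Theta^\Lambda}\circ\nu$, and for every twisted partial action $\Theta$ of a group $G$ on $A$ there is an isomorphism $\nu:G\to\mathcal G(E(A)*_\theta G)$ with $\Theta=\Theta^{\Lambda^\Theta}\circ\nu$. Moreover, equivalent twisted partial actions correspond to equivalent Sieben twisted modules (in both directions).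
   Context: A semilattice of groups is an inverse semigroup $A$ with central idempotents; $A_e=\{a: aa^{-1}=a^{-1}a=e\}$ for $e\in E(A)$. For an inverse semigroup $S$: $\sigma$ is the minimum group congruence, $\mathcal G(S)=S/\sigma$, $\sigma^\natural:S\to\mathcal G(S)$; $S$ is $E$-unitary if $e\le s$ with $e\in E(S)$ forces $s\in E(S)$. An endomorphism $\varphi$ of $A$ is relatively invertible if there are an endomorphism $\bar\varphi$ and $e_\varphi\in E(A)$ with $\bar\varphi(\varphi(a))=e_\varphi a$, $\varphi(\bar\varphi(a))=\varphi(e_\varphi)a$ for all $a$, $e_\varphi$ the identity of $\bar\varphi(A)$ and $\varphi(e_\varphi)$ the identity of $\varphi(A)$. A twisted $S$-module structure on $A$ is $\Lambda=(\alpha,\lambda,f)$ with $\alpha:E(S)\to E(A)$ an isomorphism, $s\mapsto\lambda_s$ a map from $S$ to relatively invertible endomorphisms, $f:S\times S\to A$ with $f(s,t)\in A_{\alpha(stt^{-1}s^{-1})}$, such that (i) $\lambda_e(a)=\alpha(e)a$ ($e\in E(S)$); (ii) $\lambda_s(\alpha(e))=\alpha(ses^{-1})$; (iii) $\lambda_s(\lambda_t(a))=f(s,t)\lambda_{st}(a)f(s,t)^{-1}$; (iv) $f(se,e)=\alpha(ses^{-1})$, $f(e,es)=\alpha(ess^{-1})$; (v) $\lambda_s(f(t,u))f(s,tu)=f(s,t)f(st,u)$. It is Sieben if $f(s,e)=\alpha(ses^{-1})$ and $f(e,s)=\alpha(ess^{-1})$ for all $s\in S,e\in E(S)$. Two structures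 $(\alpha,\lambda,f),(\alpha',\lambda',f')$ over $S$ are equivalent if $\alpha'=\alpha$ and there is $g:S\to A$ with $g(s)\in A_{\alpha(ss^{-1})}$, $\lambda'_s(a)=g(s)\lambda_s(a)g(s)^{-1}$ and $f'(s,t)g(st)=g(s)\lambda_s(g(t))f(s,t)$. For an isomorphism $\nu:S\to S'$ and a structure $\Lambda'$ over $S'$, $\Lambda'\circ\nu=(\alpha'\circ\nu|_{E(S)},\lambda'\circ\nu,f'\circ(\nu\times\nu))$. Multipliers and twisted partial actions: a multiplier of a semigroup $T$ is a pair $(L,R)$ of maps $T\to T$ with $L(st)=L(s)t$, $R(st)=sR(t)$, $sL(t)=R(s)t$, written $ws=L(s)$, $sw=R(s)$; they form a monoid $\mathcal M(T)$ with unit group $\mathcal U(\mathcal M(T))$. A twisted partial action of a group $G$ on $A$ is $\Theta=(\theta,w)$, $\theta_x:D_{x^{-1}}\to D_x$ isomorphisms of nonempty ideals, $w_{x,y}\in\mathcal U(\mathcal M(D_xD_{xy}))$, with (i) $D_x^2=D_x$, $D_xD_y=D_yD_x$; (ii) $D_1=A$, $\theta_1=\mathrm{id}$; (iii) $\theta_x(D_{x^{-1}}D_y)=D_xD_{xy}$; (iv) $\theta_x\theta_y(s)=w_{x,y}\theta_{xy}(s)w_{x,y}^{-1}$ for $s\in D_{y^{-1}}D_{y^{-1}x^{-1}}$; (v) $w_{1,x}=w_{x,1}=$ identity of $D_x$; (vi) $\theta_x(sw_{y,z})w_{x,yz}=\theta_x(s)w_{x,y}w_{xy,z}$ for $s\in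 D_{x^{-1}}D_yD_{yz}$. Two such, $(\theta,w)$ and $(\theta',w')$, are equivalent if $D'_x=D_x$ and there are $\varepsilon_x\in\mathcal U(\mathcal M(D_x))$ with $\theta'_x(s)=\varepsilon_x\theta_x(s)\varepsilon_x^{-1}$ ($s\in D_{x^{-1}}$) and $\theta'_x(s)w'_{x,y}\varepsilon_{xy}=\varepsilon_x\theta_x(s\varepsilon_y)w_{x,y}$ ($s\in D_{x^{-1}}D_y$). For an isomorphism $\nu:G\to G'$ and $\Theta'$ on $G'$, $\Theta'\circ\nu$ is given by $\theta'_{\nu(x)}$, $w'_{\nu(x),\nu(y)}$. Construction $\Theta^\Lambda$ (for $\Lambda$ Sieben over $E$-unitary $S$): for $x\in\mathcal G(S)$ (a $\sigma$-class), $D_x=\bigsqcup_{s\in x}A_{\alpha(ss^{-1})}$; for $a\in D_{x^{-1}}$, $\theta_x(a)=\lambda_s(a)$ where $s\in x$ is the unique element with $\alpha(s^{-1}s)=aa^{-1}$; for $a\in D_xD_{xy}$, $w_{x,y}a=f(s,s^{-1}t)a$, $aw_{x,y}=af(s,s^{-1}t)$ where $s\in x$, $t\in xy$ are the unique elements with $\alpha(ss^{-1})=\alpha(tt^{-1})=aa^{-1}$. This is a twisted partial action of $\mathcal G(S)$ on $A$. Construction $\Lambda^\Theta$ (for a twisted partial action $\Theta=(\theta,w)$ of $G$ on $A$): $\theta$ restricts to isomorphisms $E(D_{x^{-1}})\to E(D_x)$; $E(A)*_\theta G=\{e\delta_x: e\in E(D_x)\}$ with $e\delta_x\cdot f\delta_y=\theta_x(\theta_x^{-1}(e)f)\delta_{xy}$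 is an $E$-unitary inverse semigroup. Then $\Lambda^\Theta=(\alpha,\lambda,f)$ over $E(A)*_\theta G$ with $\alpha(e\delta_1)=e$, $\lambda_{e\delta_x}(a)=\theta_x(\theta_x^{-1}(e)a)$, $f(e\delta_x,e'\delta_y)=\theta_x(\theta_x^{-1}(e)e')w_{x,y}$; it is a Sieben twisted module structure. *)

theory Defs
  imports "HOL-Algebra.Group"
begin

definition sg_on :: "'a set \<Rightarrow> ('a \<Rightarrow> 'a \<Rightarrow> 'a) \<Rightarrow> bool" where
  "sg_on S m \<longleftrightarrow> (\<forall>a\<in>S. \<forall>b\<in>S. m a b \<in> S) \<and>
     (\<forall>a\<in>S. \<forall>b\<in>S. \<forall>c\<in>S. m (m a b) c = m a (m b c))"

definition idems :: "'a set \<Rightarrow> ('a \<Rightarrow> 'a \<Rightarrow> 'a) \<Rightarrow> 'a set" where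
  "idems S m = {e \<in> S. m e e = e}"

definition is_inverse_of :: "'a set \<Rightarrow> ('a \<Rightarrow> 'a \<Rightarrow> 'a) \<Rightarrow> 'a \<Rightarrow> 'a \<Rightarrow> bool" where
  "is_inverse_of S m a b \<longleftrightarrow> b \<in> S \<and> m (m a b) a = a \<and> m (m b a) b = b"

definition inverse_semigroup :: "'a set \<Rightarrow> ('a \<Rightarrow> 'a \<Rightarrow> 'a) \<Rightarrow> bool" where
  "inverse_semigroup S m \<longleftrightarrow> S \<noteq> {} \<and> sg_on S m \<and> (\<forall>a\<in>S. \<exists>!b. is_inverse_of S m a b)"

definition sinv :: "'a set \<Rightarrow> ('a \<Rightarrow> 'a \<Rightarrow> 'a) \<Rightarrow> 'a \<Rightarrow> 'a" where
  "sinv S m a = (THE b. is_inverse_of S m a b)"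

definition nat_le :: "'a set \<Rightarrow> ('a \<Rightarrow> 'a \<Rightarrow> 'a) \<Rightarrow> 'a \<Rightarrow> 'a \<Rightarrow> bool" where
  "nat_le S m s t \<longleftrightarrow> (\<exists>e\<in>idems S m. s = m e t)"

definition E_unitary :: "'a set \<Rightarrow> ('a \<Rightarrow> 'a \<Rightarrow> 'a) \<Rightarrow> bool" where
  "E_unitary S m \<longleftrightarrow> (\<forall>e\<in>idems S m. \<forall>s\<in>S. nat_le S m e s \<longrightarrow> s \<in> idems S m)"

definition sig_cls :: "'a set \<Rightarrow> ('a \<Rightarrow> 'a \<Rightarrow> 'a) \<Rightarrow> 'a \<Rightarrow> 'a set" where
  "sig_cls S m s = {t \<in> S. \<exists>e\<in>idems S m. m e s = m e t}"

definition maxgrp :: "'a set \<Rightarrow> ('a \<Rightarrow> 'a \<Rightarrow> 'a) \<Rightarrow> 'a set monoid" where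
  "maxgrp S m = \<lparr> carrier = sig_cls S m ` S,
      mult = (\<lambda>X Y. sig_cls S m (m (SOME s. s \<in> X) (SOME t. t \<in> Y))),
      one = sig_cls S m (SOME e. e \<in> idems S m) \<rparr>"

definition sg_iso :: "('a \<Rightarrow> 'c) \<Rightarrow> 'a set \<Rightarrow> ('a \<Rightarrow> 'a \<Rightarrow> 'a) \<Rightarrow> 'c set \<Rightarrow> ('c \<Rightarrow> 'c \<Rightarrow> 'c) \<Rightarrow> bool" where
  "sg_iso \<nu> S m T n \<longleftrightarrow> bij_betw \<nu> S T \<and> (\<forall>a\<in>S. \<forall>b\<in>S. \<nu> (m a b) = n (\<nu> a) (\<nu> b))"

definition semilattice_of_groups :: "'b set \<Rightarrow> ('b \<Rightarrow> 'b \<Rightarrow> 'b) \<Rightarrow> bool" where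
  "semilattice_of_groups A mA \<longleftrightarrow> inverse_semigroup A mA \<and>
     (\<forall>e\<in>idems A mA. \<forall>a\<in>A. mA e a = mA a e)"

definition Agrp :: "'b set \<Rightarrow> ('b \<Rightarrow> 'b \<Rightarrow> 'b) \<Rightarrow> 'b \<Rightarrow> 'b set" where
  "Agrp A mA e = {a \<in> A. mA a (sinv A mA a) = e \<and> mA (sinv A mA a) a = e}"

definition endo :: "'b set \<Rightarrow> ('b \<Rightarrow> 'b \<Rightarrow> 'b) \<Rightarrow> ('b \<Rightarrow> 'b) \<Rightarrow> bool" where
  "endo A mA \<phi> \<longleftrightarrow> (\<forall>a\<in>A. \<phi> a \<in> A) \<and> (\<forall>a\<in>A. \<forall>b\<in>A. \<phi> (mA a b) = mA (\<phi> a) (\<phi> b))"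

definition is_identity_of :: "'b set \<Rightarrow> ('b \<Rightarrow> 'b \<Rightarrow> 'b) \<Rightarrow> 'b \<Rightarrow> bool" where
  "is_identity_of X mA e \<longleftrightarrow> e \<in> X \<and> (\<forall>b\<in>X. mA e b = b \<and> mA b e = b)"

definition rel_invertible :: "'b set \<Rightarrow> ('b \<Rightarrow> 'b \<Rightarrow> 'b) \<Rightarrow> ('b \<Rightarrow> 'b) \<Rightarrow> bool" where
  "rel_invertible A mA \<phi> \<longleftrightarrow> endo A mA \<phi> \<and>
     (\<exists>\<phi>b e. endo A mA \<phi>b \<and> e \<in> idems A mA \<and>
        (\<forall>a\<in>A. \<phi>b (\<phi> a) = mA e a) \<and> (\<forall>a\<in>A. \<phi> (\<phi>b a) = mA (\<phi> e) a) \<and>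
        is_identity_of (\<phi>b ` A) mA e \<and> is_identity_of (\<phi> ` A) mA (\<phi> e))"

definition tms :: "'a set \<Rightarrow> ('a \<Rightarrow> 'a \<Rightarrow> 'a) \<Rightarrow> 'b set \<Rightarrow> ('b \<Rightarrow> 'b \<Rightarrow> 'b)
     \<Rightarrow> ('a \<Rightarrow> 'b) \<Rightarrow> ('a \<Rightarrow> 'b \<Rightarrow> 'b) \<Rightarrow> ('a \<Rightarrow> 'a \<Rightarrow> 'b) \<Rightarrow> bool" where
  "tms S m A mA \<alpha> lam f \<longleftrightarrow>
     bij_betw \<alpha> (idems S m) (idems A mA) \<and>
     (\<forall>e\<in>idems S m. \<forall>e'\<in>idems S m. \<alpha> (m e e') = mA (\<alpha> e) (\<alpha> e')) \<and>
     (\<forall>s\<in>S. rel_invertible A mA (lam s)) \<and>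
     (\<forall>s\<in>S. \<forall>t\<in>S. f s t \<in> Agrp A mA (\<alpha> (m (m (m s t) (sinv S m t)) (sinv S m s)))) \<and>
     (\<forall>e\<in>idems S m. \<forall>a\<in>A. lam e a = mA (\<alpha> e) a) \<and>
     (\<forall>s\<in>S. \<forall>e\<in>idems S m. lam s (\<alpha> e) = \<alpha> (m (m s e) (sinv S m s))) \<and>
     (\<forall>s\<in>S. \<forall>t\<in>S. \<forall>a\<in>A.
        lam s (lam t a) = mA (mA (f s t) (lam (m s t) a)) (sinv A mA (f s t))) \<and>
     (\<forall>s\<in>S. \<forall>e\<in>idems S m. f (m s e) e = \<alpha> (m (m s e) (sinv S m s)) \<and>
                             f e (m e s) = \<alpha> (m (m e s) (sinv S m s))) \<and>
     (\<forall>s\<in>S. \<forall>t\<in>S. \<forall>u\<in>S.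
        mA (lam s (f t u)) (f s (m t u)) = mA (f s t) (f (m s t) u))"

definition sieben_tms :: "'a set \<Rightarrow> ('a \<Rightarrow> 'a \<Rightarrow> 'a) \<Rightarrow> 'b set \<Rightarrow> ('b \<Rightarrow> 'b \<Rightarrow> 'b)
     \<Rightarrow> ('a \<Rightarrow> 'b) \<Rightarrow> ('a \<Rightarrow> 'b \<Rightarrow> 'b) \<Rightarrow> ('a \<Rightarrow> 'a \<Rightarrow> 'b) \<Rightarrow> bool" where
  "sieben_tms S m A mA \<alpha> lam f \<longleftrightarrow> tms S m A mA \<alpha> lam f \<and>
     (\<forall>s\<in>S. \<forall>e\<in>idems S m. f s e = \<alpha> (m (m s e) (sinv S m s)) \<and>
                             f e s = \<alpha> (m (m e s) (sinv S m s)))"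

definition tms_equiv :: "'a set \<Rightarrow> ('a \<Rightarrow> 'a \<Rightarrow> 'a) \<Rightarrow> 'b set \<Rightarrow> ('b \<Rightarrow> 'b \<Rightarrow> 'b)
     \<Rightarrow> ('a \<Rightarrow> 'b) \<Rightarrow> ('a \<Rightarrow> 'b \<Rightarrow> 'b) \<Rightarrow> ('a \<Rightarrow> 'a \<Rightarrow> 'b)
     \<Rightarrow> ('a \<Rightarrow> 'b) \<Rightarrow> ('a \<Rightarrow> 'b \<Rightarrow> 'b) \<Rightarrow> ('a \<Rightarrow> 'a \<Rightarrow> 'b) \<Rightarrow> bool" where
  "tms_equiv S m A mA \<alpha> lam f \<alpha>' lam' f' \<longleftrightarrow>
     (\<forall>e\<in>idems S m. \<alpha>' e = \<alpha> e) \<and>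
     (\<exists>g. \<forall>s\<in>S. g s \<in> Agrp A mA (\<alpha> (m s (sinv S m s))) \<and>
          (\<forall>a\<in>A. lam' s a = mA (mA (g s) (lam s a)) (sinv A mA (g s))) \<and>
          (\<forall>t\<in>S. mA (f' s t) (g (m s t)) = mA (mA (g s) (lam s (g t))) (f s t)))"

definition tms_comp_eq :: "'a set \<Rightarrow> ('a \<Rightarrow> 'a \<Rightarrow> 'a) \<Rightarrow> 'b set
     \<Rightarrow> ('a \<Rightarrow> 'b) \<Rightarrow> ('a \<Rightarrow> 'b \<Rightarrow> 'b) \<Rightarrow> ('a \<Rightarrow> 'a \<Rightarrow> 'b)
     \<Rightarrow> ('c \<Rightarrow> 'b) \<Rightarrow> ('c \<Rightarrow> 'b \<Rightarrow> 'b) \<Rightarrow> ('c \<Rightarrow> 'c \<Rightarrow> 'b) \<Rightarrow> ('a \<Rightarrow> 'c) \<Rightarrow> bool" where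
  "tms_comp_eq S m A \<alpha> lam f \<alpha>' lam' f' \<nu> \<longleftrightarrow>
     (\<forall>e\<in>idems S m. \<alpha> e = \<alpha>' (\<nu> e)) \<and>
     (\<forall>s\<in>S. \<forall>a\<in>A. lam s a = lam' (\<nu> s) a) \<and>
     (\<forall>s\<in>S. \<forall>t\<in>S. f s t = f' (\<nu> s) (\<nu> t))"

definition setprod :: "('b \<Rightarrow> 'b \<Rightarrow> 'b) \<Rightarrow> 'b set \<Rightarrow> 'b set \<Rightarrow> 'b set" where
  "setprod mA X Y = {mA a b | a b. a \<in> X \<and> b \<in> Y}"

definition is_ideal :: "'b set \<Rightarrow> ('b \<Rightarrow> 'b \<Rightarrow> 'b) \<Rightarrow> 'b set \<Rightarrow> bool" where
  "is_ideal A mA I \<longleftrightarrow> I \<subseteq> A \<and> I \<noteq> {} \<and> (\<forall>a\<in>A. \<forall>i\<in>I. mA a i \<in> I \<and> mA i a \<in> I)"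

text \<open>A multiplier w = (L,R) of T: \<open>w s = fst w s\<close>, \<open>s w = snd w s\<close>.\<close>
definition is_multiplier :: "'b set \<Rightarrow> ('b \<Rightarrow> 'b \<Rightarrow> 'b) \<Rightarrow> ('b \<Rightarrow> 'b) \<times> ('b \<Rightarrow> 'b) \<Rightarrow> bool" where
  "is_multiplier T mA w \<longleftrightarrow> (\<forall>s\<in>T. fst w s \<in> T \<and> snd w s \<in> T) \<and>
     (\<forall>s\<in>T. \<forall>t\<in>T. fst w (mA s t) = mA (fst w s) t \<and> snd w (mA s t) = mA s (snd w t) \<and>
                     mA s (fst w t) = mA (snd w s) t)"

text \<open>w' is the inverse of w in the monoid M(T) (product: L = L\<circ>L', R = R'\<circ>R; maps compared on T)\<close>
definition mult_inverse :: "'b set \<Rightarrow> ('b \<Rightarrow> 'b \<Rightarrow> 'b) \<Rightarrow> ('b \<Rightarrow> 'b) \<times> ('b \<Rightarrow> 'b)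
     \<Rightarrow> ('b \<Rightarrow> 'b) \<times> ('b \<Rightarrow> 'b) \<Rightarrow> bool" where
  "mult_inverse T mA w w' \<longleftrightarrow> is_multiplier T mA w \<and> is_multiplier T mA w' \<and>
     (\<forall>s\<in>T. fst w (fst w' s) = s \<and> fst w' (fst w s) = s \<and>
            snd w (snd w' s) = s \<and> snd w' (snd w s) = s)"

definition is_unit_multiplier :: "'b set \<Rightarrow> ('b \<Rightarrow> 'b \<Rightarrow> 'b) \<Rightarrow> ('b \<Rightarrow> 'b) \<times> ('b \<Rightarrow> 'b) \<Rightarrow> bool" where
  "is_unit_multiplier T mA w \<longleftrightarrow> (\<exists>w'. mult_inverse T mA w w')"

definition minv :: "'b set \<Rightarrow> ('b \<Rightarrow> 'b \<Rightarrow> 'b) \<Rightarrow> ('b \<Rightarrow> 'b) \<times> ('b \<Rightarrow> 'b) \<Rightarrow> ('b \<Rightarrow> 'b) \<times> ('b \<Rightarrow> 'b)" where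
  "minv T mA w = (SOME w'. mult_inverse T mA w w')"

definition tpa :: "'g monoid \<Rightarrow> 'b set \<Rightarrow> ('b \<Rightarrow> 'b \<Rightarrow> 'b) \<Rightarrow> ('g \<Rightarrow> 'b set)
     \<Rightarrow> ('g \<Rightarrow> 'b \<Rightarrow> 'b) \<Rightarrow> ('g \<Rightarrow> 'g \<Rightarrow> ('b \<Rightarrow> 'b) \<times> ('b \<Rightarrow> 'b)) \<Rightarrow> bool" where
  "tpa G A mA D \<theta> w \<longleftrightarrow> group G \<and>
     (\<forall>x\<in>carrier G. is_ideal A mA (D x) \<and>
        bij_betw (\<theta> x) (D (inv\<^bsub>G\<^esub> x)) (D x) \<and>
        (\<forall>a\<in>D (inv\<^bsub>G\<^esub> x). \<forall>b\<in>D (inv\<^bsub>G\<^esub> x). \<theta> x (mA a b) = mA (\<theta> x a) (\<theta> x b))) \<and>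
     (\<forall>x\<in>carrier G. \<forall>y\<in>carrier G.
        is_unit_multiplier (setprod mA (D x) (D (x \<otimes>\<^bsub>G\<^esub> y))) mA (w x y)) \<and>
     \<comment> \<open>(i)\<close>
     (\<forall>x\<in>carrier G. setprod mA (D x) (D x) = D x) \<and>
     (\<forall>x\<in>carrier G. \<forall>y\<in>carrier G. setprod mA (D x) (D y) = setprod mA (D y) (D x)) \<and>
     \<comment> \<open>(ii)\<close>
     D \<one>\<^bsub>G\<^esub> = A \<and> (\<forall>a\<in>A. \<theta> \<one>\<^bsub>G\<^esub> a = a) \<and>
     \<comment> \<open>(iii)\<close>
     (\<forall>x\<in>carrier G. \<forall>y\<in>carrier G.
        \<theta> x ` setprod mA (D (inv\<^bsub>G\<^esub> x)) (D y) = setprod mA (D x) (D (x \<otimes>\<^bsub>G\<^esub> y))) \<and>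
     \<comment> \<open>(iv)\<close>
     (\<forall>x\<in>carrier G. \<forall>y\<in>carrier G.
        \<forall>s\<in>setprod mA (D (inv\<^bsub>G\<^esub> y)) (D (inv\<^bsub>G\<^esub> y \<otimes>\<^bsub>G\<^esub> inv\<^bsub>G\<^esub> x)).
          \<theta> x (\<theta> y s) =
            snd (minv (setprod mA (D x) (D (x \<otimes>\<^bsub>G\<^esub> y))) mA (w x y))
                (fst (w x y) (\<theta> (x \<otimes>\<^bsub>G\<^esub> y) s))) \<and>
     \<comment> \<open>(v)\<close>
     (\<forall>x\<in>carrier G. \<forall>a\<in>D x. fst (w \<one>\<^bsub>G\<^esub> x) a = a \<and> snd (w \<one>\<^bsub>G\<^esub> x) a = a \<and>
                              fst (w x \<one>\<^bsub>G\<^esub>) a = a \<and> snd (w x \<one>\<^bsub>G\<^esub>) a = a) \<and>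
     \<comment> \<open>(vi)\<close>
     (\<forall>x\<in>carrier G. \<forall>y\<in>carrier G. \<forall>z\<in>carrier G.
        \<forall>s\<in>setprod mA (setprod mA (D (inv\<^bsub>G\<^esub> x)) (D y)) (D (y \<otimes>\<^bsub>G\<^esub> z)).
          snd (w x (y \<otimes>\<^bsub>G\<^esub> z)) (\<theta> x (snd (w y z) s)) =
          snd (w (x \<otimes>\<^bsub>G\<^esub> y) z) (snd (w x y) (\<theta> x s)))"

definition tpa_equiv :: "'g monoid \<Rightarrow> 'b set \<Rightarrow> ('b \<Rightarrow> 'b \<Rightarrow> 'b)
     \<Rightarrow> ('g \<Rightarrow> 'b set) \<Rightarrow> ('g \<Rightarrow> 'b \<Rightarrow> 'b) \<Rightarrow> ('g \<Rightarrow> 'g \<Rightarrow> ('b \<Rightarrow> 'b) \<times> ('b \<Rightarrow> 'b))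
     \<Rightarrow> ('g \<Rightarrow> 'b set) \<Rightarrow> ('g \<Rightarrow> 'b \<Rightarrow> 'b) \<Rightarrow> ('g \<Rightarrow> 'g \<Rightarrow> ('b \<Rightarrow> 'b) \<times> ('b \<Rightarrow> 'b)) \<Rightarrow> bool" where
  "tpa_equiv G A mA D \<theta> w D' \<theta>' w' \<longleftrightarrow>
     (\<forall>x\<in>carrier G. D' x = D x) \<and>
     (\<exists>\<epsilon>. \<forall>x\<in>carrier G. is_unit_multiplier (D x) mA (\<epsilon> x) \<and>
        (\<forall>s\<in>D (inv\<^bsub>G\<^esub> x). \<theta>' x s = snd (minv (D x) mA (\<epsilon> x)) (fst (\<epsilon> x) (\<theta> x s))) \<and>
        (\<forall>y\<in>carrier G. \<forall>s\<in>setprod mA (D (inv\<^bsub>G\<^esub> x)) (D y).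
           snd (\<epsilon> (x \<otimes>\<^bsub>G\<^esub> y)) (snd (w' x y) (\<theta>' x s)) =
           snd (w x y) (fst (\<epsilon> x) (\<theta> x (snd (\<epsilon> y) s)))))"

definition tpa_comp_eq :: "'g monoid \<Rightarrow> ('b \<Rightarrow> 'b \<Rightarrow> 'b)
     \<Rightarrow> ('g \<Rightarrow> 'b set) \<Rightarrow> ('g \<Rightarrow> 'b \<Rightarrow> 'b) \<Rightarrow> ('g \<Rightarrow> 'g \<Rightarrow> ('b \<Rightarrow> 'b) \<times> ('b \<Rightarrow> 'b))
     \<Rightarrow> ('h \<Rightarrow> 'b set) \<Rightarrow> ('h \<Rightarrow> 'b \<Rightarrow> 'b) \<Rightarrow> ('h \<Rightarrow> 'h \<Rightarrow> ('b \<Rightarrow> 'b) \<times> ('b \<Rightarrow> 'b))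
     \<Rightarrow> ('g \<Rightarrow> 'h) \<Rightarrow> bool" where
  "tpa_comp_eq G mA D \<theta> w D' \<theta>' w' \<nu> \<longleftrightarrow>
     (\<forall>x\<in>carrier G. D x = D' (\<nu> x) \<and>
        (\<forall>a\<in>D (inv\<^bsub>G\<^esub> x). \<theta> x a = \<theta>' (\<nu> x) a) \<and>
        (\<forall>y\<in>carrier G. \<forall>a\<in>setprod mA (D x) (D (x \<otimes>\<^bsub>G\<^esub> y)).
           fst (w x y) a = fst (w' (\<nu> x) (\<nu> y)) a \<and> snd (w x y) a = snd (w' (\<nu> x) (\<nu> y)) a))"

definition thD :: "'a set \<Rightarrow> ('a \<Rightarrow> 'a \<Rightarrow> 'a) \<Rightarrow> 'b set \<Rightarrow> ('b \<Rightarrow> 'b \<Rightarrow> 'b)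
     \<Rightarrow> ('a \<Rightarrow> 'b) \<Rightarrow> 'a set \<Rightarrow> 'b set" where
  "thD S m A mA \<alpha> X = (\<Union>s\<in>X. Agrp A mA (\<alpha> (m s (sinv S m s))))"

definition thTheta :: "'a set \<Rightarrow> ('a \<Rightarrow> 'a \<Rightarrow> 'a) \<Rightarrow> 'b set \<Rightarrow> ('b \<Rightarrow> 'b \<Rightarrow> 'b)
     \<Rightarrow> ('a \<Rightarrow> 'b) \<Rightarrow> ('a \<Rightarrow> 'b \<Rightarrow> 'b) \<Rightarrow> 'a set \<Rightarrow> 'b \<Rightarrow> 'b" where
  "thTheta S m A mA \<alpha> lam X a =
     lam (THE s. s \<in> X \<and> \<alpha> (m (sinv S m s) s) = mA a (sinv A mA a)) a"

definition pick_r :: "'a set \<Rightarrow> ('a \<Rightarrow> 'a \<Rightarrow> 'a) \<Rightarrow> 'b set \<Rightarrow> ('b \<Rightarrow> 'b \<Rightarrow> 'b)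
     \<Rightarrow> ('a \<Rightarrow> 'b) \<Rightarrow> 'a set \<Rightarrow> 'b \<Rightarrow> 'a" where
  "pick_r S m A mA \<alpha> X a = (THE s. s \<in> X \<and> \<alpha> (m s (sinv S m s)) = mA a (sinv A mA a))"

definition thW :: "'a set \<Rightarrow> ('a \<Rightarrow> 'a \<Rightarrow> 'a) \<Rightarrow> 'b set \<Rightarrow> ('b \<Rightarrow> 'b \<Rightarrow> 'b)
     \<Rightarrow> ('a \<Rightarrow> 'b) \<Rightarrow> ('a \<Rightarrow> 'a \<Rightarrow> 'b) \<Rightarrow> 'a set \<Rightarrow> 'a set \<Rightarrow> ('b \<Rightarrow> 'b) \<times> ('b \<Rightarrow> 'b)" where
  "thW S m A mA \<alpha> f X Y =
     (let c = (\<lambda>a. f (pick_r S m A mA \<alpha> X a)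
                     (m (sinv S m (pick_r S m A mA \<alpha> X a))
                        (pick_r S m A mA \<alpha> (X \<otimes>\<^bsub>maxgrp S m\<^esub> Y) a)))
      in (\<lambda>a. mA (c a) a, \<lambda>a. mA a (c a)))"

text \<open>E(A) *_\<theta> G: pairs (e,x) standing for e\<delta>_x\<close>
definition cross_car :: "'g monoid \<Rightarrow> ('b \<Rightarrow> 'b \<Rightarrow> 'b) \<Rightarrow> ('g \<Rightarrow> 'b set) \<Rightarrow> ('b \<times> 'g) set" where
  "cross_car G mA D = {(e, x). x \<in> carrier G \<and> e \<in> idems (D x) mA}"

definition theta_inv :: "'g monoid \<Rightarrow> ('g \<Rightarrow> 'b set) \<Rightarrow> ('g \<Rightarrow> 'b \<Rightarrow> 'b) \<Rightarrow> 'g \<Rightarrow> 'b \<Rightarrow> 'b" where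
  "theta_inv G D \<theta> x = the_inv_into (D (inv\<^bsub>G\<^esub> x)) (\<theta> x)"

definition cross_mult :: "'g monoid \<Rightarrow> ('b \<Rightarrow> 'b \<Rightarrow> 'b) \<Rightarrow> ('g \<Rightarrow> 'b set) \<Rightarrow> ('g \<Rightarrow> 'b \<Rightarrow> 'b)
     \<Rightarrow> 'b \<times> 'g \<Rightarrow> 'b \<times> 'g \<Rightarrow> 'b \<times> 'g" where
  "cross_mult G mA D \<theta> p q =
     (\<theta> (snd p) (mA (theta_inv G D \<theta> (snd p) (fst p)) (fst q)), snd p \<otimes>\<^bsub>G\<^esub> snd q)"

definition lmAlpha :: "'b \<times> 'g \<Rightarrow> 'b" where
  "lmAlpha p = fst p"

definition lmLam :: "'g monoid \<Rightarrow> ('b \<Rightarrow> 'b \<Rightarrow> 'b) \<Rightarrow> ('g \<Rightarrow> 'b set) \<Rightarrow> ('g \<Rightarrow> 'b \<Rightarrow> 'b)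
     \<Rightarrow> 'b \<times> 'g \<Rightarrow> 'b \<Rightarrow> 'b" where
  "lmLam G mA D \<theta> p a = \<theta> (snd p) (mA (theta_inv G D \<theta> (snd p) (fst p)) a)"

definition lmF :: "'g monoid \<Rightarrow> ('b \<Rightarrow> 'b \<Rightarrow> 'b) \<Rightarrow> ('g \<Rightarrow> 'b set) \<Rightarrow> ('g \<Rightarrow> 'b \<Rightarrow> 'b)
     \<Rightarrow> ('g \<Rightarrow> 'g \<Rightarrow> ('b \<Rightarrow> 'b) \<times> ('b \<Rightarrow> 'b)) \<Rightarrow> 'b \<times> 'g \<Rightarrow> 'b \<times> 'g \<Rightarrow> 'b" where
  "lmF G mA D \<theta> w p q =
     snd (w (snd p) (snd q)) (\<theta> (snd p) (mA (theta_inv G D \<theta> (snd p) (fst p)) (fst q)))"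

end

theory Submission
  imports Defs
begin

text \<open>
  In a semilattice of groups every element \<open>a\<close> sits in the group at the central idempotent
  \<open>rg a = a a\<^sup>-\<^sup>1\<close>, so products of ideals are intersections and a unit multiplier of an ideal is a
  compatible choice of an element \<open>c e\<close> in the group at each idempotent \<open>e\<close>.  A twist \<open>w\<close> is thus
  a family \<open>c x y e\<close>.

  In an \<open>E\<close>-unitary semigroup an element is determined by its \<open>\<sigma>\<close>-class \<open>x\<close> together with \<open>s s\<^sup>-\<^sup>1\<close>,
  so \<open>s\<close> may be replaced by the pair \<open>(\<alpha> (s s\<^sup>-\<^sup>1), x)\<close>.  The Sieben condition gives
  \<open>\<lambda>\<^bsub>s e\<^esub>(a) = \<lambda>\<^sub>s(\<alpha>(e) a)\<close> and \<open>f(s e, t) = f(s, e t)\<close>, so \<open>\<lambda>\<close> and \<open>f\<close> are determined by their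
  values where domains and ranges match, and these are the values of \<open>\<theta>\<close> and \<open>c\<close>.  Conversely, on idempotents
  the twist acts trivially, so \<open>\<theta>\<close> restricts to a genuine partial action of \<open>G\<close> on \<open>E(A)\<close>, and the
  composition law \<open>\<lambda>\<^sub>p \<lambda>\<^sub>q = f(p, q) \<lambda>\<^bsub>p q\<^esub> f(p, q)\<^sup>-\<^sup>1\<close> specialises there to associativity of
  \<open>E(A) *\<^sub>\<theta> G\<close>.
\<close>

section \<open>Inverse semigroups\<close>

text \<open>Both sides carry one datum on different domains: each \<open>lam s\<close> is a total
  endomorphism cut down by an idempotent, each \<open>\<theta> x\<close> a partial map glued from
  many \<open>lam s\<close>. Gluing is the obstacle one way: two factors in \<open>D (inv x)\<close>
  may be moved by different members of the class \<open>x\<close>, and multiplicativity of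
  \<open>\<theta> x\<close> needs their common restriction. Restricting is the obstacle the other
  way: the axioms for \<open>w\<close> refer to the range of the element being moved, whereas
  \<open>F p q\<close> is the twist at a possibly larger idempotent, so the compatibility
  \<open>c x y (e \<odot> f) = c x y e \<odot> f\<close> has to compare them. Likewise
  \<open>\<theta> (inv x)\<close> in general inverts \<open>\<theta> x\<close> only up to
  conjugation, but on idempotents it is a true inverse, which gives explicit inverses in the crossed
  product. Equivalences rest on rigidity at idempotents: a witness \<open>g\<close> must satisfy
  \<open>g e = \<alpha> e\<close>, which makes it a compatible family and hence a family of unit
  multipliers; conversely conjugation by \<open>\<epsilon> x\<close> fixes idempotents, so
  equivalent actions have the same crossed product.\<close>

lemma inverse_semigroupI:
  assumes ne: "S \<noteq> {}" and sg: "sg_on S m"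
    and reg: "\<And>a. a \<in> S \<Longrightarrow> \<exists>b. is_inverse_of S m a b"
    and comm: "\<And>e f. e \<in> idems S m \<Longrightarrow> f \<in> idems S m \<Longrightarrow> m e f = m f e"
  shows "inverse_semigroup S m"
proof -
  have cl: "m a b \<in> S" if "a \<in> S" "b \<in> S" for a b
    using sg that by (simp add: sg_on_def)
  have as: "m (m a b) c = m a (m b c)" if "a \<in> S" "b \<in> S" "c \<in> S" for a b c
    using sg that by (simp add: sg_on_def)
  have "b = c" if a: "a \<in> S" and b: "is_inverse_of S m a b" and c: "is_inverse_of S m a c" for a b c
  proof -
    have S: "b \<in> S" "c \<in> S" using b c by (auto simp: is_inverse_of_def)
    have eq: "m a (m b a) = a" "m b (m a b) = b" "m a (m c a) = a" "m c (m a c) = c"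
      using b c a S by (auto simp: is_inverse_of_def as)
    have id: "m a b \<in> idems S m" "m a c \<in> idems S m" "m b a \<in> idems S m" "m c a \<in> idems S m"
      using a S eq by (auto simp: idems_def as cl)
    \<comment> \<open>Two inverses \<open>b\<close>, \<open>c\<close> of \<open>a\<close> are merged
      by swapping the idempotents \<open>a b\<close>, \<open>a c\<close> and then
      \<open>b a\<close>, \<open>c a\<close>. For the crossed product it then suffices to exhibit
      inverses and to commute explicit idempotents.\<close>
    have "b = m b (m (m a c) (m a b))" using a S eq by (metis as cl)
    also have "\<dots> = m b (m (m a b) (m a c))" using comm id by simp
    also have "\<dots> = m b (m a c)" using a S eq by (metis as cl)
    also have "\<dots> = m (m (m b a) (m c a)) c" using a S eq by (metis as cl)
    also have "\<dots> = m (m (m c a) (m b a)) c" using comm id by simp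
    also have "\<dots> = m c (m a c)" using a S eq by (metis as cl)
    finally show ?thesis using eq by simp
  qed
  then show ?thesis unfolding inverse_semigroup_def using ne sg reg by metis
qed

locale inv_sg =
  fixes S :: "'a set" and m :: "'a \<Rightarrow> 'a \<Rightarrow> 'a" (infixl "\<cdot>" 70)
  assumes inverse_semigroup: "inverse_semigroup S m"
begin

abbreviation iv :: "'a \<Rightarrow> 'a" where "iv \<equiv> sinv S m"
abbreviation E :: "'a set" where "E \<equiv> idems S m"

text \<open>With \<open>a\<close> seen as a partial bijection, \<open>rg a\<close> and
  \<open>dm a\<close> are the identities of its range and domain; \<open>dm a = rg b\<close> says
  that \<open>a\<close> and \<open>b\<close> compose without any restriction.\<close>

definition rg :: "'a \<Rightarrow> 'a" where "rg a = a \<cdot> iv a"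
definition dm :: "'a \<Rightarrow> 'a" where "dm a = iv a \<cdot> a"

lemma closed [simp, intro]: "a \<in> S \<Longrightarrow> b \<in> S \<Longrightarrow> a \<cdot> b \<in> S"
  using inverse_semigroup by (simp add: inverse_semigroup_def sg_on_def)

lemma assoc: "a \<in> S \<Longrightarrow> b \<in> S \<Longrightarrow> c \<in> S \<Longrightarrow> a \<cdot> b \<cdot> c = a \<cdot> (b \<cdot> c)"
  using inverse_semigroup by (simp add: inverse_semigroup_def sg_on_def)

lemma nonempty: "S \<noteq> {}"
  using inverse_semigroup by (simp add: inverse_semigroup_def)

lemma is_inverse_of_iv: "a \<in> S \<Longrightarrow> is_inverse_of S m a (iv a)"
  using inverse_semigroup unfolding inverse_semigroup_def sinv_def by (metis theI')

lemma iv_closed [simp, intro]: "a \<in> S \<Longrightarrow> iv a \<in> S"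
  using is_inverse_of_iv by (auto simp: is_inverse_of_def)

lemma mult_iv_mult: "a \<in> S \<Longrightarrow> a \<cdot> iv a \<cdot> a = a"
  using is_inverse_of_iv by (auto simp: is_inverse_of_def)

lemma iv_mult_iv: "a \<in> S \<Longrightarrow> iv a \<cdot> a \<cdot> iv a = iv a"
  using is_inverse_of_iv by (auto simp: is_inverse_of_def)

lemma iv_eqI:
  assumes "a \<in> S" "b \<in> S" "a \<cdot> b \<cdot> a = a" "b \<cdot> a \<cdot> b = b"
  shows "iv a = b"
proof -
  have "is_inverse_of S m a b" using assms by (simp add: is_inverse_of_def)
  then show ?thesis
    using is_inverse_of_iv[of a] assms(1) inverse_semigroup
    unfolding inverse_semigroup_def by blast
qed

lemma iv_iv [simp]: "a \<in> S \<Longrightarrow> iv (iv a) = a"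
  by (rule iv_eqI) (simp_all add: mult_iv_mult iv_mult_iv)

lemma idem_closed [simp, intro]: "e \<in> E \<Longrightarrow> e \<in> S"
  by (simp add: idems_def)

lemma idem_mult_self [simp]: "e \<in> E \<Longrightarrow> e \<cdot> e = e"
  unfolding idems_def by blast

lemma idemI: "e \<in> S \<Longrightarrow> e \<cdot> e = e \<Longrightarrow> e \<in> E"
  unfolding idems_def by blast

lemma iv_idem [simp]: "e \<in> E \<Longrightarrow> iv e = e"
  by (rule iv_eqI) simp_all

text \<open>If \<open>x\<close> is the inverse of \<open>e f\<close>, then so is
  \<open>f x e\<close>; uniqueness gives \<open>x = f x e\<close>, which makes \<open>x\<close>
  idempotent. An idempotent is its own inverse, so \<open>e f = x\<close>.\<close>

lemma idem_mult_idem [simp, intro]: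
  assumes e: "e \<in> E" and f: "f \<in> E"
  shows "e \<cdot> f \<in> E"
proof -
  define x where "x = iv (e \<cdot> f)"
  have S: "e \<in> S" "f \<in> S" "x \<in> S" using e f by (auto simp: x_def)
  have ee: "e \<cdot> (e \<cdot> a) = e \<cdot> a" "f \<cdot> (f \<cdot> a) = f \<cdot> a" if "a \<in> S" for a
    using that S e f by (simp_all flip: assoc)
  have x1: "e \<cdot> (f \<cdot> (x \<cdot> (e \<cdot> f))) = e \<cdot> f"
    using mult_iv_mult[of "e \<cdot> f"] S by (simp add: x_def[symmetric] assoc)
  have x2: "x \<cdot> (e \<cdot> (f \<cdot> x)) = x"
    using iv_mult_iv[of "e \<cdot> f"] S by (simp add: x_def[symmetric] assoc)
  have x2': "x \<cdot> (e \<cdot> (f \<cdot> (x \<cdot> a))) = x \<cdot> a" if "a \<in> S" for a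
    using x2 that S by (metis assoc closed)
  have "iv (e \<cdot> f) = f \<cdot> x \<cdot> e"
    by (rule iv_eqI) (use S x1 x2' in \<open>simp_all add: assoc ee\<close>)
  then have x3: "x = f \<cdot> x \<cdot> e" by (simp add: x_def)
  then have fx: "f \<cdot> x = x" "x \<cdot> e = x"
    using S e f by (metis assoc closed idem_mult_self)+
  have "x \<cdot> x = x \<cdot> (e \<cdot> (f \<cdot> x))" using S fx by (metis assoc)
  then have "x \<in> E" using x2 S by (intro idemI) simp_all
  moreover have "iv x = e \<cdot> f" using S by (simp add: x_def)
  ultimately show ?thesis by simp
qed

text \<open>Since \<open>e f\<close> and \<open>f e\<close> are both idempotent, \<open>f e\<close>
  is an inverse of \<open>e f\<close>; but \<open>e f\<close> is its own inverse.\<close>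

lemma idem_comm:
  assumes e: "e \<in> E" and f: "f \<in> E"
  shows "e \<cdot> f = f \<cdot> e"
proof -
  have S: "e \<in> S" "f \<in> S" using e f by auto
  have ef: "e \<cdot> f \<cdot> (e \<cdot> f) = e \<cdot> f" "f \<cdot> e \<cdot> (f \<cdot> e) = f \<cdot> e"
    using e f by (meson idem_mult_idem idem_mult_self)+
  have "iv (e \<cdot> f) = f \<cdot> e"
  proof (rule iv_eqI)
    show "e \<cdot> f \<cdot> (f \<cdot> e) \<cdot> (e \<cdot> f) = e \<cdot> f"
      using ef S e f by (metis assoc closed idem_mult_self)
    show "f \<cdot> e \<cdot> (e \<cdot> f) \<cdot> (f \<cdot> e) = f \<cdot> e"
      using ef S e f by (metis assoc closed idem_mult_self)
  qed (use S in auto)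
  then show ?thesis using e f by simp
qed

lemma rg_idem [simp, intro]: "a \<in> S \<Longrightarrow> rg a \<in> E"
  unfolding rg_def by (intro idemI) (simp_all add: mult_iv_mult flip: assoc)

lemma dm_idem [simp, intro]: "a \<in> S \<Longrightarrow> dm a \<in> E"
  unfolding dm_def by (intro idemI) (simp_all add: iv_mult_iv flip: assoc)

lemma rg_mult_self [simp]: "a \<in> S \<Longrightarrow> rg a \<cdot> a = a"
  by (simp add: rg_def mult_iv_mult)

lemma mult_dm_self [simp]: "a \<in> S \<Longrightarrow> a \<cdot> dm a = a"
  by (simp add: dm_def mult_iv_mult flip: assoc)

lemma rg_of_idem [simp]: "e \<in> E \<Longrightarrow> rg e = e"
  by (simp add: rg_def)

lemma dm_of_idem [simp]: "e \<in> E \<Longrightarrow> dm e = e"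
  by (simp add: dm_def)

lemma rg_iv [simp]: "a \<in> S \<Longrightarrow> rg (iv a) = dm a"
  by (simp add: rg_def dm_def)

lemma dm_iv [simp]: "a \<in> S \<Longrightarrow> dm (iv a) = rg a"
  by (simp add: rg_def dm_def)

lemma iv_mult:
  assumes "a \<in> S" "b \<in> S"
  shows "iv (a \<cdot> b) = iv b \<cdot> iv a"
proof (rule iv_eqI)
  have c: "dm a \<cdot> rg b = rg b \<cdot> dm a" using assms by (simp add: idem_comm)
  have "a \<cdot> b \<cdot> (iv b \<cdot> iv a) \<cdot> (a \<cdot> b) = a \<cdot> (rg b \<cdot> dm a) \<cdot> b"
    using assms by (simp add: rg_def dm_def assoc)
  also have "\<dots> = a \<cdot> dm a \<cdot> (rg b \<cdot> b)"
    using assms by (simp only: c[symmetric] assoc rg_idem dm_idem idem_closed closed)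
  finally show "a \<cdot> b \<cdot> (iv b \<cdot> iv a) \<cdot> (a \<cdot> b) = a \<cdot> b" using assms by simp
  have "iv b \<cdot> iv a \<cdot> (a \<cdot> b) \<cdot> (iv b \<cdot> iv a) = iv b \<cdot> (dm a \<cdot> rg b) \<cdot> iv a"
    using assms by (simp add: rg_def dm_def assoc)
  also have "\<dots> = (iv b \<cdot> rg b) \<cdot> (dm a \<cdot> iv a)"
    using assms by (simp only: c assoc rg_idem dm_idem idem_closed closed iv_closed)
  also have "\<dots> = iv b \<cdot> iv a"
    using assms mult_dm_self[of "iv b"] rg_mult_self[of "iv a"] by simp
  finally show "iv b \<cdot> iv a \<cdot> (a \<cdot> b) \<cdot> (iv b \<cdot> iv a) = iv b \<cdot> iv a" .
qed (use assms in auto)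

lemma rg_mult: "a \<in> S \<Longrightarrow> b \<in> S \<Longrightarrow> rg (a \<cdot> b) = a \<cdot> rg b \<cdot> iv a"
  by (simp add: rg_def iv_mult assoc)

lemma dm_mult: "a \<in> S \<Longrightarrow> b \<in> S \<Longrightarrow> dm (a \<cdot> b) = iv b \<cdot> dm a \<cdot> b"
  by (simp add: dm_def iv_mult assoc)

lemma conj_idem [simp, intro]: "a \<in> S \<Longrightarrow> e \<in> E \<Longrightarrow> a \<cdot> e \<cdot> iv a \<in> E"
  using rg_mult[of a e] rg_idem[of "a \<cdot> e"] by simp

text \<open>Carries an idempotent from the right of \<open>a\<close> to its left at the price of a
  conjugation. This converts the one-sided definition of the congruence into statements about right
  factors.\<close>

lemma mult_idem_shift:
  assumes "a \<in> S" "e \<in> E"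
  shows "a \<cdot> e \<cdot> iv a \<cdot> a = a \<cdot> e"
proof -
  have "a \<cdot> e \<cdot> iv a \<cdot> a = a \<cdot> (e \<cdot> dm a)"
    using assms by (simp add: dm_def assoc)
  also have "\<dots> = a \<cdot> dm a \<cdot> e"
    using assms by (simp only: idem_comm[of e "dm a"] assoc dm_idem idem_closed)
  finally show ?thesis using assms by simp
qed

lemma rg_idem_mult:
  assumes "a \<in> S" "e \<in> E" shows "rg (e \<cdot> a) = e \<cdot> rg a"
proof -
  have "rg (e \<cdot> a) = e \<cdot> (rg a \<cdot> e)" using assms by (simp add: rg_mult assoc)
  also have "\<dots> = e \<cdot> e \<cdot> rg a"
    using assms by (simp only: idem_comm[of "rg a" e] assoc rg_idem idem_closed)
  finally show ?thesis using assms by simp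
qed

lemma dm_mult_idem:
  assumes "a \<in> S" "e \<in> E" shows "dm (a \<cdot> e) = dm a \<cdot> e"
  using rg_idem_mult[of "iv a" e] assms
  by (metis dm_idem iv_mult closed rg_iv iv_closed iv_idem idem_closed idem_comm)

lemma rg_mult_composable: "a \<in> S \<Longrightarrow> b \<in> S \<Longrightarrow> dm a = rg b \<Longrightarrow> rg (a \<cdot> b) = rg a"
  by (metis mult_dm_self rg_def rg_mult)

lemma dm_mult_composable: "a \<in> S \<Longrightarrow> b \<in> S \<Longrightarrow> dm a = rg b \<Longrightarrow> dm (a \<cdot> b) = dm b"
  by (metis assoc dm_def dm_mult iv_closed rg_def rg_mult_self idem_closed rg_idem)

lemma rg_mult_rg_left [simp]: "a \<in> S \<Longrightarrow> b \<in> S \<Longrightarrow> rg a \<cdot> rg (a \<cdot> b) = rg (a \<cdot> b)"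
  using rg_idem_mult[of "a \<cdot> b" "rg a"] by (simp flip: assoc)

lemma rg_mult_rg_right: "a \<in> S \<Longrightarrow> b \<in> S \<Longrightarrow> rg (a \<cdot> rg b) = rg (a \<cdot> b)"
  by (simp add: rg_mult)

lemma dm_mult_dm_right [simp]: "a \<in> S \<Longrightarrow> b \<in> S \<Longrightarrow> dm (a \<cdot> b) \<cdot> dm b = dm (a \<cdot> b)"
  using dm_mult_idem[of "a \<cdot> b" "dm b"] by (simp add: assoc)

section \<open>The minimum group congruence and the maximal group image\<close>

abbreviation cls :: "'a \<Rightarrow> 'a set" where "cls \<equiv> sig_cls S m"
abbreviation G :: "'a set monoid" where "G \<equiv> maxgrp S m"

lemma mem_cls_iff: "t \<in> cls s \<longleftrightarrow> t \<in> S \<and> (\<exists>e\<in>E. e \<cdot> s = e \<cdot> t)"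
  by (simp add: sig_cls_def)

lemma mem_cls_self [simp, intro]:
  assumes "s \<in> S" shows "s \<in> cls s"
  using assms rg_idem by (auto simp: mem_cls_iff)

lemma cls_trans:
  assumes "s \<in> S" "t \<in> cls s" "u \<in> cls t" shows "u \<in> cls s"
proof -
  obtain e f where ef: "e \<in> E" "f \<in> E" "e \<cdot> s = e \<cdot> t" "f \<cdot> t = f \<cdot> u" "t \<in> S" "u \<in> S"
    using assms by (auto simp: mem_cls_iff)
  have "f \<cdot> e \<cdot> s = f \<cdot> (e \<cdot> t)" using ef assms by (simp add: assoc)
  also have "\<dots> = e \<cdot> (f \<cdot> t)" using ef by (metis assoc idem_closed idem_comm)
  also have "\<dots> = f \<cdot> e \<cdot> u" using ef by (metis assoc idem_closed idem_comm)
  finally show ?thesis using ef by (auto simp: mem_cls_iff)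
qed

lemma cls_sym: "s \<in> S \<Longrightarrow> t \<in> cls s \<Longrightarrow> s \<in> cls t"
  unfolding mem_cls_iff by metis

lemma cls_eq: "s \<in> S \<Longrightarrow> t \<in> cls s \<Longrightarrow> cls t = cls s"
  by (metis cls_sym cls_trans mem_cls_iff subsetI subset_antisym)

lemma cls_mult:
  assumes "s \<in> S" "t \<in> S" "s' \<in> cls s" "t' \<in> cls t"
  shows "s' \<cdot> t' \<in> cls (s \<cdot> t)"
proof -
  obtain e f where ef: "e \<in> E" "f \<in> E" "e \<cdot> s = e \<cdot> s'" "f \<cdot> t = f \<cdot> t'" "s' \<in> S" "t' \<in> S"
    using assms by (auto simp: mem_cls_iff)
  have "e \<cdot> (s \<cdot> t) = e \<cdot> (s' \<cdot> t)" using ef assms by (metis assoc idem_closed)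
  then have 1: "s' \<cdot> t \<in> cls (s \<cdot> t)" using ef assms by (auto simp: mem_cls_iff)
  \<comment> \<open>The idempotent equalising \<open>t\<close> and \<open>t'\<close> is wanted
    between \<open>s'\<close> and \<open>t\<close>; its conjugate by \<open>s'\<close> has the same
    effect from the front.\<close>
  have "s' \<cdot> f \<cdot> iv s' \<cdot> (s' \<cdot> t) = s' \<cdot> f \<cdot> iv s' \<cdot> s' \<cdot> t"
    using ef assms by (simp add: assoc)
  also have "\<dots> = s' \<cdot> (f \<cdot> t)" using ef assms by (simp only: mult_idem_shift assoc idem_closed)
  also have "\<dots> = s' \<cdot> f \<cdot> iv s' \<cdot> s' \<cdot> t'"
    using ef assms by (simp only: mult_idem_shift assoc idem_closed)
  also have "\<dots> = s' \<cdot> f \<cdot> iv s' \<cdot> (s' \<cdot> t')" using ef assms by (simp add: assoc)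
  finally have "s' \<cdot> t' \<in> cls (s' \<cdot> t)"
    using ef assms conj_idem[of s' f] by (auto simp: mem_cls_iff)
  with 1 show ?thesis using cls_trans assms by blast
qed

lemma idem_cls: "e \<in> E \<Longrightarrow> f \<in> E \<Longrightarrow> f \<in> cls e"
  unfolding mem_cls_iff
  by (intro conjI bexI[of _ "e \<cdot> f"]) (auto, metis assoc idem_closed idem_comm idem_mult_self)

lemma carrier_G: "carrier G = cls ` S"
  by (simp add: maxgrp_def)

lemma cls_carrier [simp, intro]: "s \<in> S \<Longrightarrow> cls s \<in> carrier G"
  by (simp add: carrier_G)

lemma mem_carrier_closed: "x \<in> carrier G \<Longrightarrow> s \<in> x \<Longrightarrow> s \<in> S"
  by (auto simp: carrier_G mem_cls_iff)

lemma mem_carrier_cls: "x \<in> carrier G \<Longrightarrow> s \<in> x \<Longrightarrow> cls s = x"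
  unfolding carrier_G using cls_eq by blast

lemma mem_carrier_nonempty: "x \<in> carrier G \<Longrightarrow> \<exists>s. s \<in> x"
  by (auto simp: carrier_G)

text \<open>\<open>maxgrp\<close> multiplies classes through representatives chosen by
  \<open>SOME\<close>; compatibility of the congruence with products frees the result from that
  choice.\<close>

lemma mult_eq_cls:
  assumes "x \<in> carrier G" "y \<in> carrier G" "s \<in> x" "t \<in> y"
  shows "x \<otimes>\<^bsub>G\<^esub> y = cls (s \<cdot> t)"
proof -
  let ?s = "SOME s. s \<in> x" and ?t = "SOME t. t \<in> y"
  have "?s \<in> x" "?t \<in> y" using assms(3,4) by (auto intro: someI)
  then have "?s \<cdot> ?t \<in> cls (s \<cdot> t)"
    using assms by (intro cls_mult) (auto simp: mem_carrier_cls mem_carrier_closed)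
  moreover have "s \<cdot> t \<in> S" using assms by (auto simp: mem_carrier_closed)
  ultimately have "cls (?s \<cdot> ?t) = cls (s \<cdot> t)" by (metis cls_eq)
  then show ?thesis by (simp add: maxgrp_def)
qed

lemma cls_mult_cls: "s \<in> S \<Longrightarrow> t \<in> S \<Longrightarrow> cls s \<otimes>\<^bsub>G\<^esub> cls t = cls (s \<cdot> t)"
  by (rule mult_eq_cls) auto

lemma idem_exists: "\<exists>e. e \<in> E"
  using nonempty rg_idem by blast

lemma one_eq_cls:
  assumes "e \<in> E" shows "\<one>\<^bsub>G\<^esub> = cls e"
proof -
  have "(SOME e. e \<in> E) \<in> E" using idem_exists by (rule someI_ex)
  then have "(SOME e. e \<in> E) \<in> cls e" using assms by (simp add: idem_cls)
  then have "cls (SOME e. e \<in> E) = cls e" using assms by (intro cls_eq) auto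
  then show ?thesis by (simp add: maxgrp_def)
qed

lemma idem_mult_cls: "s \<in> S \<Longrightarrow> e \<in> E \<Longrightarrow> cls (e \<cdot> s) = cls s"
  by (rule cls_eq) (auto simp: mem_cls_iff intro!: bexI[of _ e] simp flip: assoc)

lemma mult_idem_cls:
  assumes "s \<in> S" "e \<in> E" shows "cls (s \<cdot> e) = cls s"
  using idem_mult_cls[of s "s \<cdot> e \<cdot> iv s"] assms by (simp add: mult_idem_shift)

lemma group_maxgrp: "group G"
proof (rule groupI)
  obtain e where e: "e \<in> E" using idem_exists by blast
  show "\<one>\<^bsub>G\<^esub> \<in> carrier G" using e by (auto simp: one_eq_cls)
  show "x \<otimes>\<^bsub>G\<^esub> y \<in> carrier G" if "x \<in> carrier G" "y \<in> carrier G" for x y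
    using that by (auto simp: carrier_G cls_mult_cls)
  show "x \<otimes>\<^bsub>G\<^esub> y \<otimes>\<^bsub>G\<^esub> z = x \<otimes>\<^bsub>G\<^esub> (y \<otimes>\<^bsub>G\<^esub> z)"
    if "x \<in> carrier G" "y \<in> carrier G" "z \<in> carrier G" for x y z
    using that by (auto simp: carrier_G cls_mult_cls assoc)
  show "\<one>\<^bsub>G\<^esub> \<otimes>\<^bsub>G\<^esub> x = x" if "x \<in> carrier G" for x
    using that e by (auto simp: carrier_G one_eq_cls[OF e] cls_mult_cls idem_mult_cls)
  show "\<exists>y\<in>carrier G. y \<otimes>\<^bsub>G\<^esub> x = \<one>\<^bsub>G\<^esub>" if "x \<in> carrier G" for x
  proof -
    obtain s where s: "s \<in> S" "x = cls s" using \<open>x \<in> carrier G\<close> by (auto simp: carrier_G)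
    then have "cls (iv s) \<otimes>\<^bsub>G\<^esub> x = \<one>\<^bsub>G\<^esub>"
      by (simp add: cls_mult_cls one_eq_cls[of "dm s"]) (simp add: dm_def)
    then show ?thesis using s by blast
  qed
qed

lemma inv_cls: "s \<in> S \<Longrightarrow> inv\<^bsub>G\<^esub> cls s = cls (iv s)"
proof (rule group.inv_equality[OF group_maxgrp])
  assume "s \<in> S"
  then show "cls (iv s) \<otimes>\<^bsub>G\<^esub> cls s = \<one>\<^bsub>G\<^esub>"
    by (simp add: cls_mult_cls one_eq_cls[of "dm s"]) (simp add: dm_def)
qed auto

lemma mult_mem:
  assumes "x \<in> carrier G" "y \<in> carrier G" "s \<in> x" "t \<in> y"
  shows "s \<cdot> t \<in> x \<otimes>\<^bsub>G\<^esub> y"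
  unfolding mult_eq_cls[OF assms] using assms by (intro mem_cls_self closed mem_carrier_closed)

lemma iv_mem:
  assumes "x \<in> carrier G" "s \<in> x"
  shows "iv s \<in> inv\<^bsub>G\<^esub> x"
  using inv_cls mem_carrier_cls[OF assms] mem_carrier_closed[OF assms]
  by (metis iv_closed mem_cls_self)

lemma idem_mult_mem:
  assumes "x \<in> carrier G" "s \<in> x" "e \<in> E"
  shows "e \<cdot> s \<in> x"
  using idem_mult_cls mem_carrier_cls[OF assms(1,2)] mem_carrier_closed[OF assms(1,2)] assms(3)
  by (metis closed idem_closed mem_cls_self)

lemma mult_idem_mem:
  assumes "x \<in> carrier G" "s \<in> x" "e \<in> E"
  shows "s \<cdot> e \<in> x"
  using mult_idem_cls mem_carrier_cls[OF assms(1,2)] mem_carrier_closed[OF assms(1,2)] assms(3)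
  by (metis closed idem_closed mem_cls_self)

lemma idem_mem_one: "e \<in> E \<Longrightarrow> e \<in> \<one>\<^bsub>G\<^esub>"
  by (metis idem_closed mem_cls_self one_eq_cls)

end

section \<open>E-unitary inverse semigroups: elements as pairs of an idempotent and a class\<close>

locale eunitary_sg = inv_sg +
  assumes E_unitary: "E_unitary S m"
begin

text \<open>The quotient \<open>p = iv s \<cdot> t\<close> lies above the idempotent
  \<open>iv s \<cdot> e \<cdot> s\<close>, so E-unitarity makes it idempotent. Hence
  \<open>t = s \<cdot> p\<close> is a restriction of \<open>s\<close>, and a restriction with the
  full range is no restriction at all.\<close>

lemma cls_rg_unique:
  assumes x: "x \<in> carrier G" and s: "s \<in> x" and t: "t \<in> x" and r: "rg s = rg t"
  shows "s = t"
proof -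
  have S: "s \<in> S" "t \<in> S" using x s t by (auto simp: mem_carrier_closed)
  have "t \<in> cls s" using mem_carrier_cls[OF x s] t by simp
  then obtain e where e: "e \<in> E" "e \<cdot> s = e \<cdot> t" by (auto simp: mem_cls_iff)
  define p where "p = iv s \<cdot> t"
  have pS: "p \<in> S" using S by (simp add: p_def)
  have f: "iv s \<cdot> e \<cdot> s \<in> E" using conj_idem[of "iv s" e] S e by simp
  have "iv s \<cdot> e \<cdot> s = iv s \<cdot> e \<cdot> iv (iv s) \<cdot> iv s \<cdot> t"
    using mult_idem_shift[of "iv s" e] S e by (simp add: assoc)
  also have "\<dots> = (iv s \<cdot> e \<cdot> s) \<cdot> p" using S e(1) by (simp add: p_def assoc)
  finally have "nat_le S m (iv s \<cdot> e \<cdot> s) p" using f by (auto simp: nat_le_def)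
  then have pE: "p \<in> E" using E_unitary f pS unfolding E_unitary_def by blast
  have tsp: "t = s \<cdot> p"
  proof -
    have "s \<cdot> p = rg s \<cdot> t" using S by (simp add: p_def rg_def assoc)
    then show ?thesis using r S by simp
  qed
  have "rg t \<cdot> s = s \<cdot> p \<cdot> iv s \<cdot> s" using S pE unfolding tsp by (simp add: rg_mult)
  also have "\<dots> = t" using S pE by (simp add: mult_idem_shift tsp)
  finally show ?thesis using r S by (metis rg_mult_self)
qed

lemma cls_dm_unique:
  assumes x: "x \<in> carrier G" and s: "s \<in> x" and t: "t \<in> x" and r: "dm s = dm t"
  shows "s = t"
proof -
  have S: "s \<in> S" "t \<in> S" using x s t by (auto simp: mem_carrier_closed)
  have "iv s = iv t"
    using cls_rg_unique[of "inv\<^bsub>G\<^esub> x" "iv s" "iv t"] x s t r S group_maxgrp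
    by (simp add: iv_mem group.inv_closed)
  then show ?thesis using S by (metis iv_iv)
qed

end

section \<open>Semilattices of groups and unit multipliers\<close>

locale clifford = inv_sg A mA for A :: "'b set" and mA :: "'b \<Rightarrow> 'b \<Rightarrow> 'b" (infixl "\<odot>" 70) +
  assumes idem_central: "e \<in> E \<Longrightarrow> a \<in> A \<Longrightarrow> e \<odot> a = a \<odot> e"
begin

lemma idem_left_comm: "e \<in> E \<Longrightarrow> a \<in> A \<Longrightarrow> b \<in> A \<Longrightarrow> a \<odot> (e \<odot> b) = e \<odot> (a \<odot> b)"
  by (metis assoc idem_central idem_closed)

text \<open>Centrality pulls \<open>dm a\<close> out of \<open>a \<odot> dm a \<odot> iv a\<close>,
  so \<open>rg a\<close> lies below \<open>dm a\<close>; the mirror argument gives the other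
  inequality.\<close>

lemma dm_eq_rg [simp]:
  assumes "a \<in> A" shows "dm a = rg a"
proof -
  have 1: "rg a = rg a \<odot> dm a"
  proof -
    have "rg a = a \<odot> dm a \<odot> iv a" using assms by (simp add: rg_def)
    also have "\<dots> = dm a \<odot> (a \<odot> iv a)" using assms by (metis assoc dm_idem idem_central idem_closed iv_closed)
    finally show ?thesis using assms by (metis dm_idem idem_comm rg_def rg_idem)
  qed
  have 2: "dm a = rg a \<odot> dm a"
  proof -
    have "dm a = iv a \<odot> (rg a \<odot> a)" using assms by (simp add: dm_def)
    also have "\<dots> = rg a \<odot> (iv a \<odot> a)" using assms by (metis idem_left_comm iv_closed rg_idem)
    finally show ?thesis by (simp add: dm_def)
  qed
  show ?thesis using 1 2 by simp
qed

lemma mult_iv [simp]: "a \<in> A \<Longrightarrow> a \<odot> iv a = rg a"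
  by (simp add: rg_def)

lemma iv_mult_self [simp]: "a \<in> A \<Longrightarrow> iv a \<odot> a = rg a"
  by (metis dm_def dm_eq_rg)

lemma mult_rg_self [simp]: "a \<in> A \<Longrightarrow> a \<odot> rg a = a"
  by (metis dm_eq_rg mult_dm_self)

lemma rg_mult_iv [simp]: "a \<in> A \<Longrightarrow> rg a \<odot> iv a = iv a"
  using rg_mult_self[of "iv a"] by simp

lemma rg_mult_self_left: "a \<in> A \<Longrightarrow> b \<in> A \<Longrightarrow> rg a \<odot> (a \<odot> b) = a \<odot> b"
  by (simp flip: assoc)

lemma rg_mult_distrib:
  assumes "a \<in> A" "b \<in> A" shows "rg (a \<odot> b) = rg a \<odot> rg b"
proof -
  have "rg (a \<odot> b) = a \<odot> (rg b \<odot> iv a)" using assms by (simp add: rg_mult assoc)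
  also have "\<dots> = rg b \<odot> (a \<odot> iv a)" using assms by (metis idem_left_comm iv_closed rg_idem)
  also have "\<dots> = rg a \<odot> rg b" using assms by (simp add: idem_comm)
  finally show ?thesis .
qed

lemma Agrp_iff: "a \<in> Agrp A mA e \<longleftrightarrow> a \<in> A \<and> rg a = e"
  unfolding Agrp_def by auto

lemma rg_absorb_mult:
  "e \<in> E \<Longrightarrow> a \<in> A \<Longrightarrow> e \<odot> rg a = rg a \<Longrightarrow> e \<odot> a = a"
  by (metis assoc idem_closed rg_idem rg_mult_self)

lemma idem_conj: "e \<in> E \<Longrightarrow> a \<in> A \<Longrightarrow> e \<odot> a = a \<Longrightarrow> e \<odot> a \<odot> iv e = a"
  using idem_central by simp

text \<open>Reconciles the two places where a twist is read: the axioms give it at the range of the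
  element moved, the module structure at a larger idempotent.\<close>

lemma conj_restrict:
  assumes "a \<in> A" "c \<in> A" "e \<in> E" "e \<odot> a = a"
  shows "c \<odot> e \<odot> a \<odot> iv (c \<odot> e) = c \<odot> a \<odot> iv c"
proof -
  have "c \<odot> e \<odot> a \<odot> iv (c \<odot> e) = c \<odot> (e \<odot> a) \<odot> (e \<odot> iv c)"
    using assms by (simp add: iv_mult assoc)
  also have "\<dots> = c \<odot> (a \<odot> (e \<odot> iv c))" using assms by (simp add: assoc)
  also have "\<dots> = c \<odot> (e \<odot> a \<odot> iv c)" using assms by (metis idem_left_comm assoc idem_closed iv_closed)
  finally show ?thesis using assms by (simp add: assoc)
qed

text \<open>The reason why twists and equivalences act trivially on idempotents: a central element
  passes through \<open>c\<close>, leaving only \<open>rg c\<close>.\<close>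

lemma conj_idem_eq:
  assumes "e \<in> E" "c \<in> A" "rg c \<odot> e = e"
  shows "c \<odot> e \<odot> iv c = e"
  using assms by (metis assoc idem_central idem_closed iv_closed mult_iv)

lemma rg_absorb: "e \<in> E \<Longrightarrow> a \<in> A \<Longrightarrow> e \<odot> a = a \<Longrightarrow> e \<odot> rg a = rg a"
  using rg_idem_mult by metis

lemma conj_inj:
  assumes "a \<in> A" "b \<in> A" "c \<in> A" "rg c \<odot> a = a" "rg c \<odot> b = b"
    "c \<odot> a \<odot> iv c = c \<odot> b \<odot> iv c"
  shows "a = b"
proof -
  have *: "iv c \<odot> (c \<odot> a \<odot> iv c) \<odot> c = a" if "a \<in> A" "rg c \<odot> a = a" for a
  proof -
    have "iv c \<odot> (c \<odot> a \<odot> iv c) \<odot> c = (iv c \<odot> c) \<odot> a \<odot> (iv c \<odot> c)"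
      using that assms(3) by (simp only: assoc closed iv_closed)
    also have "\<dots> = a" using that assms(3) by (metis idem_central iv_mult_self rg_idem)
    finally show ?thesis .
  qed
  show ?thesis using *[of a] *[of b] assms by metis
qed

section \<open>Ideals and their products\<close>

definition ideal :: "'b set \<Rightarrow> bool" where "ideal I \<longleftrightarrow> is_ideal A mA I"

lemma ideal_sub: "ideal I \<Longrightarrow> a \<in> I \<Longrightarrow> a \<in> A"
  by (auto simp: ideal_def is_ideal_def)

lemma ideal_left: "ideal I \<Longrightarrow> a \<in> A \<Longrightarrow> b \<in> I \<Longrightarrow> a \<odot> b \<in> I"
  by (auto simp: ideal_def is_ideal_def)

lemma ideal_right: "ideal I \<Longrightarrow> a \<in> I \<Longrightarrow> b \<in> A \<Longrightarrow> a \<odot> b \<in> I"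
  by (auto simp: ideal_def is_ideal_def)

lemma ideal_rg: "ideal I \<Longrightarrow> a \<in> I \<Longrightarrow> rg a \<in> I"
  unfolding rg_def by (meson ideal_right ideal_sub iv_closed)

lemma ideal_rg_iff: "ideal I \<Longrightarrow> a \<in> A \<Longrightarrow> rg a \<in> I \<longleftrightarrow> a \<in> I"
  by (metis ideal_rg ideal_right rg_mult_self)

text \<open>The factorisation \<open>a = a \<odot> rg a\<close> puts a common element into the
  product, because an ideal contains the range of each of its members.\<close>

lemma setprod_ideal:
  assumes "ideal I" "ideal J"
  shows "setprod mA I J = I \<inter> J"
proof
  show "setprod mA I J \<subseteq> I \<inter> J"
    unfolding setprod_def using assms ideal_left ideal_right ideal_sub by blast
  show "I \<inter> J \<subseteq> setprod mA I J"
  proof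
    fix a assume "a \<in> I \<inter> J"
    then have "a = a \<odot> rg a" "a \<in> I" "rg a \<in> J"
      using assms ideal_sub ideal_rg by auto
    then show "a \<in> setprod mA I J" unfolding setprod_def by blast
  qed
qed

lemma ideal_inter:
  assumes "ideal I" "ideal J" shows "ideal (I \<inter> J)"
proof -
  obtain a b where "a \<in> I" "b \<in> J" using assms by (auto simp: ideal_def is_ideal_def)
  then have "a \<odot> b \<in> I \<inter> J" using assms ideal_left ideal_right ideal_sub by blast
  then show ?thesis using assms unfolding ideal_def is_ideal_def by blast
qed

lemma idems_subset: "ideal I \<Longrightarrow> e \<in> idems I mA \<longleftrightarrow> e \<in> I \<and> e \<in> E"
  using ideal_sub unfolding idems_def by blast

text \<open>A unit multiplier \<open>w\<close> of an ideal \<open>T\<close> is determined by the elements \<open>c e = w e = e w\<close>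
  for the idempotents \<open>e\<close> of \<open>T\<close>: since \<open>e\<close> is central, left and right action agree on it, and \<open>c e\<close>
  lies in the maximal subgroup at \<open>e\<close>.\<close>
definition mult_rep :: "'b set \<Rightarrow> ('b \<Rightarrow> 'b) \<times> ('b \<Rightarrow> 'b) \<Rightarrow> ('b \<Rightarrow> 'b) \<Rightarrow> bool" where
  "mult_rep T w c \<longleftrightarrow>
     (\<forall>e\<in>T. e \<in> E \<longrightarrow> c e \<in> A \<and> rg (c e) = e \<and> (\<forall>f\<in>E. c (e \<odot> f) = c e \<odot> f)) \<and>
     (\<forall>a\<in>T. fst w a = c (rg a) \<odot> a \<and> snd w a = a \<odot> c (rg a))"

lemma mult_rep_closed: "mult_rep T w c \<Longrightarrow> e \<in> T \<Longrightarrow> e \<in> E \<Longrightarrow> c e \<in> A"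
  and mult_rep_rg: "mult_rep T w c \<Longrightarrow> e \<in> T \<Longrightarrow> e \<in> E \<Longrightarrow> rg (c e) = e"
  and mult_rep_restrict: "mult_rep T w c \<Longrightarrow> e \<in> T \<Longrightarrow> e \<in> E \<Longrightarrow> f \<in> E \<Longrightarrow> c (e \<odot> f) = c e \<odot> f"
  and mult_rep_fst: "mult_rep T w c \<Longrightarrow> a \<in> T \<Longrightarrow> fst w a = c (rg a) \<odot> a"
  and mult_rep_snd: "mult_rep T w c \<Longrightarrow> a \<in> T \<Longrightarrow> snd w a = a \<odot> c (rg a)"
  by (auto simp: mult_rep_def)

lemma mult_rep_multiplier:
  assumes T: "ideal T" and w: "mult_rep T w c"
  shows "is_multiplier T mA w"
proof -
  note cl = mult_rep_closed[OF w] and rs = mult_rep_restrict[OF w]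
  have c: "c (rg a) \<in> A" if "a \<in> T" for a
    using that T cl ideal_rg ideal_sub by blast
  have "fst w s \<in> T \<and> snd w s \<in> T" if "s \<in> T" for s
    using that c T by (simp add: mult_rep_fst[OF w] mult_rep_snd[OF w] ideal_left ideal_right)
  moreover have "fst w (s \<odot> t) = fst w s \<odot> t \<and> snd w (s \<odot> t) = s \<odot> snd w t \<and> s \<odot> fst w t = snd w s \<odot> t"
    if st: "s \<in> T" "t \<in> T" for s t
  proof -
    have A: "s \<in> A" "t \<in> A" "rg s \<in> E" "rg t \<in> E" "s \<odot> t \<in> T"
      using st T ideal_sub ideal_right by auto
    \<comment> \<open>The value of \<open>c\<close> at \<open>rg (s \<odot> t)\<close> can be
      restricted from either factor; comparing \<open>c1\<close> with \<open>c2\<close> yields the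
      linking identity between left and right action.\<close>
    have c1: "c (rg (s \<odot> t)) = c (rg s) \<odot> rg t"
      using A T st rs[of "rg s" "rg t"] by (simp add: rg_mult_distrib ideal_rg)
    have c2: "c (rg (s \<odot> t)) = rg s \<odot> c (rg t)"
      using A T st rs[of "rg t" "rg s"] c[of t]
      by (simp add: rg_mult_distrib ideal_rg idem_comm[of "rg s"] idem_central[of "rg s" "c (rg t)"])
    have "c (rg s) \<odot> rg t \<odot> (s \<odot> t) = c (rg s) \<odot> s \<odot> t"
      using A c[OF st(1)] idem_left_comm[of "rg t" s t] by (simp add: assoc)
    moreover have "s \<odot> t \<odot> (rg s \<odot> c (rg t)) = s \<odot> (t \<odot> c (rg t))"
      using A c[OF st(2)] idem_left_comm[of "rg s" "s \<odot> t" "c (rg t)"]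
      by (simp add: assoc rg_mult_self_left)
    moreover have "s \<odot> (c (rg t) \<odot> t) = s \<odot> c (rg s) \<odot> t"
    proof -
      have "s \<odot> (c (rg t) \<odot> t) = s \<odot> (rg s \<odot> c (rg t)) \<odot> t"
        using A c[OF st(1)] c[OF st(2)] by (metis assoc closed idem_closed mult_rg_self)
      also have "\<dots> = s \<odot> (c (rg s) \<odot> rg t) \<odot> t" using c1 c2 by simp
      also have "\<dots> = s \<odot> c (rg s) \<odot> t" using A c[OF st(1)] by (simp add: assoc)
      finally show ?thesis .
    qed
    ultimately show ?thesis
      using st A c1 c2 by (simp add: mult_rep_fst[OF w] mult_rep_snd[OF w])
  qed
  ultimately show ?thesis unfolding is_multiplier_def by blast
qed

lemma mult_rep_inverse:
  assumes T: "ideal T" and w: "mult_rep T w c"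
  shows "mult_rep T (\<lambda>a. iv (c (rg a)) \<odot> a, \<lambda>a. a \<odot> iv (c (rg a))) (\<lambda>e. iv (c e))"
  unfolding mult_rep_def
  using mult_rep_closed[OF w] mult_rep_rg[OF w] mult_rep_restrict[OF w] T
  by (auto simp: iv_mult intro: idem_central)

lemma mult_rep_mult_inverse:
  assumes T: "ideal T" and w: "mult_rep T w c"
  shows "mult_inverse T mA w (\<lambda>a. iv (c (rg a)) \<odot> a, \<lambda>a. a \<odot> iv (c (rg a)))" (is "mult_inverse _ _ _ ?w'")
proof -
  note w' = mult_rep_inverse[OF T w]
  have "fst w (fst ?w' s) = s \<and> fst ?w' (fst w s) = s \<and> snd w (snd ?w' s) = s \<and> snd ?w' (snd w s) = s"
    if s: "s \<in> T" for s
  proof -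
    define d where "d = c (rg s)"
    have A: "s \<in> A" "d \<in> A" "rg d = rg s"
      using s T mult_rep_closed[OF w] mult_rep_rg[OF w] ideal_rg ideal_sub by (auto simp: d_def)
    have r: "rg (iv d \<odot> s) = rg s" "rg (d \<odot> s) = rg s" "rg (s \<odot> iv d) = rg s" "rg (s \<odot> d) = rg s"
      using A by (simp_all add: rg_mult_distrib)
    have t: "iv d \<odot> s \<in> T" "s \<odot> iv d \<in> T"
      using A s T by (auto intro: ideal_left ideal_right)
    have "d \<odot> (iv d \<odot> s) = s" "iv d \<odot> (d \<odot> s) = s" "s \<odot> iv d \<odot> d = s" "s \<odot> d \<odot> iv d = s"
      using A by (simp_all flip: assoc) (simp_all add: assoc)
    then show ?thesis
      using s t r by (simp add: mult_rep_fst[OF w] mult_rep_snd[OF w] d_def[symmetric])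
  qed
  then show ?thesis
    unfolding mult_inverse_def
    using mult_rep_multiplier[OF T w] mult_rep_multiplier[OF T w'] by blast
qed

lemma mult_rep_unit: "ideal T \<Longrightarrow> mult_rep T w c \<Longrightarrow> is_unit_multiplier T mA w"
  unfolding is_unit_multiplier_def using mult_rep_mult_inverse by blast

lemma unit_mult_rep:
  assumes T: "ideal T" and u: "is_unit_multiplier T mA w"
  shows "mult_rep T w (snd w)"
proof -
  obtain w' where w': "mult_inverse T mA w w'" using u by (auto simp: is_unit_multiplier_def)
  have cl: "fst w s \<in> T" "snd w s \<in> T" "fst w' s \<in> T" "snd w' s \<in> T" if "s \<in> T" for s
    using w' that by (auto simp: mult_inverse_def is_multiplier_def)
  have L: "fst w (s \<odot> t) = fst w s \<odot> t" "fst w' (s \<odot> t) = fst w' s \<odot> t"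
    and R: "snd w (s \<odot> t) = s \<odot> snd w t"
    and LR: "s \<odot> fst w t = snd w s \<odot> t" if "s \<in> T" "t \<in> T" for s t
    using w' that by (auto simp: mult_inverse_def is_multiplier_def)
  have inv: "fst w' (fst w s) = s" if "s \<in> T" for s
    using w' that by (auto simp: mult_inverse_def)
  have A: "s \<in> A" if "s \<in> T" for s using that T ideal_sub by blast
  have FS: "fst w e = snd w e" and SE: "snd w e \<odot> e = snd w e" if "e \<in> T" "e \<in> E" for e
  proof -
    have e: "fst w e \<in> A" "snd w e \<in> A" using that cl A by auto
    have "fst w e = fst w e \<odot> e" using L(1)[OF that(1) that(1)] that by simp
    also have "\<dots> = snd w e \<odot> e" using that e LR[OF that(1) that(1)] by (metis idem_central)
    also have 1: "\<dots> = snd w e" using R[OF that(1) that(1)] that e by (metis idem_central idem_mult_self)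
    finally show "fst w e = snd w e" .
    show "snd w e \<odot> e = snd w e" by (rule 1)
  qed
  show ?thesis unfolding mult_rep_def
  proof (intro conjI ballI impI)
    fix e assume e: "e \<in> T" "e \<in> E"
    let ?c = "snd w e" and ?c' = "fst w' e"
    show cA: "?c \<in> A" using e cl A by blast
    have c'A: "?c' \<in> A" using e cl A by blast
    \<comment> \<open>The inverse multiplier returns \<open>e\<close>, which forces \<open>e\<close>
      below \<open>rg ?c\<close>; the reverse inequality comes from
      \<open>?c \<odot> e = ?c\<close>. Together they locate \<open>?c\<close> in the group at
      \<open>e\<close>.\<close>
    have "?c' \<odot> ?c = fst w' (e \<odot> fst w e)" using e cl L(2)[of e "fst w e"] FS by simp
    also have "e \<odot> fst w e = fst w e" using SE[OF e] FS[OF e] cA e by (metis idem_central)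
    finally have "?c' \<odot> ?c = e" using inv e by simp
    then have 1: "rg ?c' \<odot> rg ?c = e" using cA c'A e rg_mult_distrib[of ?c' ?c] by simp
    have 2: "rg ?c \<odot> e = rg ?c" using rg_mult_distrib[of ?c e] SE[OF e] cA e by simp
    have "e = e \<odot> rg ?c"
      using 1 cA c'A by (metis assoc idem_closed idem_mult_self rg_idem)
    then show "rg ?c = e" using 2 e cA by (metis idem_comm rg_idem)
    fix f assume f: "f \<in> E"
    have "snd w (e \<odot> f) = snd w (f \<odot> e \<odot> e)"
      using e f by (metis assoc idem_closed idem_comm idem_mult_self)
    also have "\<dots> = f \<odot> e \<odot> ?c" using e f R[of "f \<odot> e" e] T by (simp add: ideal_left)
    also have "\<dots> = ?c \<odot> f" using e f cA SE[OF e] by (metis assoc idem_central idem_closed)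
    finally show "snd w (e \<odot> f) = ?c \<odot> f" .
  next
    fix a assume a: "a \<in> T"
    then have r: "rg a \<in> T" "rg a \<in> E" "a \<in> A" using T ideal_rg A by auto
    have "fst w a = fst w (rg a \<odot> a)" using r by simp
    also have "\<dots> = snd w (rg a) \<odot> a" using r a L(1)[of "rg a" a] FS by simp
    finally show "fst w a = snd w (rg a) \<odot> a" .
    have "snd w a = snd w (a \<odot> rg a)" using r by simp
    also have "\<dots> = a \<odot> snd w (rg a)" using r a R by blast
    finally show "snd w a = a \<odot> snd w (rg a)" .
  qed
qed

text \<open>\<open>minv\<close> picks some inverse; it is identified by uniqueness of inverses in a monoid.\<close>
lemma snd_minv:
  assumes T: "ideal T" and w: "mult_rep T w c" and a: "a \<in> T"
  shows "snd (minv T mA w) a = a \<odot> iv (c (rg a))"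
proof -
  let ?w' = "(\<lambda>a. iv (c (rg a)) \<odot> a, \<lambda>a. a \<odot> iv (c (rg a)))"
  have i: "mult_inverse T mA w ?w'" by (rule mult_rep_mult_inverse[OF T w])
  then have m: "mult_inverse T mA w (minv T mA w)" unfolding minv_def by (rule someI)
  have t: "snd ?w' a \<in> T" using i a unfolding mult_inverse_def is_multiplier_def by blast
  have "snd (minv T mA w) a = snd (minv T mA w) (snd w (snd ?w' a))"
    using i a by (simp add: mult_inverse_def)
  also have "\<dots> = snd ?w' a" using m t unfolding mult_inverse_def by blast
  finally show ?thesis by simp
qed

text \<open>Conjugation by a multiplier becomes conjugation by an element of \<open>A\<close>. Both
  factors are read at the same idempotent since multiplying \<open>a\<close> by
  \<open>c (rg a)\<close> leaves its range unchanged.\<close>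

lemma snd_minv_fst:
  assumes T: "ideal T" and w: "mult_rep T w c" and a: "a \<in> T"
  shows "snd (minv T mA w) (fst w a) = c (rg a) \<odot> a \<odot> iv (c (rg a))"
proof -
  have c: "c (rg a) \<in> A" "rg (c (rg a)) = rg a" "a \<in> A"
    using T w a mult_rep_closed mult_rep_rg ideal_rg ideal_sub by auto
  then have "rg (c (rg a) \<odot> a) = rg a" by (simp add: rg_mult_distrib)
  then show ?thesis
    using c a T by (simp add: mult_rep_fst[OF w] snd_minv[OF T w] ideal_left)
qed

section \<open>Endomorphisms preserve idempotents, inverses and ranges\<close>

lemma endo_closed: "endo A mA h \<Longrightarrow> a \<in> A \<Longrightarrow> h a \<in> A"
  and endo_mult: "endo A mA h \<Longrightarrow> a \<in> A \<Longrightarrow> b \<in> A \<Longrightarrow> h (a \<odot> b) = h a \<odot> h b"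
  by (auto simp: endo_def)

lemma endo_idem: "endo A mA h \<Longrightarrow> e \<in> E \<Longrightarrow> h e \<in> E"
  by (intro idemI) (auto simp: endo_closed simp flip: endo_mult)

lemma endo_iv: "endo A mA h \<Longrightarrow> a \<in> A \<Longrightarrow> h (iv a) = iv (h a)"
  by (rule iv_eqI[symmetric]) (auto simp: endo_closed mult_iv_mult iv_mult_iv simp flip: endo_mult)

lemma endo_rg: "endo A mA h \<Longrightarrow> a \<in> A \<Longrightarrow> rg (h a) = h (rg a)"
  unfolding rg_def by (metis endo_iv endo_mult iv_closed)

end

lemma clifford_of_semilattice_of_groups: "semilattice_of_groups A mA \<Longrightarrow> clifford A mA"
  unfolding semilattice_of_groups_def by unfold_locales blast+

section \<open>The twisted partial action of a Sieben module\<close>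

locale sieben = A: clifford A mA + S: eunitary_sg S m
  for A :: "'b set" and mA :: "'b \<Rightarrow> 'b \<Rightarrow> 'b" (infixl "\<odot>" 70)
    and S :: "'a set" and m :: "'a \<Rightarrow> 'a \<Rightarrow> 'a" (infixl "\<cdot>" 70) +
  fixes \<alpha> :: "'a \<Rightarrow> 'b" and lam :: "'a \<Rightarrow> 'b \<Rightarrow> 'b" and f :: "'a \<Rightarrow> 'a \<Rightarrow> 'b"
  assumes sieben_tms: "sieben_tms S m A mA \<alpha> lam f"
begin

section \<open>Restriction laws for the maps and the twist of a Sieben module\<close>

lemma tms: "tms S m A mA \<alpha> lam f"
  using sieben_tms by (simp add: sieben_tms_def)

lemma alpha_bij: "bij_betw \<alpha> S.E A.E"
  using tms by (simp add: tms_def)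

lemma alpha_idem [simp, intro]: "p \<in> S.E \<Longrightarrow> \<alpha> p \<in> A.E"
  using alpha_bij by (meson bij_betwE)

lemma alpha_closed [simp, intro]: "p \<in> S.E \<Longrightarrow> \<alpha> p \<in> A"
  by (rule A.idem_closed) auto

lemma alpha_eq_iff: "p \<in> S.E \<Longrightarrow> q \<in> S.E \<Longrightarrow> \<alpha> p = \<alpha> q \<longleftrightarrow> p = q"
  using alpha_bij by (meson bij_betw_imp_inj_on inj_on_eq_iff)

lemma alpha_surj: "e \<in> A.E \<Longrightarrow> \<exists>p\<in>S.E. \<alpha> p = e"
  using alpha_bij by (metis bij_betw_imp_surj_on imageE)

lemma alpha_mult: "p \<in> S.E \<Longrightarrow> q \<in> S.E \<Longrightarrow> \<alpha> (p \<cdot> q) = \<alpha> p \<odot> \<alpha> q"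
  using tms by (simp add: tms_def)

lemma lam_rel_invertible: "s \<in> S \<Longrightarrow> rel_invertible A mA (lam s)"
  using tms by (simp add: tms_def)

lemma lam_endo: "s \<in> S \<Longrightarrow> endo A mA (lam s)"
  using lam_rel_invertible by (simp add: rel_invertible_def)

lemma lam_closed [simp, intro]: "s \<in> S \<Longrightarrow> a \<in> A \<Longrightarrow> lam s a \<in> A"
  by (simp add: lam_endo A.endo_closed)

lemma lam_mult: "s \<in> S \<Longrightarrow> a \<in> A \<Longrightarrow> b \<in> A \<Longrightarrow> lam s (a \<odot> b) = lam s a \<odot> lam s b"
  by (simp add: lam_endo A.endo_mult)

lemma lam_rg: "s \<in> S \<Longrightarrow> a \<in> A \<Longrightarrow> A.rg (lam s a) = lam s (A.rg a)"
  by (simp add: lam_endo A.endo_rg)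

lemma f_Agrp: "s \<in> S \<Longrightarrow> t \<in> S \<Longrightarrow> f s t \<in> Agrp A mA (\<alpha> (S.rg (s \<cdot> t)))"
  using tms unfolding tms_def S.rg_def by (metis S.assoc S.closed S.iv_closed S.iv_mult)

lemma f_closed [simp, intro]: "s \<in> S \<Longrightarrow> t \<in> S \<Longrightarrow> f s t \<in> A"
  using f_Agrp by (simp add: A.Agrp_iff)

lemma rg_f [simp]: "s \<in> S \<Longrightarrow> t \<in> S \<Longrightarrow> A.rg (f s t) = \<alpha> (S.rg (s \<cdot> t))"
  using f_Agrp by (simp add: A.Agrp_iff)

lemma lam_idem: "p \<in> S.E \<Longrightarrow> a \<in> A \<Longrightarrow> lam p a = \<alpha> p \<odot> a"
  using tms by (simp add: tms_def)

lemma lam_alpha: "s \<in> S \<Longrightarrow> p \<in> S.E \<Longrightarrow> lam s (\<alpha> p) = \<alpha> (S.rg (s \<cdot> p))"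
  using tms by (simp add: tms_def S.rg_mult)

lemma lam_lam: "s \<in> S \<Longrightarrow> t \<in> S \<Longrightarrow> a \<in> A \<Longrightarrow>
    lam s (lam t a) = f s t \<odot> lam (s \<cdot> t) a \<odot> A.iv (f s t)"
  using tms by (simp add: tms_def)

lemma f_cocycle: "s \<in> S \<Longrightarrow> t \<in> S \<Longrightarrow> u \<in> S \<Longrightarrow>
    lam s (f t u) \<odot> f s (t \<cdot> u) = f s t \<odot> f (s \<cdot> t) u"
  using tms by (simp add: tms_def)

lemma f_idem_right: "s \<in> S \<Longrightarrow> p \<in> S.E \<Longrightarrow> f s p = \<alpha> (S.rg (s \<cdot> p))"
  using sieben_tms by (simp add: sieben_tms_def S.rg_mult)

lemma f_idem_left: "s \<in> S \<Longrightarrow> p \<in> S.E \<Longrightarrow> f p s = \<alpha> (S.rg (p \<cdot> s))"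
proof -
  assume sp: "s \<in> S" "p \<in> S.E"
  then have "f p s = \<alpha> (p \<cdot> s \<cdot> S.iv s)" using sieben_tms by (simp add: sieben_tms_def)
  also have "p \<cdot> s \<cdot> S.iv s = S.rg (p \<cdot> s)"
    using sp by (simp add: S.rg_idem_mult S.assoc) (simp add: S.rg_def)
  finally show ?thesis .
qed

lemma alpha_obtain:
  assumes "a \<in> A" obtains p where "p \<in> S.E" "\<alpha> p = A.rg a"
  using assms alpha_surj by blast

lemma alpha_rg_mult: "s \<in> S \<Longrightarrow> t \<in> S \<Longrightarrow> \<alpha> (S.rg s) \<odot> \<alpha> (S.rg (s \<cdot> t)) = \<alpha> (S.rg (s \<cdot> t))"
  by (simp flip: alpha_mult)

text \<open>The range of \<open>a\<close> is \<open>\<alpha> p\<close> for some \<open>p\<close>,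
  and \<open>lam s\<close> takes it to \<open>\<alpha> (S.rg (s \<cdot> p))\<close>, which is below
  \<open>\<alpha> (S.rg s)\<close>.\<close>

lemma lam_absorb:
  assumes "s \<in> S" "a \<in> A" shows "\<alpha> (S.rg s) \<odot> lam s a = lam s a"
proof -
  obtain p where p: "p \<in> S.E" "\<alpha> p = A.rg a" using assms alpha_obtain by blast
  have "A.rg (lam s a) = \<alpha> (S.rg (s \<cdot> p))"
    using assms p by (simp add: lam_rg lam_alpha flip: p(2))
  then show ?thesis using assms p by - (rule A.rg_absorb_mult, simp_all add: alpha_rg_mult)
qed

text \<open>By the Sieben condition \<open>f s p\<close> is an idempotent dominating the image of
  \<open>lam (s \<cdot> p)\<close>, so the conjugation in the composition law disappears.\<close>

lemma lam_mult_idem: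
  assumes "s \<in> S" "p \<in> S.E" "a \<in> A" shows "lam (s \<cdot> p) a = lam s (\<alpha> p \<odot> a)"
proof -
  have "lam s (lam p a) = \<alpha> (S.rg (s \<cdot> p)) \<odot> lam (s \<cdot> p) a \<odot> A.iv (\<alpha> (S.rg (s \<cdot> p)))"
    using assms lam_lam[of s p a] by (simp add: f_idem_right)
  also have "\<dots> = lam (s \<cdot> p) a" using assms by (intro A.idem_conj lam_absorb) auto
  finally show ?thesis using assms by (simp add: lam_idem)
qed

lemma lam_idem_mult:
  assumes "s \<in> S" "p \<in> S.E" "a \<in> A" shows "lam (p \<cdot> s) a = \<alpha> p \<odot> lam s a"
proof -
  have "lam p (lam s a) = \<alpha> (S.rg (p \<cdot> s)) \<odot> lam (p \<cdot> s) a \<odot> A.iv (\<alpha> (S.rg (p \<cdot> s)))"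
    using assms lam_lam[of p s a] by (simp add: f_idem_left)
  also have "\<dots> = lam (p \<cdot> s) a" using assms by (intro A.idem_conj lam_absorb) auto
  finally show ?thesis using assms by (simp add: lam_idem)
qed

lemma lam_dm: "s \<in> S \<Longrightarrow> a \<in> A \<Longrightarrow> lam s (\<alpha> (S.dm s) \<odot> a) = lam s a"
  by (simp flip: lam_mult_idem)

lemma lam_alpha_dm [simp]: "s \<in> S \<Longrightarrow> lam s (\<alpha> (S.dm s)) = \<alpha> (S.rg s)"
  by (simp add: lam_alpha)

lemma rg_lam:
  assumes "u \<in> S" "a \<in> A" "\<alpha> (S.dm u) = A.rg a"
  shows "A.rg (lam u a) = \<alpha> (S.rg u)"
  using assms by (simp add: lam_rg flip: assms(3))

text \<open>The cocycle identity at \<open>(p, s, t)\<close>: the values \<open>f p s\<close> and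
  \<open>f p (s \<cdot> t)\<close> are idempotents and are absorbed by the remaining
  factors.\<close>

lemma f_mult_left:
  assumes "s \<in> S" "t \<in> S" "p \<in> S.E" shows "f (p \<cdot> s) t = \<alpha> p \<odot> f s t"
proof -
  have r: "A.rg (\<alpha> p \<odot> f s t) = \<alpha> (S.rg (p \<cdot> (s \<cdot> t)))"
    using assms by (simp add: A.rg_idem_mult S.rg_idem_mult alpha_mult)
  have "lam p (f s t) \<odot> f p (s \<cdot> t) = f p s \<odot> f (p \<cdot> s) t"
    using assms by (intro f_cocycle) auto
  then have "\<alpha> p \<odot> f s t \<odot> A.rg (\<alpha> p \<odot> f s t) = \<alpha> (S.rg (p \<cdot> s)) \<odot> f (p \<cdot> s) t"
    using assms r by (simp add: lam_idem f_idem_left)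
  also have "\<dots> = f (p \<cdot> s) t" using assms by - (rule A.rg_absorb_mult, auto simp: alpha_rg_mult)
  finally show ?thesis using assms by simp
qed

text \<open>The cocycle identity at \<open>(s, p, t)\<close>, where \<open>f p t\<close> and
  \<open>f s p\<close> are the idempotents. It lets any pair of arguments be replaced by a
  composable one.\<close>

lemma f_shift:
  assumes "s \<in> S" "t \<in> S" "p \<in> S.E" shows "f (s \<cdot> p) t = f s (p \<cdot> t)"
proof -
  have "lam s (f p t) \<odot> f s (p \<cdot> t) = f s p \<odot> f (s \<cdot> p) t"
    using assms by (intro f_cocycle) auto
  moreover have "lam s (f p t) = A.rg (f s (p \<cdot> t))"
    using assms by (simp add: f_idem_left lam_alpha S.rg_mult_rg_right)
  moreover have "f s p \<odot> f (s \<cdot> p) t = f (s \<cdot> p) t"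
    using assms by - (rule A.rg_absorb_mult, auto simp: alpha_rg_mult f_idem_right)
  ultimately show ?thesis using assms by (metis A.rg_mult_self f_closed S.closed S.idem_closed)
qed

lemma f_dm: "s \<in> S \<Longrightarrow> t \<in> S \<Longrightarrow> f s (S.dm s \<cdot> t) = f s t"
  by (simp flip: f_shift)

text \<open>On the group at \<open>\<alpha> (S.dm u)\<close> the map \<open>lam (S.iv u)\<close>
  undoes \<open>lam u\<close> up to conjugation by \<open>f (S.iv u) u\<close>, and that conjugation
  is injective there.\<close>

lemma lam_inj:
  assumes "u \<in> S" "a \<in> A" "b \<in> A" "A.rg a = \<alpha> (S.dm u)" "A.rg b = \<alpha> (S.dm u)" "lam u a = lam u b"
  shows "a = b"
proof -
  define c where "c = f (S.iv u) u"
  have *: "lam (S.iv u) (lam u a) = c \<odot> a \<odot> A.iv c" if "a \<in> A" "A.rg a = \<alpha> (S.dm u)" for a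
  proof -
    have "lam (S.dm u) a = A.rg a \<odot> a" using that assms(1) by (simp add: lam_idem)
    also have "\<dots> = a" using that(1) by simp
    finally have "lam (S.iv u \<cdot> u) a = a" by (simp add: S.dm_def)
    then show ?thesis using that assms(1) lam_lam[of "S.iv u" u a] by (simp add: c_def)
  qed
  have "c \<in> A" "A.rg c = \<alpha> (S.dm u)" using assms(1) by (simp_all add: c_def) (simp flip: S.dm_def)
  moreover have "c \<odot> a \<odot> A.iv c = c \<odot> b \<odot> A.iv c" using *[of a] *[of b] assms by metis
  ultimately show ?thesis using assms(2-5) by (metis A.conj_inj A.rg_mult_self)
qed

lemma lam_surj:
  assumes "u \<in> S" "b \<in> A" "A.rg b = \<alpha> (S.rg u)"
  shows "\<exists>a\<in>A. A.rg a = \<alpha> (S.dm u) \<and> lam u a = b"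
proof -
  define c where "c = f u (S.iv u)"
  \<comment> \<open>Conjugating \<open>b\<close> backwards by \<open>c\<close> in advance cancels
    the twist that \<open>lam u (lam (S.iv u) b')\<close> produces.\<close>
  define b' where "b' = A.iv c \<odot> b \<odot> c"
  have c: "c \<in> A" "A.rg c = \<alpha> (S.rg u)" using assms(1) by (simp_all add: c_def) (simp flip: S.rg_def)
  have b': "b' \<in> A" "A.rg b' = \<alpha> (S.rg u)"
    using c assms by (auto simp: b'_def A.rg_mult_distrib)
  have "lam u (lam (S.iv u) b') = c \<odot> lam (S.rg u) b' \<odot> A.iv c"
    using lam_lam[of u "S.iv u" b'] assms b' by (simp add: c_def S.rg_def)
  also have "lam (S.rg u) b' = b'" using assms b' by (metis lam_idem A.rg_mult_self S.rg_idem)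
  also have "c \<odot> b' \<odot> A.iv c = (c \<odot> A.iv c) \<odot> b \<odot> (c \<odot> A.iv c)"
    using c(1) assms(2) by (simp only: b'_def A.assoc A.closed A.iv_closed)
  also have "\<dots> = A.rg b \<odot> b \<odot> A.rg b" using c assms by simp
  also have "\<dots> = b" using assms(2) by simp
  finally have "lam u (lam (S.iv u) b') = b" .
  moreover have "A.rg (lam (S.iv u) b') = \<alpha> (S.dm u)"
    using assms b' by (simp add: lam_rg lam_alpha S.rg_mult_rg_right)
      (simp add: S.rg_mult S.assoc S.rg_def S.mult_iv_mult flip: S.dm_def)
  ultimately show ?thesis using assms b' by blast
qed

section \<open>Ideals, partial isomorphisms and multipliers built from a Sieben module\<close>

abbreviation D :: "'a set \<Rightarrow> 'b set" where "D \<equiv> thD S m A mA \<alpha>"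
abbreviation \<theta> :: "'a set \<Rightarrow> 'b \<Rightarrow> 'b" where "\<theta> \<equiv> thTheta S m A mA \<alpha> lam"
abbreviation W :: "'a set \<Rightarrow> 'a set \<Rightarrow> ('b \<Rightarrow> 'b) \<times> ('b \<Rightarrow> 'b)" where "W \<equiv> thW S m A mA \<alpha> f"

lemma D_iff: "a \<in> D x \<longleftrightarrow> a \<in> A \<and> (\<exists>s\<in>x. \<alpha> (S.rg s) = A.rg a)"
  unfolding thD_def S.rg_def[symmetric] using A.Agrp_iff by auto metis

text \<open>Inversion exchanges domains and ranges, so the same members of \<open>x\<close> index
  both the source and the target of \<open>\<theta> x\<close>.\<close>

lemma D_inv_iff:
  assumes x: "x \<in> carrier S.G"
  shows "a \<in> D (inv\<^bsub>S.G\<^esub> x) \<longleftrightarrow> a \<in> A \<and> (\<exists>s\<in>x. \<alpha> (S.dm s) = A.rg a)"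
proof -
  have xi: "inv\<^bsub>S.G\<^esub> x \<in> carrier S.G" using x by (simp add: S.group_maxgrp group.inv_closed)
  have xii: "inv\<^bsub>S.G\<^esub> (inv\<^bsub>S.G\<^esub> x) = x" using x by (simp add: S.group_maxgrp group.inv_inv)
  have "\<alpha> (S.rg (S.iv s)) = \<alpha> (S.dm s)" "S.iv s \<in> inv\<^bsub>S.G\<^esub> x" if "s \<in> x" for s
    using that x S.mem_carrier_closed[OF x that] by (simp_all add: S.iv_mem)
  moreover have "\<alpha> (S.dm (S.iv s)) = \<alpha> (S.rg s)" "S.iv s \<in> x" if "s \<in> inv\<^bsub>S.G\<^esub> x" for s
    using that xi S.mem_carrier_closed[OF xi that] S.iv_mem[OF xi that] xii by simp_all
  ultimately show ?thesis unfolding D_iff by metis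
qed

lemma theta_eq_dm:
  assumes x: "x \<in> carrier S.G" and s: "s \<in> x" and a: "\<alpha> (S.dm s) = A.rg a" "a \<in> A"
  shows "\<theta> x a = lam s a"
proof -
  have sS: "t \<in> S" if "t \<in> x" for t using that x S.mem_carrier_closed by blast
  have "(THE s. s \<in> x \<and> \<alpha> (S.dm s) = A.rg a) = s"
  proof (rule the_equality)
    fix t assume t: "t \<in> x \<and> \<alpha> (S.dm t) = A.rg a"
    then have "S.dm t = S.dm s" using a sS s by (metis S.dm_idem alpha_eq_iff)
    then show "t = s" using t x s by (metis S.cls_dm_unique)
  qed (use s a in auto)
  then show ?thesis unfolding thTheta_def S.dm_def A.rg_def by simp
qed

text \<open>An element \<open>s\<close> whose domain is merely above \<open>a\<close> may be used:
  its restriction \<open>s \<cdot> p\<close> to the range of \<open>a\<close> has the exact domain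
  and the same value at \<open>a\<close>.\<close>

lemma theta_eq:
  assumes x: "x \<in> carrier S.G" and s: "s \<in> x" and a: "\<alpha> (S.dm s) \<odot> a = a" "a \<in> A"
  shows "\<theta> x a = lam s a"
proof -
  have sS: "s \<in> S" using x s S.mem_carrier_closed by blast
  obtain p where p: "p \<in> S.E" "\<alpha> p = A.rg a" using a alpha_obtain by blast
  have "\<alpha> (S.dm (s \<cdot> p)) = \<alpha> (S.dm s) \<odot> A.rg a"
    using p sS by (simp add: S.dm_mult_idem alpha_mult)
  also have "\<dots> = A.rg a" using a sS by (simp add: A.rg_absorb)
  finally have "\<theta> x a = lam (s \<cdot> p) a"
    using x s p a by (intro theta_eq_dm) (auto simp: S.mult_idem_mem)
  also have "\<dots> = lam s a" using sS p a by (simp add: lam_mult_idem)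
  finally show ?thesis .
qed

lemma pick_r_eq:
  assumes x: "x \<in> carrier S.G" and s: "s \<in> x" and a: "\<alpha> (S.rg s) = A.rg a"
  shows "pick_r S m A mA \<alpha> x a = s"
  unfolding pick_r_def S.rg_def[symmetric] A.rg_def[symmetric]
proof (rule the_equality)
  have sS: "t \<in> S" if "t \<in> x" for t using that x S.mem_carrier_closed by blast
  fix t assume t: "t \<in> x \<and> \<alpha> (S.rg t) = A.rg a"
  then have "S.rg t = S.rg s" using a sS s by (metis S.rg_idem alpha_eq_iff)
  then show "t = s" using t x s by (metis S.cls_rg_unique)
qed (use s a in auto)

text \<open>Composable pairs \<open>u \<in> x\<close>, \<open>v \<in> y\<close> parametrise the idempotents of \<open>D x \<inter> D (x y)\<close>; evaluating at
  them turns each axiom for \<open>(\<theta>, w)\<close> into the corresponding identity for \<open>(\<lambda>, f)\<close>.\<close>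
lemma W_eq:
  assumes x: "x \<in> carrier S.G" and y: "y \<in> carrier S.G" and u: "u \<in> x" and v: "v \<in> y"
    and uv: "S.dm u = S.rg v" and a: "\<alpha> (S.rg u) = A.rg a"
  shows "fst (W x y) a = f u v \<odot> a" "snd (W x y) a = a \<odot> f u v"
proof -
  have S: "u \<in> S" "v \<in> S" using x y u v S.mem_carrier_closed by auto
  have xy: "x \<otimes>\<^bsub>S.G\<^esub> y \<in> carrier S.G" using x y S.group_maxgrp by (simp add: group.is_monoid monoid.m_closed)
  have "pick_r S m A mA \<alpha> (x \<otimes>\<^bsub>S.G\<^esub> y) a = u \<cdot> v"
    using S uv a by (intro pick_r_eq xy S.mult_mem x y u v) (simp add: S.rg_mult_composable)
  moreover have "S.iv u \<cdot> (u \<cdot> v) = v"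
  proof -
    have "S.iv u \<cdot> (u \<cdot> v) = S.dm u \<cdot> v" using S by (simp add: S.dm_def S.assoc)
    then show ?thesis using S uv by simp
  qed
  ultimately show "fst (W x y) a = f u v \<odot> a" "snd (W x y) a = a \<odot> f u v"
    using pick_r_eq[OF x u a] by (simp_all add: thW_def)
qed

lemma D_pair:
  assumes x: "x \<in> carrier S.G" and y: "y \<in> carrier S.G" and a: "a \<in> D x" "a \<in> D (x \<otimes>\<^bsub>S.G\<^esub> y)"
  shows "\<exists>u\<in>x. \<exists>v\<in>y. S.dm u = S.rg v \<and> \<alpha> (S.rg u) = A.rg a"
proof -
  interpret G: group S.G by (rule S.group_maxgrp)
  obtain u t where ut: "u \<in> x" "\<alpha> (S.rg u) = A.rg a" "t \<in> x \<otimes>\<^bsub>S.G\<^esub> y" "\<alpha> (S.rg t) = A.rg a"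
    using a by (auto simp: D_iff)
  have xy: "x \<otimes>\<^bsub>S.G\<^esub> y \<in> carrier S.G" using x y by simp
  have S: "u \<in> S" "t \<in> S" using x xy ut S.mem_carrier_closed by auto
  have rg: "S.rg u = S.rg t" using ut S by (metis S.rg_idem alpha_eq_iff)
  \<comment> \<open>The partner of \<open>u\<close> is \<open>S.iv u \<cdot> t\<close>: it strips
    the class \<open>x\<close> from \<open>x y\<close>, and equality of the ranges of
    \<open>u\<close> and \<open>t\<close> makes it composable with \<open>u\<close>.\<close>
  have "S.iv u \<cdot> t \<in> inv\<^bsub>S.G\<^esub> x \<otimes>\<^bsub>S.G\<^esub> (x \<otimes>\<^bsub>S.G\<^esub> y)"
    using ut x xy by (intro S.mult_mem S.iv_mem) auto
  also have "inv\<^bsub>S.G\<^esub> x \<otimes>\<^bsub>S.G\<^esub> (x \<otimes>\<^bsub>S.G\<^esub> y) = y" using x y by (simp flip: G.m_assoc)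
  finally have "S.iv u \<cdot> t \<in> y" .
  moreover have "S.rg (S.iv u \<cdot> t) = S.dm u"
    using S rg[symmetric] S.iv_mult_iv[of u] by (simp add: S.rg_mult S.assoc) (simp add: S.dm_def)
  ultimately show ?thesis using ut by metis
qed

lemma D_inv_pair:
  assumes x: "x \<in> carrier S.G" and y: "y \<in> carrier S.G" and a: "a \<in> D (inv\<^bsub>S.G\<^esub> x)" "a \<in> D y"
  shows "\<exists>u\<in>x. \<exists>v\<in>y. S.dm u = S.rg v \<and> \<alpha> (S.dm u) = A.rg a"
proof -
  obtain u v where "u \<in> x" "\<alpha> (S.dm u) = A.rg a" "v \<in> y" "\<alpha> (S.rg v) = A.rg a"
    using a by (auto simp: D_iff[of _ y] D_inv_iff[OF x])
  moreover from this have "S.dm u = S.rg v"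
    using x y S.mem_carrier_closed by (metis S.dm_idem S.rg_idem alpha_eq_iff)
  ultimately show ?thesis by metis
qed

lemma D_ideal:
  assumes x: "x \<in> carrier S.G" shows "A.ideal (D x)"
proof -
  have sub: "D x \<subseteq> A" by (auto simp: D_iff)
  obtain s where s: "s \<in> x" using x S.mem_carrier_nonempty by blast
  then have "s \<in> S" using x S.mem_carrier_closed by blast
  then have "\<alpha> (S.rg s) \<in> D x" using s by (auto simp: D_iff)
  moreover have "a \<odot> b \<in> D x \<and> b \<odot> a \<in> D x" if ab: "a \<in> A" "b \<in> D x" for a b
  proof -
    obtain s where s: "s \<in> x" "\<alpha> (S.rg s) = A.rg b" "b \<in> A" using ab by (auto simp: D_iff)
    have sS: "s \<in> S" using x s S.mem_carrier_closed by blast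
    obtain p where p: "p \<in> S.E" "\<alpha> p = A.rg a" using ab alpha_obtain by blast
    have "p \<cdot> s \<in> x" using x s p by (simp add: S.idem_mult_mem)
    moreover have "\<alpha> (S.rg (p \<cdot> s)) = A.rg (a \<odot> b)"
      using s sS p ab by (simp add: S.rg_idem_mult alpha_mult A.rg_mult_distrib)
    moreover have "A.rg (b \<odot> a) = A.rg (a \<odot> b)"
      using s ab by (simp add: A.rg_mult_distrib A.idem_comm)
    ultimately show ?thesis using s ab unfolding D_iff by auto
  qed
  ultimately show ?thesis using sub unfolding A.ideal_def is_ideal_def by blast
qed

text \<open>\<open>\<theta> x\<close> carries the group over \<open>S.dm u\<close> onto the group
  over \<open>S.rg u\<close> by \<open>lam u\<close>; distinct members of \<open>x\<close> have
  distinct domains and distinct ranges, so these bijections do not interfere.\<close>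

lemma theta_bij:
  assumes x: "x \<in> carrier S.G"
  shows "bij_betw (\<theta> x) (D (inv\<^bsub>S.G\<^esub> x)) (D x)"
proof (rule bij_betw_imageI)
  have sS: "t \<in> S" if "t \<in> x" for t using that x S.mem_carrier_closed by blast
  have th: "\<theta> x a = lam u a" "A.rg (lam u a) = \<alpha> (S.rg u)"
    if "u \<in> x" "a \<in> A" "\<alpha> (S.dm u) = A.rg a" for u a
  proof -
    show "\<theta> x a = lam u a" using theta_eq_dm[OF x] that by simp
    show "A.rg (lam u a) = \<alpha> (S.rg u)" using that sS[of u] by (simp add: rg_lam)
  qed
  show "inj_on (\<theta> x) (D (inv\<^bsub>S.G\<^esub> x))"
  proof (rule inj_onI)
    fix a b assume ab: "a \<in> D (inv\<^bsub>S.G\<^esub> x)" "b \<in> D (inv\<^bsub>S.G\<^esub> x)" "\<theta> x a = \<theta> x b"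
    obtain u where u: "u \<in> x" "\<alpha> (S.dm u) = A.rg a" "a \<in> A" using ab by (auto simp: D_inv_iff[OF x])
    obtain v where v: "v \<in> x" "\<alpha> (S.dm v) = A.rg b" "b \<in> A" using ab by (auto simp: D_inv_iff[OF x])
    have "\<alpha> (S.rg u) = \<alpha> (S.rg v)" using th[of u a] th[of v b] u v ab(3) by metis
    then have "u = v" using sS[OF u(1)] sS[OF v(1)] x u v
      by (metis S.rg_idem alpha_eq_iff S.cls_rg_unique)
    then show "a = b" using lam_inj[of u a b] sS u v ab(3) th[of u a] th[of v b] by metis
  qed
  show "\<theta> x ` D (inv\<^bsub>S.G\<^esub> x) = D x"
  proof (intro equalityI subsetI)
    fix b assume "b \<in> \<theta> x ` D (inv\<^bsub>S.G\<^esub> x)"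
    then obtain a u where a: "b = \<theta> x a" "u \<in> x" "\<alpha> (S.dm u) = A.rg a" "a \<in> A"
      by (auto simp: D_inv_iff[OF x])
    then show "b \<in> D x" unfolding D_iff using th[of u a] sS[of u] lam_closed by metis
  next
    fix b assume "b \<in> D x"
    then obtain u where u: "u \<in> x" "\<alpha> (S.rg u) = A.rg b" "b \<in> A" by (auto simp: D_iff)
    then obtain a where a: "a \<in> A" "A.rg a = \<alpha> (S.dm u)" "lam u a = b"
      using lam_surj[of u b] sS by metis
    then have "a \<in> D (inv\<^bsub>S.G\<^esub> x)" "b = \<theta> x a" using u th[of u a] by (auto simp: D_inv_iff[OF x])
    then show "b \<in> \<theta> x ` D (inv\<^bsub>S.G\<^esub> x)" by blast
  qed
qed

text \<open>The factors are moved by members \<open>u\<close> and \<open>v\<close> of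
  \<open>x\<close>, the product by their restriction \<open>r\<close> to the meet of the domains.
  Writing \<open>lam r\<close> as \<open>lam u\<close> and as \<open>lam v\<close>, each cut by an
  idempotent, reduces the claim to multiplicativity of \<open>lam r\<close>.\<close>

lemma theta_mult:
  assumes x: "x \<in> carrier S.G" and a: "a \<in> D (inv\<^bsub>S.G\<^esub> x)" and b: "b \<in> D (inv\<^bsub>S.G\<^esub> x)"
  shows "\<theta> x (a \<odot> b) = \<theta> x a \<odot> \<theta> x b"
proof -
  have sS: "t \<in> S" if "t \<in> x" for t using that x S.mem_carrier_closed by blast
  obtain u where u: "u \<in> x" "\<alpha> (S.dm u) = A.rg a" "a \<in> A" using a by (auto simp: D_inv_iff[OF x])
  obtain v where v: "v \<in> x" "\<alpha> (S.dm v) = A.rg b" "b \<in> A" using b by (auto simp: D_inv_iff[OF x])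
  define r where "r = u \<cdot> S.dm v"
  have uS: "u \<in> S" and vS: "v \<in> S" using u v sS by auto
  have rS: "r \<in> S" and rx: "r \<in> x" using u v x uS vS by (auto simp: r_def S.mult_idem_mem)
  have dr: "S.dm r = S.dm u \<cdot> S.dm v" using uS vS by (simp add: r_def S.dm_mult_idem)
  have rv: "r = v \<cdot> S.dm u"
  proof (rule S.cls_dm_unique[OF x rx])
    show "v \<cdot> S.dm u \<in> x" using u v x uS by (simp add: S.mult_idem_mem)
    show "S.dm r = S.dm (v \<cdot> S.dm u)" using uS vS dr by (simp add: S.dm_mult_idem S.idem_comm)
  qed
  \<comment> \<open>\<open>E\<close>-unitarity makes \<open>u\<close> and \<open>v\<close> compatible: \<open>r\<close> is their common restriction on both sides.\<close>
  have q: "S.rg v \<cdot> u = S.rg u \<cdot> v"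
  proof (rule S.cls_rg_unique[OF x])
    show "S.rg v \<cdot> u \<in> x" "S.rg u \<cdot> v \<in> x" using u v x uS vS by (simp_all add: S.idem_mult_mem)
    show "S.rg (S.rg v \<cdot> u) = S.rg (S.rg u \<cdot> v)" using uS vS by (simp add: S.rg_idem_mult S.idem_comm)
  qed
  have "r = S.rg v \<cdot> (v \<cdot> S.dm u)" using uS vS by (simp add: rv flip: S.assoc)
  also have "\<dots> = S.rg v \<cdot> u \<cdot> S.dm v" using uS vS by (simp add: S.assoc r_def flip: rv)
  also have "\<dots> = S.rg u \<cdot> v" using uS vS by (simp add: q S.assoc)
  finally have ru: "r = S.rg u \<cdot> v" .
  have "\<alpha> (S.dm r) = A.rg (a \<odot> b)" using u v uS vS by (simp add: dr alpha_mult A.rg_mult_distrib)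
  then have "\<theta> x (a \<odot> b) = lam r (a \<odot> b)" using theta_eq_dm[OF x rx] u v by simp
  also have "\<dots> = lam r a \<odot> lam r b" using rS u v by (simp add: lam_mult)
  also have "lam r a = \<alpha> (S.rg v) \<odot> lam u a"
    using uS vS u by (simp add: ru lam_idem_mult flip: q)
  also have "lam r b = \<alpha> (S.rg u) \<odot> lam v b"
    using uS vS v by (simp add: ru lam_idem_mult)
  also have "\<alpha> (S.rg v) \<odot> lam u a \<odot> (\<alpha> (S.rg u) \<odot> lam v b)
      = \<alpha> (S.rg u) \<odot> lam u a \<odot> (\<alpha> (S.rg v) \<odot> lam v b)"
  proof -
    have "\<alpha> (S.rg v) \<odot> lam u a \<odot> (\<alpha> (S.rg u) \<odot> lam v b)
      = lam u a \<odot> \<alpha> (S.rg v) \<odot> (\<alpha> (S.rg u) \<odot> lam v b)"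
      using uS vS u v by (metis A.idem_central S.rg_idem alpha_idem lam_closed)
    also have "\<dots> = lam u a \<odot> (\<alpha> (S.rg u) \<odot> (\<alpha> (S.rg v) \<odot> lam v b))"
      using uS vS u v by (simp add: A.assoc A.idem_left_comm[of "\<alpha> (S.rg u)" "\<alpha> (S.rg v)"])
    also have "\<dots> = \<alpha> (S.rg u) \<odot> lam u a \<odot> (\<alpha> (S.rg v) \<odot> lam v b)"
      using uS vS u v by (simp add: A.assoc A.idem_left_comm[of "\<alpha> (S.rg u)" "lam u a"])
    finally show ?thesis .
  qed
  also have "\<dots> = lam u a \<odot> lam v b" using uS vS u v by (simp add: lam_absorb)
  also have "\<dots> = \<theta> x a \<odot> \<theta> x b" using theta_eq_dm[OF x] u v by simp
  finally show ?thesis .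
qed

lemma W_mult_rep:
  assumes x: "x \<in> carrier S.G" and y: "y \<in> carrier S.G"
  shows "A.mult_rep (D x \<inter> D (x \<otimes>\<^bsub>S.G\<^esub> y)) (W x y) (snd (W x y))"
  unfolding A.mult_rep_def
proof (intro conjI ballI impI)
  have S: "t \<in> S" if "t \<in> x \<or> t \<in> y" for t using that x y S.mem_carrier_closed by blast
  fix e assume e: "e \<in> D x \<inter> D (x \<otimes>\<^bsub>S.G\<^esub> y)" "e \<in> A.E"
  then obtain u v where uv: "u \<in> x" "v \<in> y" "S.dm u = S.rg v" "\<alpha> (S.rg u) = e"
    using D_pair[OF x y, of e] by auto
  have uS: "u \<in> S" and vS: "v \<in> S" using uv S by auto
  have rgf: "A.rg (f u v) = e" using uS vS uv by (simp add: S.rg_mult_composable)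
  have We: "snd (W x y) e = f u v"
    using W_eq(2)[OF x y uv(1-3), of e] uv(4) e(2) rgf uS vS by (metis A.rg_mult_self A.rg_of_idem f_closed)
  show "snd (W x y) e \<in> A" using We uS vS by simp
  show "A.rg (snd (W x y) e) = e" using We rgf by simp
  fix g assume g: "g \<in> A.E"
  then obtain p where p: "p \<in> S.E" "\<alpha> p = g" using alpha_surj by blast
  \<comment> \<open>Cutting \<open>u\<close> down to \<open>p \<cdot> u\<close> shrinks its domain,
    so \<open>v\<close> must be cut to that domain to keep the pair composable.\<close>
  define v' where "v' = S.dm (p \<cdot> u) \<cdot> v"
  have v'S: "v' \<in> S" using p uS vS by (simp add: v'_def)
  have pu: "p \<cdot> u \<in> x" and v': "v' \<in> y" using x y uv p uS
    by (simp_all add: S.idem_mult_mem v'_def)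
  have d: "S.dm (p \<cdot> u) = S.rg v'"
    using p uS vS by (simp add: v'_def S.rg_idem_mult flip: uv(3))
  have r: "\<alpha> (S.rg (p \<cdot> u)) = A.rg (e \<odot> g)"
    using p uS g e(2) uv(4) by (simp add: S.rg_idem_mult alpha_mult A.idem_comm)
  have "snd (W x y) (e \<odot> g) = (e \<odot> g) \<odot> f (p \<cdot> u) v'" by (rule W_eq(2)[OF x y pu v' d r])
  also have "f (p \<cdot> u) v' = g \<odot> f u v" using p uS vS by (simp add: v'_def f_dm f_mult_left)
  also have "e \<odot> g \<odot> (g \<odot> f u v) = e \<odot> f u v \<odot> g"
  proof -
    have "e \<odot> g \<odot> (g \<odot> f u v) = e \<odot> (g \<odot> f u v)"
      using e(2) g uS vS by (metis A.assoc A.closed A.idem_closed A.idem_mult_self f_closed)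
    also have "\<dots> = e \<odot> (f u v \<odot> g)" using g uS vS by (metis A.idem_central f_closed)
    finally show ?thesis using e(2) g uS vS by (simp add: A.assoc)
  qed
  also have "e \<odot> f u v = f u v" using rgf uS vS by (metis A.rg_mult_self f_closed)
  finally show "snd (W x y) (e \<odot> g) = snd (W x y) e \<odot> g" using We by simp
next
  fix a assume a: "a \<in> D x \<inter> D (x \<otimes>\<^bsub>S.G\<^esub> y)"
  then have aA: "a \<in> A" by (simp add: D_iff)
  obtain u v where uv: "u \<in> x" "v \<in> y" "S.dm u = S.rg v" "\<alpha> (S.rg u) = A.rg a"
    using a D_pair[OF x y, of a] by auto
  have uS: "u \<in> S" and vS: "v \<in> S" using uv x y S.mem_carrier_closed by auto
  have "snd (W x y) (A.rg a) = A.rg a \<odot> f u v"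
    using uv aA by (intro W_eq(2)[OF x y]) auto
  also have "A.rg a \<odot> f u v = f u v"
    using uS vS uv A.rg_mult_self[of "f u v"] by (simp add: S.rg_mult_composable)
  finally have "snd (W x y) (A.rg a) = f u v" .
  then show "fst (W x y) a = snd (W x y) (A.rg a) \<odot> a" "snd (W x y) a = a \<odot> snd (W x y) (A.rg a)"
    using W_eq[OF x y uv(1-4)] by simp_all
qed

lemma theta_image:
  assumes x: "x \<in> carrier S.G" and y: "y \<in> carrier S.G"
  shows "\<theta> x ` (D (inv\<^bsub>S.G\<^esub> x) \<inter> D y) = D x \<inter> D (x \<otimes>\<^bsub>S.G\<^esub> y)"
proof (intro equalityI subsetI)
  fix b assume "b \<in> \<theta> x ` (D (inv\<^bsub>S.G\<^esub> x) \<inter> D y)"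
  then obtain a where a: "a \<in> D (inv\<^bsub>S.G\<^esub> x)" "a \<in> D y" "b = \<theta> x a" by blast
  then have aA: "a \<in> A" by (simp add: D_iff)
  obtain u v where uv: "u \<in> x" "v \<in> y" "S.dm u = S.rg v" "\<alpha> (S.dm u) = A.rg a"
    using D_inv_pair[OF x y] a by blast
  have uS: "u \<in> S" and vS: "v \<in> S" using uv x y S.mem_carrier_closed by auto
  have b: "b = lam u a" using theta_eq_dm[OF x uv(1,4) aA] a by simp
  have "A.rg b = \<alpha> (S.rg u)" using aA uS by (simp add: b lam_rg flip: uv(4))
  moreover have "u \<cdot> v \<in> x \<otimes>\<^bsub>S.G\<^esub> y" using x y uv by (simp add: S.mult_mem)
  moreover have "S.rg (u \<cdot> v) = S.rg u" using uS vS uv by (simp add: S.rg_mult_composable)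
  moreover have "b \<in> A" using b aA uS by simp
  ultimately show "b \<in> D x \<inter> D (x \<otimes>\<^bsub>S.G\<^esub> y)" using uv(1) unfolding Int_iff D_iff by metis
next
  fix b assume "b \<in> D x \<inter> D (x \<otimes>\<^bsub>S.G\<^esub> y)"
  then obtain u v where uv: "u \<in> x" "v \<in> y" "S.dm u = S.rg v" "\<alpha> (S.rg u) = A.rg b" "b \<in> A"
    using D_pair[OF x y, of b] by (auto simp: D_iff[of b x])
  have uS: "u \<in> S" and vS: "v \<in> S" using uv x y S.mem_carrier_closed by auto
  obtain a where a: "a \<in> A" "A.rg a = \<alpha> (S.dm u)" "lam u a = b"
    using lam_surj[of u b] uv uS by metis
  have "a \<in> D (inv\<^bsub>S.G\<^esub> x)" unfolding D_inv_iff[OF x] using uv a by metis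
  moreover have "a \<in> D y" unfolding D_iff using uv a by metis
  moreover have "\<theta> x a = b" using theta_eq_dm[OF x uv(1)] a by simp
  ultimately show "b \<in> \<theta> x ` (D (inv\<^bsub>S.G\<^esub> x) \<inter> D y)" by blast
qed

lemma tpa_of_sieben: "tpa S.G A mA D \<theta> W"
proof -
  interpret G: group S.G by (rule S.group_maxgrp)
  have sp: "setprod mA (D x) (D y) = D x \<inter> D y" if "x \<in> carrier S.G" "y \<in> carrier S.G" for x y
    using that by (simp add: A.setprod_ideal D_ideal)
  have sp3: "setprod mA (setprod mA (D x) (D y)) (D z) = D x \<inter> D y \<inter> D z"
    if "x \<in> carrier S.G" "y \<in> carrier S.G" "z \<in> carrier S.G" for x y z
    using that by (simp add: A.setprod_ideal D_ideal A.ideal_inter)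
  show ?thesis unfolding tpa_def
  proof (intro conjI ballI)
    show "group S.G" by (rule S.group_maxgrp)
    show "is_ideal A mA (D x)" if "x \<in> carrier S.G" for x
      using D_ideal[OF that] by (simp add: A.ideal_def)
    show "bij_betw (\<theta> x) (D (inv\<^bsub>S.G\<^esub> x)) (D x)" if "x \<in> carrier S.G" for x
      using that by (rule theta_bij)
    show "\<theta> x (a \<odot> b) = \<theta> x a \<odot> \<theta> x b"
      if "x \<in> carrier S.G" "a \<in> D (inv\<^bsub>S.G\<^esub> x)" "b \<in> D (inv\<^bsub>S.G\<^esub> x)" for x a b
      using that by (rule theta_mult)
    show "is_unit_multiplier (setprod mA (D x) (D (x \<otimes>\<^bsub>S.G\<^esub> y))) mA (W x y)"
      if "x \<in> carrier S.G" "y \<in> carrier S.G" for x y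
      using that A.mult_rep_unit[OF _ W_mult_rep[OF that]] by (simp add: sp A.ideal_inter D_ideal)
    show "setprod mA (D x) (D x) = D x" if "x \<in> carrier S.G" for x
      using that by (simp add: sp)
    show "setprod mA (D x) (D y) = setprod mA (D y) (D x)"
      if "x \<in> carrier S.G" "y \<in> carrier S.G" for x y
      using that by (simp add: sp Int_commute)
    show "D \<one>\<^bsub>S.G\<^esub> = A"
    proof -
      have "a \<in> D \<one>\<^bsub>S.G\<^esub>" if a: "a \<in> A" for a
      proof -
        obtain p where p: "p \<in> S.E" "\<alpha> p = A.rg a" using a alpha_obtain by blast
        then have "\<alpha> (S.rg p) = A.rg a" by simp
        then show ?thesis using p a S.idem_mem_one unfolding D_iff by blast
      qed
      then show ?thesis by (auto simp: D_iff)
    qed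
    show "\<theta> \<one>\<^bsub>S.G\<^esub> a = a" if a: "a \<in> A" for a
    proof -
      obtain p where p: "p \<in> S.E" "\<alpha> p = A.rg a" using a alpha_obtain by blast
      have "\<theta> \<one>\<^bsub>S.G\<^esub> a = lam p a"
        using p a by (intro theta_eq_dm) (auto simp: S.idem_mem_one)
      then show ?thesis using p a by (simp add: lam_idem)
    qed
    show "\<theta> x ` setprod mA (D (inv\<^bsub>S.G\<^esub> x)) (D y) = setprod mA (D x) (D (x \<otimes>\<^bsub>S.G\<^esub> y))"
      if "x \<in> carrier S.G" "y \<in> carrier S.G" for x y
      using theta_image[OF that] that by (simp add: sp)
  next
    fix x y a assume x: "x \<in> carrier S.G" and y: "y \<in> carrier S.G"
      and "a \<in> setprod mA (D (inv\<^bsub>S.G\<^esub> y)) (D (inv\<^bsub>S.G\<^esub> y \<otimes>\<^bsub>S.G\<^esub> inv\<^bsub>S.G\<^esub> x))"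
    then have a: "a \<in> D (inv\<^bsub>S.G\<^esub> y)" "a \<in> D (inv\<^bsub>S.G\<^esub> y \<otimes>\<^bsub>S.G\<^esub> inv\<^bsub>S.G\<^esub> x)" by (simp_all add: sp)
    then have aA: "a \<in> A" by (simp add: D_iff)
    \<comment> \<open>The pair is found for the inverse classes in reversed order; inverting both
      entries yields composable \<open>u \<in> x\<close>, \<open>v \<in> y\<close> with the domain
      of \<open>v\<close> lying over \<open>a\<close>.\<close>
    obtain v0 u0 where uv0: "v0 \<in> inv\<^bsub>S.G\<^esub> y" "u0 \<in> inv\<^bsub>S.G\<^esub> x" "S.dm v0 = S.rg u0" "\<alpha> (S.rg v0) = A.rg a"
      using D_pair[OF _ _ a] x y by blast
    have S0: "u0 \<in> S" "v0 \<in> S"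
      using uv0 S.mem_carrier_closed[of "inv\<^bsub>S.G\<^esub> y"] S.mem_carrier_closed[of "inv\<^bsub>S.G\<^esub> x"] x y by auto
    define u v where "u = S.iv u0" and "v = S.iv v0"
    have S: "u \<in> S" "v \<in> S" using S0 by (auto simp: u_def v_def)
    have ux: "u \<in> x" and vy: "v \<in> y"
      using S.iv_mem[of "inv\<^bsub>S.G\<^esub> y" v0] S.iv_mem[of "inv\<^bsub>S.G\<^esub> x" u0] uv0 x y by (simp_all add: u_def v_def)
    have uv: "S.dm u = S.rg v" and va: "\<alpha> (S.dm v) = A.rg a" using uv0 S0 by (simp_all add: u_def v_def)
    have rv: "A.rg (lam v a) = \<alpha> (S.dm u)" using S aA va uv by (simp add: rg_lam)
    have "\<theta> x (\<theta> y a) = lam u (lam v a)"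
      using theta_eq_dm[OF y vy va aA] theta_eq_dm[OF x ux, of "lam v a"] rv S aA by simp
    also have "\<dots> = f u v \<odot> lam (u \<cdot> v) a \<odot> A.iv (f u v)" using S aA by (simp add: lam_lam)
    finally have l: "\<theta> x (\<theta> y a) = f u v \<odot> lam (u \<cdot> v) a \<odot> A.iv (f u v)" .
    have xy: "u \<cdot> v \<in> x \<otimes>\<^bsub>S.G\<^esub> y" using x y ux vy by (simp add: S.mult_mem)
    have duv: "\<alpha> (S.dm (u \<cdot> v)) = A.rg a" using S uv va by (simp add: S.dm_mult_composable)
    have t: "\<theta> (x \<otimes>\<^bsub>S.G\<^esub> y) a = lam (u \<cdot> v) a"
      using x y xy aA duv by (intro theta_eq_dm) auto
    have rt: "A.rg (lam (u \<cdot> v) a) = \<alpha> (S.rg u)"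
      using S aA duv uv by (simp add: rg_lam S.rg_mult_composable)
    have T: "lam (u \<cdot> v) a \<in> D x \<inter> D (x \<otimes>\<^bsub>S.G\<^esub> y)"
    proof -
      have "S.rg (u \<cdot> v) = S.rg u" using S uv by (simp add: S.rg_mult_composable)
      moreover have "lam (u \<cdot> v) a \<in> A" using S aA by simp
      ultimately show ?thesis using rt ux xy unfolding Int_iff D_iff by metis
    qed
    have W: "snd (W x y) (A.rg (lam (u \<cdot> v) a)) = f u v"
    proof -
      have "snd (W x y) (A.rg (lam (u \<cdot> v) a)) = A.rg (f u v) \<odot> f u v"
        using W_eq(2)[OF x y ux vy uv, of "A.rg (lam (u \<cdot> v) a)"] S uv rt by (simp add: S.rg_mult_composable)
      also have "\<dots> = f u v" by (rule A.rg_mult_self) (use S in auto)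
      finally show ?thesis .
    qed
    show "\<theta> x (\<theta> y a) = snd (minv (setprod mA (D x) (D (x \<otimes>\<^bsub>S.G\<^esub> y))) mA (W x y)) (fst (W x y) (\<theta> (x \<otimes>\<^bsub>S.G\<^esub> y) a))"
      using A.snd_minv_fst[OF _ W_mult_rep[OF x y] T] x y
      by (simp add: sp l t W A.ideal_inter D_ideal)
  next
    fix x a assume x: "x \<in> carrier S.G" and a: "a \<in> D x"
    then have aA: "a \<in> A" by (simp add: D_iff)
    obtain s where s: "s \<in> x" "\<alpha> (S.rg s) = A.rg a" using a by (auto simp: D_iff)
    have sS: "s \<in> S" using x s S.mem_carrier_closed by blast
    \<comment> \<open>The composable pairs over \<open>a\<close> are \<open>(S.rg s, s)\<close> for
      the classes of one and \<open>x\<close>, and \<open>(s, S.dm s)\<close> for \<open>x\<close>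
      and one; the twist is idempotent at both.\<close>
    have 1: "f (S.rg s) s = A.rg a" "f s (S.dm s) = A.rg a" using sS s by (simp_all add: f_idem_left f_idem_right)
    show "fst (W \<one>\<^bsub>S.G\<^esub> x) a = a" "snd (W \<one>\<^bsub>S.G\<^esub> x) a = a"
      using W_eq[OF G.one_closed x, of "S.rg s" s a] s sS aA 1 by (simp_all add: S.idem_mem_one)
    show "fst (W x \<one>\<^bsub>S.G\<^esub>) a = a" "snd (W x \<one>\<^bsub>S.G\<^esub>) a = a"
      using W_eq[OF x G.one_closed, of s "S.dm s" a] s sS aA 1 by (simp_all add: S.idem_mem_one)
  next
    fix x y z a assume x: "x \<in> carrier S.G" and y: "y \<in> carrier S.G" and z: "z \<in> carrier S.G"
      and "a \<in> setprod mA (setprod mA (D (inv\<^bsub>S.G\<^esub> x)) (D y)) (D (y \<otimes>\<^bsub>S.G\<^esub> z))"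
    then have a: "a \<in> D (inv\<^bsub>S.G\<^esub> x)" "a \<in> D y" "a \<in> D (y \<otimes>\<^bsub>S.G\<^esub> z)" by (simp_all add: sp3)
    then have aA: "a \<in> A" by (simp add: D_iff)
    \<comment> \<open>A composable triple \<open>u\<close>, \<open>v\<close>, \<open>t\<close> over
      \<open>a\<close> turns all four multipliers into values of \<open>f\<close>, after which the
      multiplier identity is the cocycle identity for \<open>f\<close>.\<close>
    obtain v t where vt: "v \<in> y" "t \<in> z" "S.dm v = S.rg t" "\<alpha> (S.rg v) = A.rg a"
      using D_pair[OF y z] a by blast
    obtain u where u: "u \<in> x" "\<alpha> (S.dm u) = A.rg a" using a by (auto simp: D_inv_iff[OF x])
    have S: "u \<in> S" "v \<in> S" "t \<in> S" using x y z u vt S.mem_carrier_closed by auto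
    have uv: "S.dm u = S.rg v" using S u vt by (metis S.dm_idem S.rg_idem alpha_eq_iff)
    have 1: "snd (W y z) a = a \<odot> f v t" by (rule W_eq(2)[OF y z vt])
    have rvt: "A.rg (a \<odot> f v t) = A.rg a"
      using S aA vt by (simp add: A.rg_mult_distrib S.rg_mult_composable)
    have 2: "\<theta> x (a \<odot> f v t) = lam u (a \<odot> f v t)"
      using S aA u rvt by (intro theta_eq_dm[OF x]) auto
    have 3: "snd (W x (y \<otimes>\<^bsub>S.G\<^esub> z)) (lam u (a \<odot> f v t)) = lam u (a \<odot> f v t) \<odot> f u (v \<cdot> t)"
    proof (rule W_eq(2)[OF x _ u(1)])
      show "S.dm u = S.rg (v \<cdot> t)" using S uv vt by (simp add: S.rg_mult_composable)
      show "\<alpha> (S.rg u) = A.rg (lam u (a \<odot> f v t))" using S aA u rvt by (simp add: rg_lam)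
    qed (use y z vt in \<open>auto simp: S.mult_mem\<close>)
    have 4: "\<theta> x a = lam u a" by (rule theta_eq_dm[OF x u aA])
    have 5: "snd (W x y) (lam u a) = lam u a \<odot> f u v"
      using S aA u vt uv by (intro W_eq(2)[OF x y]) (auto simp: rg_lam)
    have 6: "snd (W (x \<otimes>\<^bsub>S.G\<^esub> y) z) (lam u a \<odot> f u v) = lam u a \<odot> f u v \<odot> f (u \<cdot> v) t"
    proof (rule W_eq(2)[OF _ z _ vt(2)])
      show "S.dm (u \<cdot> v) = S.rg t" using S uv vt by (simp add: S.dm_mult_composable)
      show "\<alpha> (S.rg (u \<cdot> v)) = A.rg (lam u a \<odot> f u v)"
        using S aA u uv by (simp add: A.rg_mult_distrib rg_lam S.rg_mult_composable)
    qed (use x y u vt in \<open>auto simp: S.mult_mem\<close>)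
    have "lam u (a \<odot> f v t) \<odot> f u (v \<cdot> t) = lam u a \<odot> (lam u (f v t) \<odot> f u (v \<cdot> t))"
      using S aA by (simp add: lam_mult A.assoc)
    also have "\<dots> = lam u a \<odot> f u v \<odot> f (u \<cdot> v) t"
      using S aA by (simp add: f_cocycle A.assoc)
    finally show "snd (W x (y \<otimes>\<^bsub>S.G\<^esub> z)) (\<theta> x (snd (W y z) a)) =
        snd (W (x \<otimes>\<^bsub>S.G\<^esub> y) z) (snd (W x y) (\<theta> x a))"
      by (simp add: 1 2 3 4 5 6)
  qed
qed

section \<open>Recovering a Sieben module from its twisted partial action\<close>

definition nu :: "'a \<Rightarrow> 'b \<times> 'a set" where "nu s = (\<alpha> (S.rg s), S.cls s)"

lemma theta_inv_alpha:
  assumes x: "x \<in> carrier S.G" and s: "s \<in> x"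
  shows "theta_inv S.G D \<theta> x (\<alpha> (S.rg s)) = \<alpha> (S.dm s)"
  unfolding theta_inv_def
proof (rule the_inv_into_f_eq)
  have sS: "s \<in> S" using x s S.mem_carrier_closed by blast
  show "inj_on (\<theta> x) (D (inv\<^bsub>S.G\<^esub> x))" using theta_bij[OF x] by (rule bij_betw_imp_inj_on)
  show "\<theta> x (\<alpha> (S.dm s)) = \<alpha> (S.rg s)" using theta_eq_dm[OF x s] sS by simp
  have "\<alpha> (S.dm s) = A.rg (\<alpha> (S.dm s))" using sS by simp
  then show "\<alpha> (S.dm s) \<in> D (inv\<^bsub>S.G\<^esub> x)" unfolding D_inv_iff[OF x] using s sS by blast
qed

lemma lmLam_nu:
  assumes s: "s \<in> S" and a: "a \<in> A"
  shows "\<theta> (S.cls s) (theta_inv S.G D \<theta> (S.cls s) (\<alpha> (S.rg s)) \<odot> a) = lam s a"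
proof -
  have "\<theta> (S.cls s) (\<alpha> (S.dm s) \<odot> a) = lam s (\<alpha> (S.dm s) \<odot> a)"
    using s a by (intro theta_eq) (auto simp flip: A.assoc)
  then show ?thesis using s a by (simp add: theta_inv_alpha lam_dm)
qed

lemma lmLam_nu_alpha: "s \<in> S \<Longrightarrow> t \<in> S \<Longrightarrow>
    \<theta> (S.cls s) (theta_inv S.G D \<theta> (S.cls s) (\<alpha> (S.rg s)) \<odot> \<alpha> (S.rg t)) = \<alpha> (S.rg (s \<cdot> t))"
  by (simp add: lmLam_nu lam_alpha S.rg_mult_rg_right)

lemma nu_iso: "sg_iso nu S m (cross_car S.G mA D) (cross_mult S.G mA D \<theta>)"
  unfolding sg_iso_def
proof (intro conjI ballI)
  show "bij_betw nu S (cross_car S.G mA D)"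
  proof (rule bij_betw_imageI)
    show "inj_on nu S"
    proof (rule inj_onI)
      fix s t assume st: "s \<in> S" "t \<in> S" "nu s = nu t"
      then have "S.rg s = S.rg t" "S.cls s = S.cls t" by (auto simp: nu_def alpha_eq_iff)
      then show "s = t" using st S.cls_rg_unique[of "S.cls s" s t] by (metis S.cls_carrier S.mem_cls_self)
    qed
    show "nu ` S = cross_car S.G mA D"
    proof (intro equalityI subsetI)
      fix q assume "q \<in> nu ` S"
      then obtain s where s: "s \<in> S" "q = nu s" by blast
      have "\<alpha> (S.rg s) = A.rg (\<alpha> (S.rg s))" using s by simp
      then have "\<alpha> (S.rg s) \<in> D (S.cls s)" unfolding D_iff using s S.mem_cls_self by blast
      then show "q \<in> cross_car S.G mA D"
        using s by (simp add: nu_def cross_car_def A.idems_subset D_ideal)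
    next
      fix q assume "q \<in> cross_car S.G mA D"
      then obtain e x where q: "q = (e, x)" "x \<in> carrier S.G" "e \<in> D x" "e \<in> A.E"
        unfolding cross_car_def by (auto simp: A.idems_subset D_ideal)
      then obtain s where s: "s \<in> x" "\<alpha> (S.rg s) = e" by (auto simp: D_iff)
      then have "s \<in> S" "q = nu s"
        using q S.mem_carrier_closed S.mem_carrier_cls by (auto simp: nu_def)
      then show "q \<in> nu ` S" by blast
    qed
  qed
  fix s t assume "s \<in> S" "t \<in> S"
  then show "nu (s \<cdot> t) = cross_mult S.G mA D \<theta> (nu s) (nu t)"
    by (simp add: nu_def cross_mult_def lmLam_nu_alpha S.cls_mult_cls)
qed

lemma nu_comp_eq:
  "tms_comp_eq S m A \<alpha> lam f lmAlpha (lmLam S.G mA D \<theta>) (lmF S.G mA D \<theta> W) nu"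
  unfolding tms_comp_eq_def
proof (intro conjI ballI)
  show "\<alpha> e = lmAlpha (nu e)" if "e \<in> S.E" for e
    using that by (simp add: lmAlpha_def nu_def)
  show "lam s a = lmLam S.G mA D \<theta> (nu s) a" if "s \<in> S" "a \<in> A" for s a
    using that by (simp add: lmLam_def nu_def lmLam_nu)
  fix s t assume st: "s \<in> S" "t \<in> S"
  \<comment> \<open>Arbitrary \<open>s\<close>, \<open>t\<close> need not compose exactly. These
    restrictions do, stay in the same classes and leave both the range of the product and the value
    of \<open>f\<close> unchanged.\<close>
  define u v where "u = s \<cdot> S.rg t" and "v = S.dm s \<cdot> t"
  have uv: "S.dm u = S.rg v" "S.rg u = S.rg (s \<cdot> t)"
    using st by (simp_all add: u_def v_def S.dm_mult_idem S.rg_idem_mult S.rg_mult_rg_right)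
  have "u \<in> S.cls s" "v \<in> S.cls t"
    using st by (simp_all add: u_def v_def S.mult_idem_mem S.idem_mult_mem)
  then have "snd (W (S.cls s) (S.cls t)) (\<alpha> (S.rg (s \<cdot> t))) = \<alpha> (S.rg (s \<cdot> t)) \<odot> f u v"
    using st uv by (intro W_eq(2)) auto
  also have "f u v = f s (S.rg t \<cdot> (S.dm s \<cdot> t))" using st by (simp add: u_def v_def f_shift)
  also have "S.rg t \<cdot> (S.dm s \<cdot> t) = S.dm s \<cdot> t"
    using st by (metis S.assoc S.idem_comm S.idem_closed S.dm_idem S.rg_idem S.rg_mult_self)
  also have "f s (S.dm s \<cdot> t) = f s t" using st by (simp add: f_dm)
  also have "\<alpha> (S.rg (s \<cdot> t)) \<odot> f s t = f s t" using st A.rg_mult_self[of "f s t"] by simp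
  finally show "f s t = lmF S.G mA D \<theta> W (nu s) (nu t)"
    using st by (simp add: lmF_def nu_def lmLam_nu_alpha)
qed

text \<open>The witness \<open>g\<close> commutes with restriction, hence its values on a class
  \<open>x\<close>, indexed by ranges, form the compatible family of a unit multiplier
  \<open>\<epsilon> x\<close> of \<open>D x\<close>.\<close>

lemma tpa_equiv_of_tms_equiv:
  assumes "sieben A mA S m \<alpha>' lam' f'" and eq: "tms_equiv S m A mA \<alpha> lam f \<alpha>' lam' f'"
  shows "tpa_equiv S.G A mA D \<theta> W (thD S m A mA \<alpha>') (thTheta S m A mA \<alpha>' lam') (thW S m A mA \<alpha>' f')"
proof -
  interpret L': sieben A mA S m \<alpha>' lam' f' by fact
  interpret G: group S.G by (rule S.group_maxgrp)
  have al: "\<alpha>' p = \<alpha> p" if "p \<in> S.E" for p using eq that by (simp add: tms_equiv_def)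
  obtain g where g: "\<forall>s\<in>S. g s \<in> Agrp A mA (\<alpha> (s \<cdot> S.iv s)) \<and>
          (\<forall>a\<in>A. lam' s a = g s \<odot> lam s a \<odot> A.iv (g s)) \<and>
          (\<forall>t\<in>S. f' s t \<odot> g (s \<cdot> t) = g s \<odot> lam s (g t) \<odot> f s t)"
    using eq unfolding tms_equiv_def by blast
  have gA [simp, intro]: "g s \<in> A" and rgg [simp]: "A.rg (g s) = \<alpha> (S.rg s)" if "s \<in> S" for s
    using g that unfolding S.rg_def[symmetric] A.Agrp_iff by blast+
  have glam: "lam' s a = g s \<odot> lam s a \<odot> A.iv (g s)" if "s \<in> S" "a \<in> A" for s a
    using g that by blast
  have gf: "f' s t \<odot> g (s \<cdot> t) = g s \<odot> lam s (g t) \<odot> f s t" if "s \<in> S" "t \<in> S" for s t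
    using g that by blast
  \<comment> \<open>The equation for \<open>g\<close> at the pair \<open>(p, p)\<close> collapses to
    \<open>g p = g p \<odot> g p\<close>, and the only idempotent of a group is its
    identity.\<close>
  have g_idem: "g p = \<alpha> p" if p: "p \<in> S.E" for p
  proof -
    have gp: "g p \<in> A" "A.rg (g p) = \<alpha> p" using p by simp_all
    have "\<alpha> p \<odot> g p = g p \<odot> (\<alpha> p \<odot> g p) \<odot> \<alpha> p"
      using gf[of p p] p by (simp add: al f_idem_right L'.f_idem_right lam_idem)
    moreover have "\<alpha> p \<odot> g p = g p" "g p \<odot> \<alpha> p = g p"
      using gp A.rg_mult_self[of "g p"] A.mult_rg_self[of "g p"] by simp_all
    ultimately have "g p = g p \<odot> g p" using gp p by (simp add: A.assoc)
    then have "g p \<in> A.E" using gp by (intro A.idemI) auto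
    then show ?thesis using gp by simp
  qed
  \<comment> \<open>The equation at \<open>(p, s)\<close>: both twists are idempotent and
    \<open>g p\<close> is already known.\<close>
  have g_mult: "g (p \<cdot> s) = \<alpha> p \<odot> g s" if p: "p \<in> S.E" and s: "s \<in> S" for p s
  proof -
    have r: "A.rg (\<alpha> p \<odot> g s) = \<alpha> (S.rg (p \<cdot> s))" "A.rg (g (p \<cdot> s)) = \<alpha> (S.rg (p \<cdot> s))"
      using p s by (simp_all add: A.rg_idem_mult S.rg_idem_mult alpha_mult)
    have "\<alpha> (S.rg (p \<cdot> s)) \<odot> g (p \<cdot> s) = \<alpha> p \<odot> (\<alpha> p \<odot> g s) \<odot> \<alpha> (S.rg (p \<cdot> s))"
      using gf[of p s] p s by (simp add: al f_idem_left L'.f_idem_left lam_idem g_idem)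
    also have "\<alpha> p \<odot> (\<alpha> p \<odot> g s) = \<alpha> p \<odot> g s" using p s by (simp flip: A.assoc)
    finally show ?thesis using r p s
      by (metis A.closed A.mult_rg_self A.rg_mult_self S.closed S.idem_closed alpha_closed gA)
  qed
  have rglam': "A.rg (lam' u a) = \<alpha> (S.rg u)" if "u \<in> S" "a \<in> A" "\<alpha> (S.dm u) = A.rg a" for u a
  proof -
    have "A.rg a = \<alpha>' (S.dm u)" using that al by simp
    then show ?thesis using that(1,2) al by (metis L'.lam_rg L'.lam_alpha_dm S.rg_idem)
  qed
  have D': "L'.D x = D x" if "x \<in> carrier S.G" for x
  proof -
    have "\<alpha>' (S.rg s) = \<alpha> (S.rg s)" if "s \<in> x" for s
      using that \<open>x \<in> carrier S.G\<close> S.mem_carrier_closed al by simp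
    then show ?thesis by (auto simp: D_iff L'.D_iff)
  qed
  \<comment> \<open>The value at \<open>e\<close> is \<open>g\<close> at the member of
    \<open>x\<close> with range \<open>e\<close>. As \<open>pick_r\<close> depends on its argument
    through the range alone, \<open>c x\<close> may be applied to any element of
    \<open>D x\<close>.\<close>
  define c where "c x e = g (pick_r S m A mA \<alpha> x e)" for x e
  define \<epsilon> where "\<epsilon> x = (\<lambda>a. c x a \<odot> a, \<lambda>a. a \<odot> c x a)" for x
  have c_eq: "c x a = g s" if "x \<in> carrier S.G" "s \<in> x" "\<alpha> (S.rg s) = A.rg a" for x s a
    using pick_r_eq[OF that] by (simp add: c_def)
  have rep: "A.mult_rep (D x) (\<epsilon> x) (c x)" if x: "x \<in> carrier S.G" for x
    unfolding A.mult_rep_def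
  proof (intro conjI ballI impI)
    fix e assume e: "e \<in> D x" "e \<in> A.E"
    then obtain s where s: "s \<in> x" "\<alpha> (S.rg s) = e" by (auto simp: D_iff)
    have sS: "s \<in> S" using x s S.mem_carrier_closed by blast
    have ce: "c x e = g s" using c_eq[OF x s(1)] s e by simp
    show "c x e \<in> A" "A.rg (c x e) = e" using ce sS s by simp_all
    fix h assume h: "h \<in> A.E"
    then obtain p where p: "p \<in> S.E" "\<alpha> p = h" using alpha_surj by blast
    have "c x (e \<odot> h) = g (p \<cdot> s)"
      using x s p sS e h by (intro c_eq) (auto simp: S.idem_mult_mem S.rg_idem_mult alpha_mult A.idem_comm)
    also have "\<dots> = h \<odot> g s" using p sS by (simp add: g_mult)
    also have "\<dots> = g s \<odot> h" using h sS by (metis A.idem_central gA)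
    finally show "c x (e \<odot> h) = c x e \<odot> h" using ce by simp
  next
    fix a assume a: "a \<in> D x"
    then obtain s where s: "s \<in> x" "\<alpha> (S.rg s) = A.rg a" "a \<in> A" by (auto simp: D_iff)
    have "c x a = c x (A.rg a)" using c_eq[OF x s(1)] s by simp
    then show "fst (\<epsilon> x) a = c x (A.rg a) \<odot> a" "snd (\<epsilon> x) a = a \<odot> c x (A.rg a)" by (simp_all add: \<epsilon>_def)
  qed
  have th: "\<theta> x a = lam u a" "L'.\<theta> x a = lam' u a" "lam u a \<in> D x"
    if "x \<in> carrier S.G" "u \<in> x" "\<alpha> (S.dm u) = A.rg a" "a \<in> A" for x u a
  proof -
    have uS: "u \<in> S" using that S.mem_carrier_closed by blast
    show "\<theta> x a = lam u a" using that by (intro theta_eq_dm) auto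
    show "L'.\<theta> x a = lam' u a" using that uS al by (intro L'.theta_eq_dm) auto
    have "A.rg (lam u a) = \<alpha> (S.rg u)" "lam u a \<in> A" using that uS by (simp_all add: rg_lam)
    then show "lam u a \<in> D x" unfolding D_iff using that by metis
  qed
  show ?thesis unfolding tpa_equiv_def
  proof (intro conjI ballI exI[of _ \<epsilon>])
    show "L'.D x = D x" if "x \<in> carrier S.G" for x using that by (rule D')
    show "is_unit_multiplier (D x) mA (\<epsilon> x)" if "x \<in> carrier S.G" for x
      using that by (intro A.mult_rep_unit[OF D_ideal rep])
  next
    fix x a assume x: "x \<in> carrier S.G" and a: "a \<in> D (inv\<^bsub>S.G\<^esub> x)"
    then obtain u where u: "u \<in> x" "\<alpha> (S.dm u) = A.rg a" "a \<in> A" by (auto simp: D_inv_iff[OF x])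
    have uS: "u \<in> S" using x u S.mem_carrier_closed by blast
    have "c x (A.rg (lam u a)) = g u" using rg_lam[OF uS u(3,2)] uS by (intro c_eq[OF x u(1)]) simp
    then show "L'.\<theta> x a = snd (minv (D x) mA (\<epsilon> x)) (fst (\<epsilon> x) (\<theta> x a))"
      using th[OF x u] glam[OF uS u(3)] A.snd_minv_fst[OF D_ideal[OF x] rep[OF x]] by simp
  next
    fix x y a assume x: "x \<in> carrier S.G" and y: "y \<in> carrier S.G"
      and "a \<in> setprod mA (D (inv\<^bsub>S.G\<^esub> x)) (D y)"
    then have a: "a \<in> D (inv\<^bsub>S.G\<^esub> x)" "a \<in> D y" by (simp_all add: A.setprod_ideal D_ideal)
    then have aA: "a \<in> A" by (simp add: D_iff)
    obtain u v where uv: "u \<in> x" "v \<in> y" "S.dm u = S.rg v" "\<alpha> (S.dm u) = A.rg a"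
      using D_inv_pair[OF x y a] by blast
    have S: "u \<in> S" "v \<in> S" using uv x y S.mem_carrier_closed by auto
    have xy: "u \<cdot> v \<in> x \<otimes>\<^bsub>S.G\<^esub> y" "S.rg (u \<cdot> v) = S.rg u"
      using x y S uv by (simp_all add: S.mult_mem S.rg_mult_composable)
    note rl = rg_lam[OF S(1) aA uv(4)] and rl' = rglam'[OF S(1) aA uv(4)]
    have 1: "snd (L'.W x y) (lam' u a) = lam' u a \<odot> f' u v"
      using S uv rl' al by (intro L'.W_eq(2)[OF x y]) auto
    have rg1: "A.rg (lam' u a \<odot> f' u v) = \<alpha> (S.rg u)"
      using S aA rl' xy al by (simp add: A.rg_mult_distrib)
    have 2: "snd (\<epsilon> (x \<otimes>\<^bsub>S.G\<^esub> y)) (lam' u a \<odot> f' u v) = lam' u a \<odot> f' u v \<odot> g (u \<cdot> v)"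
      using c_eq[OF _ xy(1), of "lam' u a \<odot> f' u v"] x y rg1 xy by (simp add: \<epsilon>_def)
    have 3: "snd (\<epsilon> y) a = a \<odot> g v" using c_eq[OF y uv(2), of a] uv by (simp add: \<epsilon>_def)
    have rg3: "A.rg (a \<odot> g v) = A.rg a" using S aA uv by (simp add: A.rg_mult_distrib)
    have 4: "\<theta> x (a \<odot> g v) = lam u (a \<odot> g v)" using S aA uv rg3 by (intro th(1)[OF x uv(1)]) auto
    have rg4: "A.rg (lam u (a \<odot> g v)) = \<alpha> (S.rg u)" using S aA uv rg3 by (intro rg_lam) auto
    have 5: "fst (\<epsilon> x) (lam u (a \<odot> g v)) = g u \<odot> lam u (a \<odot> g v)"
      using c_eq[OF x uv(1), of "lam u (a \<odot> g v)"] rg4 by (simp add: \<epsilon>_def)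
    have 6: "snd (W x y) (g u \<odot> lam u (a \<odot> g v)) = g u \<odot> lam u (a \<odot> g v) \<odot> f u v"
      using S aA rg4 by (intro W_eq(2)[OF x y uv(1-3)]) (simp add: A.rg_mult_distrib)
    have "lam' u a \<odot> f' u v \<odot> g (u \<cdot> v) = lam' u a \<odot> (g u \<odot> lam u (g v) \<odot> f u v)"
      using S aA gf[of u v] by (simp add: A.assoc)
    also have "\<dots> = g u \<odot> lam u a \<odot> (A.iv (g u) \<odot> g u \<odot> lam u (g v)) \<odot> f u v"
      using S aA by (simp only: glam A.assoc A.closed A.iv_closed gA lam_closed f_closed)
    also have "A.iv (g u) \<odot> g u \<odot> lam u (g v) = lam u (g v)" using S by (simp add: lam_absorb)
    also have "g u \<odot> lam u a \<odot> lam u (g v) \<odot> f u v = g u \<odot> lam u (a \<odot> g v) \<odot> f u v"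
      using S aA by (simp add: lam_mult A.assoc)
    finally show "snd (\<epsilon> (x \<otimes>\<^bsub>S.G\<^esub> y)) (snd (L'.W x y) (L'.\<theta> x a)) =
           snd (W x y) (fst (\<epsilon> x) (\<theta> x (snd (\<epsilon> y) a)))"
      using th[OF x uv(1,4) aA] by (simp add: 1 2 3 4 5 6)
  qed
qed

end

section \<open>The Sieben module of a twisted partial action\<close>

locale tpact = A: clifford A mA
  for A :: "'b set" and mA :: "'b \<Rightarrow> 'b \<Rightarrow> 'b" (infixl "\<odot>" 70) +
  fixes G :: "'g monoid" (structure) and D :: "'g \<Rightarrow> 'b set" and \<theta> :: "'g \<Rightarrow> 'b \<Rightarrow> 'b"
    and w :: "'g \<Rightarrow> 'g \<Rightarrow> ('b \<Rightarrow> 'b) \<times> ('b \<Rightarrow> 'b)"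
  assumes tpa: "tpa G A mA D \<theta> w"
begin

section \<open>Reading the axioms of a twisted partial action through elements of
  \<open>A\<close>\<close>

sublocale G: group G using tpa by (simp add: tpa_def)

lemma D_ideal: "x \<in> carrier G \<Longrightarrow> A.ideal (D x)"
  using tpa by (simp add: tpa_def A.ideal_def)

lemma theta_bij: "x \<in> carrier G \<Longrightarrow> bij_betw (\<theta> x) (D (inv x)) (D x)"
  using tpa by (simp add: tpa_def)

lemma theta_mult: "x \<in> carrier G \<Longrightarrow> a \<in> D (inv x) \<Longrightarrow> b \<in> D (inv x) \<Longrightarrow> \<theta> x (a \<odot> b) = \<theta> x a \<odot> \<theta> x b"
  using tpa by (simp add: tpa_def)

lemma D_one [simp]: "D \<one> = A"
  using tpa by (simp add: tpa_def)

lemma theta_one [simp]: "a \<in> A \<Longrightarrow> \<theta> \<one> a = a"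
  using tpa by (simp add: tpa_def)

lemma setprod_D: "x \<in> carrier G \<Longrightarrow> y \<in> carrier G \<Longrightarrow> setprod mA (D x) (D y) = D x \<inter> D y"
  by (simp add: A.setprod_ideal D_ideal)

lemma setprod3_D: "x \<in> carrier G \<Longrightarrow> y \<in> carrier G \<Longrightarrow> z \<in> carrier G \<Longrightarrow>
    setprod mA (setprod mA (D x) (D y)) (D z) = D x \<inter> D y \<inter> D z"
  by (simp add: A.setprod_ideal D_ideal A.ideal_inter)

lemma theta_image: "x \<in> carrier G \<Longrightarrow> y \<in> carrier G \<Longrightarrow> \<theta> x ` (D (inv x) \<inter> D y) = D x \<inter> D (x \<otimes> y)"
proof -
  assume xy: "x \<in> carrier G" "y \<in> carrier G"
  have "\<theta> x ` setprod mA (D (inv x)) (D y) = setprod mA (D x) (D (x \<otimes> y))"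
    using tpa xy unfolding tpa_def by blast
  then show ?thesis using xy by (simp add: setprod_D)
qed

abbreviation c :: "'g \<Rightarrow> 'g \<Rightarrow> 'b \<Rightarrow> 'b" where "c x y \<equiv> snd (w x y)"

lemma w_rep: "x \<in> carrier G \<Longrightarrow> y \<in> carrier G \<Longrightarrow> A.mult_rep (D x \<inter> D (x \<otimes> y)) (w x y) (c x y)"
proof -
  assume xy: "x \<in> carrier G" "y \<in> carrier G"
  have "is_unit_multiplier (setprod mA (D x) (D (x \<otimes> y))) mA (w x y)"
    using tpa xy by (simp add: tpa_def)
  then show ?thesis using xy by (intro A.unit_mult_rep) (simp_all add: setprod_D A.ideal_inter D_ideal)
qed

lemma D_closed: "x \<in> carrier G \<Longrightarrow> a \<in> D x \<Longrightarrow> a \<in> A"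
  using D_ideal A.ideal_sub by blast

lemma D_left: "x \<in> carrier G \<Longrightarrow> a \<in> A \<Longrightarrow> b \<in> D x \<Longrightarrow> a \<odot> b \<in> D x"
  using D_ideal A.ideal_left by blast

lemma D_right: "x \<in> carrier G \<Longrightarrow> a \<in> D x \<Longrightarrow> b \<in> A \<Longrightarrow> a \<odot> b \<in> D x"
  using D_ideal A.ideal_right by blast

lemma D_rg_iff: "x \<in> carrier G \<Longrightarrow> a \<in> A \<Longrightarrow> A.rg a \<in> D x \<longleftrightarrow> a \<in> D x"
  using D_ideal A.ideal_rg_iff by blast

lemma c_closed: "x \<in> carrier G \<Longrightarrow> y \<in> carrier G \<Longrightarrow> e \<in> D x \<Longrightarrow> e \<in> D (x \<otimes> y) \<Longrightarrow> e \<in> A.E \<Longrightarrow> c x y e \<in> A"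
  and rg_c: "x \<in> carrier G \<Longrightarrow> y \<in> carrier G \<Longrightarrow> e \<in> D x \<Longrightarrow> e \<in> D (x \<otimes> y) \<Longrightarrow> e \<in> A.E \<Longrightarrow> A.rg (c x y e) = e"
  and c_restrict: "x \<in> carrier G \<Longrightarrow> y \<in> carrier G \<Longrightarrow> e \<in> D x \<Longrightarrow> e \<in> D (x \<otimes> y) \<Longrightarrow> e \<in> A.E \<Longrightarrow>
      g \<in> A.E \<Longrightarrow> c x y (e \<odot> g) = c x y e \<odot> g"
  using w_rep[of x y] A.mult_rep_closed A.mult_rep_rg A.mult_rep_restrict by blast+

lemma theta_mem: "x \<in> carrier G \<Longrightarrow> a \<in> D (inv x) \<Longrightarrow> \<theta> x a \<in> D x"
  using theta_bij by (meson bij_betwE)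

lemma theta_closed: "x \<in> carrier G \<Longrightarrow> a \<in> D (inv x) \<Longrightarrow> \<theta> x a \<in> A"
  using theta_mem D_closed by blast

lemma theta_mem_mult: "x \<in> carrier G \<Longrightarrow> y \<in> carrier G \<Longrightarrow> a \<in> D (inv x) \<Longrightarrow> a \<in> D y \<Longrightarrow> \<theta> x a \<in> D (x \<otimes> y)"
  using theta_image[of x y] by blast

lemma theta_eq_iff: "x \<in> carrier G \<Longrightarrow> a \<in> D (inv x) \<Longrightarrow> b \<in> D (inv x) \<Longrightarrow> \<theta> x a = \<theta> x b \<longleftrightarrow> a = b"
  using theta_bij by (meson bij_betw_imp_inj_on inj_on_eq_iff)

text \<open>Injectivity sharpens the image axiom to a membership test, which later decides whether a
  composite is defined at an idempotent.\<close>

lemma theta_mem_mult_iff: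
  assumes "x \<in> carrier G" "y \<in> carrier G" "a \<in> D (inv x)"
  shows "\<theta> x a \<in> D (x \<otimes> y) \<longleftrightarrow> a \<in> D y"
proof
  assume "\<theta> x a \<in> D (x \<otimes> y)"
  then have "\<theta> x a \<in> \<theta> x ` (D (inv x) \<inter> D y)" using assms theta_image[of x y] theta_mem by blast
  then obtain b where "b \<in> D (inv x)" "b \<in> D y" "\<theta> x a = \<theta> x b" by blast
  then show "a \<in> D y" using assms theta_eq_iff by metis
qed (use assms theta_mem_mult in blast)

lemma theta_iv:
  assumes x: "x \<in> carrier G" and a: "a \<in> D (inv x)"
  shows "\<theta> x (A.iv a) = A.iv (\<theta> x a)"
proof -
  have aA: "a \<in> A" using D_closed x a by (meson G.inv_closed)
  have i: "A.iv a \<in> D (inv x)"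
    using x a aA D_rg_iff[of "inv x" a] D_rg_iff[of "inv x" "A.iv a"] by simp
  have "a \<odot> A.iv a \<in> D (inv x)" "A.iv a \<odot> a \<in> D (inv x)"
    using x a i aA by (simp_all add: D_left D_right del: A.mult_iv A.iv_mult_self)
  then have "\<theta> x (a \<odot> A.iv a \<odot> a) = \<theta> x a \<odot> \<theta> x (A.iv a) \<odot> \<theta> x a"
     "\<theta> x (A.iv a \<odot> a \<odot> A.iv a) = \<theta> x (A.iv a) \<odot> \<theta> x a \<odot> \<theta> x (A.iv a)"
    using x a i by (simp_all add: theta_mult del: A.mult_iv A.iv_mult_self)
  then show ?thesis using x a i aA
    by (intro A.iv_eqI[symmetric]) (simp_all add: theta_closed A.mult_iv_mult A.iv_mult_iv del: A.mult_iv A.iv_mult_self)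
qed

lemma theta_rg:
  assumes x: "x \<in> carrier G" and a: "a \<in> D (inv x)"
  shows "A.rg (\<theta> x a) = \<theta> x (A.rg a)"
proof -
  have aA: "a \<in> A" using D_closed x a by (meson G.inv_closed)
  have i: "A.iv a \<in> D (inv x)"
    using x a aA D_rg_iff[of "inv x" a] D_rg_iff[of "inv x" "A.iv a"] by simp
  show ?thesis unfolding A.rg_def using theta_mult[OF x a i] theta_iv[OF x a] by simp
qed

lemma theta_idem: "x \<in> carrier G \<Longrightarrow> e \<in> D (inv x) \<Longrightarrow> e \<in> A.E \<Longrightarrow> \<theta> x e \<in> A.E"
  by (metis A.rg_idem A.rg_of_idem theta_closed theta_rg)

lemma theta_theta:
  assumes x: "x \<in> carrier G" and y: "y \<in> carrier G" and a: "a \<in> D (inv y)" "a \<in> D (inv y \<otimes> inv x)"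
  shows "\<theta> x (\<theta> y a) = c x y (A.rg (\<theta> (x \<otimes> y) a)) \<odot> \<theta> (x \<otimes> y) a \<odot> A.iv (c x y (A.rg (\<theta> (x \<otimes> y) a)))"
    and "\<theta> (x \<otimes> y) a \<in> D x" "\<theta> (x \<otimes> y) a \<in> D (x \<otimes> y)"
proof -
  have i: "inv (x \<otimes> y) = inv y \<otimes> inv x" using x y by (simp add: G.inv_mult_group)
  show T: "\<theta> (x \<otimes> y) a \<in> D x" "\<theta> (x \<otimes> y) a \<in> D (x \<otimes> y)"
    using theta_mem_mult[of "x \<otimes> y" "inv y" a] theta_mem[of "x \<otimes> y" a] x y a i
    by (simp_all add: G.m_assoc)
  have "\<theta> x (\<theta> y a) = snd (minv (setprod mA (D x) (D (x \<otimes> y))) mA (w x y)) (fst (w x y) (\<theta> (x \<otimes> y) a))"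
    using tpa x y a setprod_D[of "inv y" "inv y \<otimes> inv x"] unfolding tpa_def by blast
  then show "\<theta> x (\<theta> y a) = c x y (A.rg (\<theta> (x \<otimes> y) a)) \<odot> \<theta> (x \<otimes> y) a \<odot> A.iv (c x y (A.rg (\<theta> (x \<otimes> y) a)))"
    using A.snd_minv_fst[OF _ w_rep[OF x y], of "\<theta> (x \<otimes> y) a"] T x y
    by (simp add: setprod_D A.ideal_inter D_ideal)
qed

lemma theta_theta_idem:
  assumes x: "x \<in> carrier G" and y: "y \<in> carrier G" and e: "e \<in> D (inv y)" "e \<in> D (inv y \<otimes> inv x)" "e \<in> A.E"
  shows "\<theta> x (\<theta> y e) = \<theta> (x \<otimes> y) e"
proof -
  have i: "inv (x \<otimes> y) = inv y \<otimes> inv x" using x y by (simp add: G.inv_mult_group)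
  define r where "r = \<theta> (x \<otimes> y) e"
  have r: "r \<in> A.E" "r \<in> D x" "r \<in> D (x \<otimes> y)"
    using theta_theta[OF x y e(1,2)] theta_idem[of "x \<otimes> y" e] x y e i by (simp_all add: r_def)
  have "c x y r \<odot> r \<odot> A.iv (c x y r) = r"
    using r x y by (intro A.conj_idem_eq) (simp_all add: c_closed rg_c)
  then show ?thesis using theta_theta(1)[OF x y e(1,2)] r by (simp add: r_def)
qed

lemma c_one:
  assumes x: "x \<in> carrier G" and e: "e \<in> D x"
  shows "c \<one> x e = e" "c x \<one> e = e"
  using tpa x e by (simp_all add: tpa_def)

text \<open>The multiplier identity evaluated at an idempotent. Applying a twist to \<open>e\<close>
  keeps the range, so the outer multipliers are again read at \<open>\<theta> x e\<close> and only
  elements of \<open>A\<close> remain.\<close>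

lemma c_cocycle:
  assumes x: "x \<in> carrier G" and y: "y \<in> carrier G" and z: "z \<in> carrier G"
    and e: "e \<in> D (inv x)" "e \<in> D y" "e \<in> D (y \<otimes> z)" "e \<in> A.E"
  shows "\<theta> x (c y z e) \<odot> c x (y \<otimes> z) (\<theta> x e) = c x y (\<theta> x e) \<odot> c (x \<otimes> y) z (\<theta> x e)"
proof -
  have te: "\<theta> x e \<in> A.E" "\<theta> x e \<in> D x" "\<theta> x e \<in> D (x \<otimes> y)" "\<theta> x e \<in> D (x \<otimes> (y \<otimes> z))" "\<theta> x e \<in> D (x \<otimes> y \<otimes> z)"
    using x y z e theta_mem_mult[of x "y \<otimes> z" e] by (simp_all add: theta_idem theta_mem theta_mem_mult G.m_assoc)
  define d where "d = c y z e"
  have d: "d \<in> A" "A.rg d = e" using y z e by (simp_all add: d_def c_closed rg_c)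
  then have dD: "d \<in> D (inv x)" "d \<in> D y" "d \<in> D (y \<otimes> z)"
    using x y z e D_rg_iff[of _ d] by auto
  have "snd (w x (y \<otimes> z)) (\<theta> x d) = \<theta> x d \<odot> c x (y \<otimes> z) (A.rg (\<theta> x d))"
    using x y z dD by (intro A.mult_rep_snd[OF w_rep]) (simp_all add: theta_mem theta_mem_mult)
  moreover have "A.rg (\<theta> x d) = \<theta> x e" using x d dD by (simp add: theta_rg)
  moreover have "snd (w (x \<otimes> y) z) (c x y (\<theta> x e)) = c x y (\<theta> x e) \<odot> c (x \<otimes> y) z (A.rg (c x y (\<theta> x e)))"
  proof (intro A.mult_rep_snd[OF w_rep])
    have "c x y (\<theta> x e) \<in> A" "A.rg (c x y (\<theta> x e)) = \<theta> x e" using x y te by (simp_all add: c_closed rg_c)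
    then show "c x y (\<theta> x e) \<in> D (x \<otimes> y) \<inter> D (x \<otimes> y \<otimes> z)"
      using x y z te D_rg_iff[of "x \<otimes> y" "c x y (\<theta> x e)"] D_rg_iff[of "x \<otimes> y \<otimes> z" "c x y (\<theta> x e)"] by simp
  qed (use x y z in auto)
  moreover have "A.rg (c x y (\<theta> x e)) = \<theta> x e" using x y te by (simp add: rg_c)
  moreover have "snd (w x (y \<otimes> z)) (\<theta> x (snd (w y z) e)) = snd (w (x \<otimes> y) z) (snd (w x y) (\<theta> x e))"
    using tpa x y z e setprod3_D[of "inv x" y "y \<otimes> z"] unfolding tpa_def by blast
  ultimately show ?thesis by (simp add: d_def)
qed

section \<open>The inverse maps and their behaviour on idempotents\<close>

abbreviation ti :: "'g \<Rightarrow> 'b \<Rightarrow> 'b" where "ti \<equiv> theta_inv G D \<theta>"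

lemma ti_theta: "x \<in> carrier G \<Longrightarrow> a \<in> D (inv x) \<Longrightarrow> ti x (\<theta> x a) = a"
  unfolding theta_inv_def using theta_bij by (meson bij_betw_imp_inj_on the_inv_into_f_f)

lemma theta_ti: "x \<in> carrier G \<Longrightarrow> a \<in> D x \<Longrightarrow> \<theta> x (ti x a) = a"
  unfolding theta_inv_def using theta_bij by (meson f_the_inv_into_f_bij_betw)

lemma ti_mem: "x \<in> carrier G \<Longrightarrow> a \<in> D x \<Longrightarrow> ti x a \<in> D (inv x)"
  unfolding theta_inv_def using theta_bij by (meson bij_betwE bij_betw_the_inv_into)

lemma ti_closed: "x \<in> carrier G \<Longrightarrow> a \<in> D x \<Longrightarrow> ti x a \<in> A"
  using ti_mem D_closed G.inv_closed by meson

lemma ti_idem: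
  assumes x: "x \<in> carrier G" and e: "e \<in> D x" "e \<in> A.E"
  shows "ti x e \<in> A.E"
proof (rule A.idemI)
  have t: "ti x e \<in> D (inv x)" "ti x e \<in> A" "ti x e \<odot> ti x e \<in> D (inv x)"
    using x e ti_mem ti_closed D_left G.inv_closed by simp_all
  show "ti x e \<in> A" by fact
  have "\<theta> x (ti x e \<odot> ti x e) = \<theta> x (ti x e)" using x e t by (simp add: theta_mult theta_ti)
  then show "ti x e \<odot> ti x e = ti x e" using x t theta_eq_iff by blast
qed

text \<open>\<open>\<theta> (inv x)\<close> composed with \<open>\<theta> x\<close> is the identity
  only up to a twist; idempotents do not feel the twist, so there the two inverses coincide.\<close>

lemma theta_inv_eq_ti:
  assumes x: "x \<in> carrier G" and e: "e \<in> D x" "e \<in> A.E"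
  shows "\<theta> (inv x) e = ti x e" "ti (inv x) (ti x e) = e"
proof -
  have t: "ti x e \<in> D (inv x)" "ti x e \<in> A.E" "ti x e \<in> A" using x e ti_mem ti_idem ti_closed by simp_all
  have "\<theta> (inv x) (\<theta> x (ti x e)) = \<theta> (inv x \<otimes> x) (ti x e)"
    using x t by (intro theta_theta_idem) simp_all
  then show 1: "\<theta> (inv x) e = ti x e" using x e t by (simp add: theta_ti)
  show "ti (inv x) (ti x e) = e" using ti_theta[of "inv x" e] x e 1 by simp
qed

section \<open>The crossed product of \<open>E(A)\<close> by the group and its module
  structure\<close>

abbreviation C :: "('b \<times> 'g) set" where "C \<equiv> cross_car G mA D"
abbreviation M :: "'b \<times> 'g \<Rightarrow> 'b \<times> 'g \<Rightarrow> 'b \<times> 'g" where "M \<equiv> cross_mult G mA D \<theta>"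
abbreviation L :: "'b \<times> 'g \<Rightarrow> 'b \<Rightarrow> 'b" where "L \<equiv> lmLam G mA D \<theta>"
abbreviation F :: "'b \<times> 'g \<Rightarrow> 'b \<times> 'g \<Rightarrow> 'b" where "F \<equiv> lmF G mA D \<theta> w"

lemma pair_mem_C_iff: "(e, x) \<in> C \<longleftrightarrow> x \<in> carrier G \<and> e \<in> D x \<and> e \<in> A.E"
  unfolding cross_car_def using A.idems_subset[OF D_ideal] by auto

lemma mem_C_iff: "p \<in> C \<longleftrightarrow> snd p \<in> carrier G \<and> fst p \<in> D (snd p) \<and> fst p \<in> A.E"
  using pair_mem_C_iff[of "fst p" "snd p"] by simp

lemma L_eq: "L p a = \<theta> (snd p) (ti (snd p) (fst p) \<odot> a)"
  by (simp add: lmLam_def)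

lemma M_eq: "M p q = (L p (fst q), snd p \<otimes> snd q)"
  by (simp add: cross_mult_def lmLam_def)

lemma F_eq: "F p q = c (snd p) (snd q) (L p (fst q))"
  by (simp add: lmF_def lmLam_def)

lemma L_mem: "p \<in> C \<Longrightarrow> a \<in> A \<Longrightarrow> L p a \<in> D (snd p)"
  unfolding L_eq mem_C_iff by (intro theta_mem D_right ti_mem) auto

lemma L_closed: "p \<in> C \<Longrightarrow> a \<in> A \<Longrightarrow> L p a \<in> A"
  using L_mem D_closed unfolding mem_C_iff by blast

lemma L_mult:
  assumes p: "p \<in> C" and a: "a \<in> A" and b: "b \<in> A"
  shows "L p (a \<odot> b) = L p a \<odot> L p b"
proof -
  define k where "k = ti (snd p) (fst p)"
  have x: "snd p \<in> carrier G" using p by (simp add: mem_C_iff)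
  have k: "k \<in> A.E" "k \<in> D (inv (snd p))" "k \<in> A"
    using p by (auto simp: mem_C_iff k_def ti_idem ti_mem ti_closed)
  have "k \<odot> (a \<odot> b) = k \<odot> a \<odot> (k \<odot> b)"
  proof -
    have "k \<odot> a \<odot> (k \<odot> b) = k \<odot> (k \<odot> (a \<odot> b))"
      using k a b by (simp add: A.assoc A.idem_left_comm[of k a b])
    then show ?thesis using k a b by (simp flip: A.assoc)
  qed
  then show ?thesis unfolding L_eq k_def[symmetric] using x k a b
    by (simp add: theta_mult D_right)
qed

lemma L_endo: "p \<in> C \<Longrightarrow> endo A mA (L p)"
  by (simp add: endo_def L_closed L_mult)

lemma L_fst:
  assumes p: "p \<in> C" shows "L p (ti (snd p) (fst p)) = fst p"
  using p unfolding L_eq mem_C_iff by (simp add: ti_idem theta_ti)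

lemma L_absorb:
  assumes p: "p \<in> C" and a: "a \<in> A" shows "fst p \<odot> L p a = L p a"
proof -
  have k: "ti (snd p) (fst p) \<in> A.E" "ti (snd p) (fst p) \<in> A" using p by (auto simp: mem_C_iff ti_idem)
  have "fst p \<odot> L p a = L p (ti (snd p) (fst p) \<odot> a)" using L_fst[OF p] L_mult[OF p k(2) a] by simp
  also have "\<dots> = L p a" unfolding L_eq using k a by (simp flip: A.assoc)
  finally show ?thesis .
qed

lemma L_mem_mult:
  assumes p: "p \<in> C" and y: "y \<in> carrier G" and a: "a \<in> D y" shows "L p a \<in> D (snd p \<otimes> y)"
  unfolding L_eq using p y a D_closed[OF y a]
  by (intro theta_mem_mult) (auto simp: mem_C_iff D_left D_right ti_mem ti_closed)

lemma L_idem: "p \<in> C \<Longrightarrow> e \<in> A.E \<Longrightarrow> L p e \<in> A.E"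
  using A.endo_idem L_endo by blast

lemma M_closed: "p \<in> C \<Longrightarrow> q \<in> C \<Longrightarrow> M p q \<in> C"
  unfolding M_eq pair_mem_C_iff using L_mem_mult L_idem mem_C_iff by auto

lemma F_closed: "p \<in> C \<Longrightarrow> q \<in> C \<Longrightarrow> F p q \<in> A"
  and rg_F: "p \<in> C \<Longrightarrow> q \<in> C \<Longrightarrow> A.rg (F p q) = fst (M p q)"
proof -
  assume p: "p \<in> C" and q: "q \<in> C"
  have *: "snd p \<in> carrier G" "snd q \<in> carrier G" "L p (fst q) \<in> D (snd p)"
    "L p (fst q) \<in> D (snd p \<otimes> snd q)" "L p (fst q) \<in> A.E"
    using p q L_mem L_mem_mult L_idem D_closed by (auto simp: mem_C_iff)
  show "F p q \<in> A" "A.rg (F p q) = fst (M p q)"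
    unfolding F_eq M_eq using * by (simp_all add: c_closed rg_c)
qed

lemma L_L:
  assumes p: "p \<in> C" and q: "q \<in> C" and a: "a \<in> A"
  shows "L p (L q a) = F p q \<odot> L (M p q) a \<odot> A.iv (F p q)"
proof -
  obtain e x f y where pq: "p = (e, x)" "q = (f, y)" by (cases p, cases q)
  have x: "x \<in> carrier G" "e \<in> D x" "e \<in> A.E" and y: "y \<in> carrier G" "f \<in> D y" "f \<in> A.E"
    using p q by (simp_all add: pq pair_mem_C_iff)
  have i: "inv (x \<otimes> y) = inv y \<otimes> inv x" using x y by (simp add: G.inv_mult_group)
  have yy: "y \<otimes> (inv y \<otimes> inv x) = inv x" using x y by (simp flip: G.m_assoc)
  \<comment> \<open>\<open>h\<close> is the meet of the domain idempotent of \<open>p\<close> with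
    the range idempotent of \<open>q\<close>, and \<open>k\<close> is its pullback along
    \<open>\<theta> y\<close>, which turns out to be the domain idempotent of \<open>M p q\<close>.
    Cutting \<open>a\<close> by \<open>k\<close> brings it into the domain of every map
    involved.\<close>
  define h where "h = ti x e \<odot> f"
  define k where "k = ti y h"
  have te: "ti x e \<in> A.E" "ti x e \<in> D (inv x)" "ti x e \<in> A" using x by (simp_all add: ti_idem ti_mem ti_closed)
  have tf: "ti y f \<in> A.E" "ti y f \<in> D (inv y)" "ti y f \<in> A" using y by (simp_all add: ti_idem ti_mem ti_closed)
  have h: "h \<in> A.E" "h \<in> D (inv x)" "h \<in> D y" "h \<in> A"
    using x y te by (simp_all add: h_def D_left D_right)
  have k: "k \<in> A.E" "k \<in> D (inv y)" "k \<in> A" "\<theta> y k = h"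
    using y h by (simp_all add: k_def ti_idem ti_mem ti_closed theta_ti)
  \<comment> \<open>The membership test applies because \<open>\<theta> y k = h\<close> lies in
    \<open>D (inv x)\<close>; this is what makes \<open>\<theta> (x \<otimes> y)\<close> applicable
    to \<open>k\<close>.\<close>
  have kx: "k \<in> D (inv y \<otimes> inv x)"
    using theta_mem_mult_iff[of y "inv y \<otimes> inv x" k] x y k h yy by simp
  have La: "L q a = \<theta> y (ti y f \<odot> a)" by (simp add: L_eq pq)
  have LaA: "L q a \<in> A" using q a by (simp add: L_closed)
  have "\<theta> y (k \<odot> a) = ti x e \<odot> L q a"
  proof -
    have "\<theta> y (k \<odot> ti y f) = \<theta> y k"
    proof -
      have "\<theta> y (k \<odot> ti y f) = ti x e \<odot> f \<odot> f" using y k tf by (simp add: theta_mult theta_ti h_def)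
      also have "\<dots> = ti x e \<odot> f" using te y by (simp add: A.assoc)
      finally show ?thesis using k by (simp add: h_def)
    qed
    then have "k \<odot> ti y f = k"
      using y k tf theta_eq_iff[of y "k \<odot> ti y f" k] D_right[of "inv y" k "ti y f"] by simp
    then have "\<theta> y (k \<odot> a) = \<theta> y (k \<odot> (ti y f \<odot> a))" using k tf a by (simp flip: A.assoc)
    also have "\<dots> = h \<odot> L q a" using y k tf a La by (simp add: theta_mult D_right)
    also have "\<dots> = ti x e \<odot> (f \<odot> L q a)" using te y LaA by (simp add: h_def A.assoc)
    also have "f \<odot> L q a = L q a" using L_absorb[OF q a] by (simp add: pq)
    finally show ?thesis .
  qed
  then have LL: "L p (L q a) = \<theta> x (\<theta> y (k \<odot> a))" by (simp add: L_eq[of "(e, x)"] pq(1))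
  have ka: "k \<odot> a \<in> D (inv y)" "k \<odot> a \<in> D (inv y \<otimes> inv x)"
    using x y k kx a by (simp_all add: D_right)
  define r where "r = L p f"
  have r: "\<theta> (x \<otimes> y) k = r"
    using theta_theta_idem[of x y k] x y k kx by (simp add: r_def L_eq pq h_def)
  have rE: "r \<in> A.E" "r \<in> D x" "r \<in> D (x \<otimes> y)"
    using theta_theta(2,3)[of x y k] theta_idem[of "x \<otimes> y" k] x y k kx r i by simp_all
  have Mpq: "M p q = (r, x \<otimes> y)" by (simp add: M_eq r_def pq)
  have "ti (x \<otimes> y) r = k" using ti_theta[of "x \<otimes> y" k] r x y kx i by simp
  then have b: "\<theta> (x \<otimes> y) (k \<odot> a) = L (M p q) a" by (simp add: L_eq[of "(r, x \<otimes> y)"] Mpq)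
  define b where "b = L (M p q) a"
  have bA: "b \<in> A" "r \<odot> b = b"
    using L_closed[OF M_closed[OF p q] a] L_absorb[OF M_closed[OF p q] a] by (simp_all add: b_def Mpq)
  \<comment> \<open>The axiom supplies the twist at the range of \<open>b\<close>, which is below
    \<open>r\<close>, while \<open>F p q\<close> is the twist at \<open>r\<close>; compatibility and
    \<open>A.conj_restrict\<close> bridge the gap.\<close>
  have "L p (L q a) = c x y (A.rg b) \<odot> b \<odot> A.iv (c x y (A.rg b))"
    using theta_theta(1)[OF _ _ ka] x y LL b by (simp add: b_def)
  also have "A.rg b = r \<odot> A.rg b" using bA rE by (simp add: A.rg_absorb)
  also have "c x y (r \<odot> A.rg b) = c x y r \<odot> A.rg b" using x y rE bA by (simp add: c_restrict)
  also have "c x y r \<odot> A.rg b \<odot> b \<odot> A.iv (c x y r \<odot> A.rg b) = c x y r \<odot> b \<odot> A.iv (c x y r)"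
    using x y rE bA by (intro A.conj_restrict) (simp_all add: c_closed)
  finally show ?thesis by (simp add: F_eq pq r_def b_def)
qed

lemma L_L_idem:
  assumes p: "p \<in> C" and q: "q \<in> C" and e: "e \<in> A.E"
  shows "L p (L q e) = L (M p q) e"
proof -
  have "M p q \<in> C" using p q by (simp add: M_closed)
  then have "L (M p q) e \<in> A.E" "A.rg (F p q) \<odot> L (M p q) e = L (M p q) e"
    using p q e by (simp_all add: L_idem rg_F L_absorb)
  then have "F p q \<odot> L (M p q) e \<odot> A.iv (F p q) = L (M p q) e"
    using p q by (intro A.conj_idem_eq) (simp_all add: F_closed)
  then show ?thesis using L_L[OF p q] e by simp
qed

lemma L_one: "e \<in> A.E \<Longrightarrow> a \<in> A \<Longrightarrow> L (e, \<one>) a = e \<odot> a"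
  using ti_theta[of \<one> e] by (simp add: L_eq)

lemma one_C: "e \<in> A.E \<Longrightarrow> (e, \<one>) \<in> C"
  by (simp add: pair_mem_C_iff)

lemma idems_C: "idems C M = (\<lambda>e. (e, \<one>)) ` A.E"
proof (intro equalityI subsetI)
  fix p assume "p \<in> idems C M"
  then have p: "p \<in> C" "M p p = p" by (auto simp: idems_def)
  then have "snd p \<otimes> snd p = snd p" "snd p \<in> carrier G" by (auto simp: M_eq mem_C_iff prod_eq_iff)
  then have "snd p = \<one>" by (simp add: G.r_cancel_one')
  then show "p \<in> (\<lambda>e. (e, \<one>)) ` A.E" using p by (auto simp: mem_C_iff prod_eq_iff image_iff intro!: bexI[of _ "fst p"])
next
  fix p assume "p \<in> (\<lambda>e. (e, \<one>)) ` A.E"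
  then obtain e where e: "p = (e, \<one>)" "e \<in> A.E" by blast
  then have "p \<in> C" "M p p = p" by (simp_all add: one_C M_eq L_one)
  then show "p \<in> idems C M" unfolding idems_def by blast
qed

text \<open>The semigroup inverse: its products with \<open>p\<close> are the idempotents given by
  the range \<open>fst p\<close> and by its pullback along \<open>\<theta> (snd p)\<close>.\<close>

definition Ci :: "'b \<times> 'g \<Rightarrow> 'b \<times> 'g" where "Ci p = (ti (snd p) (fst p), inv (snd p))"

lemma Ci_C: "p \<in> C \<Longrightarrow> Ci p \<in> C"
  by (simp add: Ci_def pair_mem_C_iff mem_C_iff[of p] ti_mem ti_idem)

lemma M_Ci: "p \<in> C \<Longrightarrow> M p (Ci p) = (fst p, \<one>)"
  by (simp add: M_eq Ci_def L_fst) (simp add: mem_C_iff)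

lemma Ci_M:
  assumes "p \<in> C" shows "M (Ci p) p = (ti (snd p) (fst p), \<one>)"
  using assms by (simp add: M_eq Ci_def L_eq mem_C_iff theta_inv_eq_ti)

lemma C_inverse: "p \<in> C \<Longrightarrow> is_inverse_of C M p (Ci p)"
proof -
  assume p: "p \<in> C"
  then have x: "snd p \<in> carrier G" "fst p \<in> D (snd p)" "fst p \<in> A.E" "ti (snd p) (fst p) \<in> A.E"
    by (simp_all add: mem_C_iff ti_idem)
  have "M (M p (Ci p)) p = p" using x by (simp add: M_Ci[OF p]) (simp add: M_eq L_one prod_eq_iff)
  moreover have "M (M (Ci p) p) (Ci p) = Ci p"
    using x by (simp add: Ci_M[OF p]) (simp add: M_eq Ci_def L_one)
  ultimately show ?thesis using Ci_C[OF p] by (simp add: is_inverse_of_def)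
qed

lemma C_inverse_semigroup: "inverse_semigroup C M"
proof (rule inverse_semigroupI)
  show "C \<noteq> {}" using one_C A.idem_exists by blast
  \<comment> \<open>A product has first coordinate \<open>L p (fst q)\<close>, so associativity
    there is the composition law for \<open>L\<close> at the idempotent
    \<open>fst r\<close>.\<close>
  have "M (M p q) r = M p (M q r)" if "p \<in> C" "q \<in> C" "r \<in> C" for p q r
    using that L_L_idem[of p q "fst r"] by (simp add: M_eq[of _ r] M_eq[of p "M q r"] mem_C_iff G.m_assoc)
      (simp add: M_eq mem_C_iff G.m_assoc)
  then show "sg_on C M" by (simp add: sg_on_def M_closed)
  show "\<exists>q. is_inverse_of C M p q" if "p \<in> C" for p using C_inverse that by blast
  show "M e f = M f e" if "e \<in> idems C M" "f \<in> idems C M" for e f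
    using that by (auto simp: idems_C M_eq L_one A.idem_comm)
qed

text \<open>Multiplying by an idempotent does not change the group coordinate, so an element above
  an idempotent has coordinate \<open>\<one>\<close>, and every such pair is idempotent.\<close>

lemma C_E_unitary: "E_unitary C M"
  unfolding E_unitary_def
proof (intro ballI impI)
  fix e p assume e: "e \<in> idems C M" and p: "p \<in> C" and le: "nat_le C M e p"
  then obtain g where g: "g \<in> idems C M" "e = M g p" by (auto simp: nat_le_def)
  have x: "snd p \<in> carrier G" using p by (simp add: mem_C_iff)
  have "snd p = \<one>" using g e x by (auto simp: idems_C M_eq)
  then have "p = (fst p, \<one>)" "fst p \<in> A.E" using p by (auto simp: mem_C_iff prod_eq_iff)
  then show "p \<in> idems C M" unfolding idems_C by blast
qed

sublocale C: eunitary_sg C M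
  by unfold_locales (fact C_inverse_semigroup C_E_unitary)+

lemma iv_C: "p \<in> C \<Longrightarrow> sinv C M p = Ci p"
  using C_inverse[of p] by (intro C.iv_eqI) (auto simp: is_inverse_of_def)

lemma rg_C: "p \<in> C \<Longrightarrow> C.rg p = (fst p, \<one>)"
  by (simp add: C.rg_def iv_C M_Ci)

lemma dm_C: "p \<in> C \<Longrightarrow> C.dm p = (ti (snd p) (fst p), \<one>)"
  by (simp add: C.dm_def iv_C Ci_M)

lemma L_rel_invertible:
  assumes p: "p \<in> C" shows "rel_invertible A mA (L p)"
proof -
  define x e k where "x = snd p" and "e = fst p" and "k = ti x e"
  have x: "x \<in> carrier G" "e \<in> D x" "e \<in> A.E" "e \<in> A" using p by (auto simp: x_def e_def mem_C_iff)
  have k: "k \<in> A.E" "k \<in> D (inv x)" "k \<in> A" "\<theta> x k = e" using x by (simp_all add: k_def ti_idem ti_mem ti_closed theta_ti)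
  have L: "L p a = \<theta> x (k \<odot> a)" for a by (simp add: L_eq x_def e_def k_def)
  \<comment> \<open>The companion endomorphism uses the inverse map of \<open>\<theta> x\<close>
    rather than \<open>\<theta> (inv x)\<close>, which would leave a conjugation behind; the factor
    \<open>e\<close> makes it total.\<close>
  define \<psi> where "\<psi> a = ti x (e \<odot> a)" for a
  have \<psi>D: "\<psi> a \<in> D (inv x)" "\<theta> x (\<psi> a) = e \<odot> a" "\<psi> a \<in> A" if "a \<in> A" for a
    using that x by (simp_all add: \<psi>_def ti_mem theta_ti ti_closed D_right)
  have kpsi: "k \<odot> \<psi> a = \<psi> a" "\<psi> a \<odot> k = \<psi> a" if "a \<in> A" for a
  proof -
    have "\<theta> x (k \<odot> \<psi> a) = e \<odot> (e \<odot> a)" using that x k \<psi>D by (simp add: theta_mult)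
    also have "\<dots> = \<theta> x (\<psi> a)" using that x \<psi>D by (simp flip: A.assoc)
    finally show "k \<odot> \<psi> a = \<psi> a"
      using that x k \<psi>D theta_eq_iff[of x "k \<odot> \<psi> a" "\<psi> a"] by (simp add: D_right)
    then show "\<psi> a \<odot> k = \<psi> a" using that k \<psi>D A.idem_central by metis
  qed
  have "\<psi> (a \<odot> b) = \<psi> a \<odot> \<psi> b" if "a \<in> A" "b \<in> A" for a b
  proof -
    have "\<theta> x (\<psi> a \<odot> \<psi> b) = e \<odot> a \<odot> (e \<odot> b)" using that x \<psi>D by (simp add: theta_mult)
    also have "\<dots> = e \<odot> (e \<odot> (a \<odot> b))" using that x by (simp add: A.assoc A.idem_left_comm[of e a b])
    also have "\<dots> = \<theta> x (\<psi> (a \<odot> b))" using that x \<psi>D by (simp flip: A.assoc)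
    finally show ?thesis
      using that x \<psi>D theta_eq_iff[of x "\<psi> a \<odot> \<psi> b" "\<psi> (a \<odot> b)"] by (simp add: D_right)
  qed
  then have "endo A mA \<psi>" using \<psi>D by (simp add: endo_def)
  moreover have "\<psi> (L p a) = k \<odot> a" if a: "a \<in> A" for a
    using L_absorb[OF p a] a x k by (simp add: \<psi>_def e_def[symmetric] L ti_theta D_right)
  moreover have Lk: "L p k = e" using k by (simp add: L)
  moreover have "L p (\<psi> a) = e \<odot> a" if "a \<in> A" for a using that kpsi \<psi>D by (simp add: L)
  moreover have "is_identity_of (\<psi> ` A) mA k"
  proof -
    have "k = \<psi> e" using x by (simp add: \<psi>_def k_def)
    then show ?thesis unfolding is_identity_of_def using kpsi x by blast
  qed
  moreover have "is_identity_of (L p ` A) mA e"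
  proof -
    have "e \<odot> L p a = L p a" "L p a \<odot> e = L p a" if a: "a \<in> A" for a
      using L_absorb[OF p a] L_closed[OF p a] x A.idem_central[of e "L p a"] by (simp_all add: e_def)
    moreover have "e \<in> L p ` A" using Lk k by blast
    ultimately show ?thesis unfolding is_identity_of_def by blast
  qed
  ultimately show ?thesis unfolding rel_invertible_def using L_endo[OF p] k(1) by blast
qed

text \<open>The Sieben condition is the normalisation of \<open>w\<close> at \<open>\<one>\<close>,
  since idempotents have group coordinate \<open>\<one>\<close>.\<close>

lemma F_one:
  assumes p: "p \<in> C" and e: "e \<in> idems C M"
  shows "F p e = fst (M p e)" "F e p = fst (M e p)"
proof -
  obtain g where g: "e = (g, \<one>)" "g \<in> A.E" using e by (auto simp: idems_C)
  have x: "snd p \<in> carrier G" "fst p \<in> D (snd p)" "fst p \<in> A" using p by (auto simp: mem_C_iff)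
  have "L p g \<in> D (snd p)" using L_mem[OF p] g by simp
  then show "F p e = fst (M p e)" using x by (simp add: F_eq M_eq g c_one)
  have "L e (fst p) \<in> D (snd p)" using x g by (simp add: L_one D_left)
  then show "F e p = fst (M e p)" using x by (simp add: F_eq M_eq g c_one)
qed

text \<open>All four factors are brought to one idempotent, \<open>\<theta> x i\<close>, the first
  coordinate of the triple product. There the identity is \<open>c_cocycle\<close>;
  \<open>F p q\<close> starts at the larger idempotent \<open>s\<close> and is cut down by its
  neighbour.\<close>

lemma F_cocycle:
  assumes p: "p \<in> C" and q: "q \<in> C" and r: "r \<in> C"
  shows "L p (F q r) \<odot> F p (M q r) = F p q \<odot> F (M p q) r"
proof -
  obtain e x f y g z where pq: "p = (e, x)" "q = (f, y)" "r = (g, z)" by (cases p, cases q, cases r)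
  have x: "x \<in> carrier G" "e \<in> D x" "e \<in> A.E" and y: "y \<in> carrier G" and z: "z \<in> carrier G"
    using p q r by (simp_all add: pq pair_mem_C_iff)
  have k: "ti x e \<in> A.E" "ti x e \<in> D (inv x)" "ti x e \<in> A" using x by (simp_all add: ti_idem ti_mem ti_closed)
  define t where "t = fst (M q r)"
  have Mqr: "M q r = (t, y \<otimes> z)" by (simp add: t_def M_eq pq)
  have "(t, y \<otimes> z) \<in> C" using M_closed[OF q r] Mqr by simp
  then have t: "t \<in> A.E" "t \<in> D (y \<otimes> z)" "t \<in> D y" "t \<in> A"
    using L_mem[OF q, of g] r by (auto simp: pair_mem_C_iff t_def M_eq pq)
  define i where "i = ti x e \<odot> t"
  have i: "i \<in> A.E" "i \<in> D (inv x)" "i \<in> D y" "i \<in> D (y \<otimes> z)"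
    using k t x y z by (simp_all add: i_def D_left D_right)
  have ti: "\<theta> x i = L p t" by (simp add: i_def L_eq pq)
  define s where "s = fst (M p q)"
  have Mpq: "M p q = (s, x \<otimes> y)" by (simp add: s_def M_eq pq)
  have "(s, x \<otimes> y) \<in> C" using M_closed[OF p q] Mpq by simp
  then have s: "s \<in> A.E" "s \<in> D (x \<otimes> y)" "s \<in> D x"
    using L_mem[OF p, of f] q by (auto simp: pair_mem_C_iff s_def M_eq pq)
  have asc: "L (M p q) g = \<theta> x i"
    using L_L_idem[OF p q, of g] r ti by (simp add: t_def M_eq[of "(f, y)" "(g, z)"] pq pair_mem_C_iff)
  have "s \<odot> \<theta> x i = \<theta> x i" using L_absorb[OF M_closed[OF p q], of g] r asc by (auto simp: s_def pq pair_mem_C_iff)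
  moreover have tiE: "\<theta> x i \<in> A.E" using x i by (simp add: theta_idem)
  ultimately have c1: "c x y s \<odot> \<theta> x i = c x y (\<theta> x i)" using c_restrict[of x y s "\<theta> x i"] x y s by simp
  have c2: "c (x \<otimes> y) z (\<theta> x i) \<in> A" "\<theta> x i \<odot> c (x \<otimes> y) z (\<theta> x i) = c (x \<otimes> y) z (\<theta> x i)"
  proof -
    have D: "\<theta> x i \<in> D (x \<otimes> y)" "\<theta> x i \<in> D (x \<otimes> y \<otimes> z)"
      using x y z i theta_mem_mult[of x y i] theta_mem_mult[of x "y \<otimes> z" i] by (simp_all add: G.m_assoc)
    show 1: "c (x \<otimes> y) z (\<theta> x i) \<in> A" using D tiE x y z by (simp add: c_closed)
    have "A.rg (c (x \<otimes> y) z (\<theta> x i)) = \<theta> x i" using D tiE x y z by (simp add: rg_c)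
    then show "\<theta> x i \<odot> c (x \<otimes> y) z (\<theta> x i) = c (x \<otimes> y) z (\<theta> x i)" using A.rg_mult_self[OF 1] by simp
  qed
  have "L p (F q r) = \<theta> x (c y z i)"
  proof -
    have "ti x e \<odot> c y z t = c y z t \<odot> ti x e" using k t y z by (intro A.idem_central) (simp_all add: c_closed)
    also have "\<dots> = c y z (t \<odot> ti x e)" using k t y z by (simp add: c_restrict)
    also have "t \<odot> ti x e = i" using k t by (simp add: i_def A.idem_comm)
    finally show ?thesis by (simp add: L_eq[of "(e, x)"] pq F_eq t_def M_eq)
  qed
  moreover have "F p (M q r) = c x (y \<otimes> z) (\<theta> x i)" by (simp add: F_eq ti Mqr) (simp add: pq)
  moreover have "F p q \<odot> F (M p q) r = c x y s \<odot> (\<theta> x i \<odot> c (x \<otimes> y) z (\<theta> x i))"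
  proof -
    have "F p q = c x y s" by (simp add: F_eq s_def M_eq pq)
    moreover have "F (M p q) r = c (x \<otimes> y) z (\<theta> x i)" using asc by (simp add: F_eq pq(3)) (simp add: Mpq)
    ultimately show ?thesis using c2 by simp
  qed
  moreover have "c x y s \<odot> (\<theta> x i \<odot> c (x \<otimes> y) z (\<theta> x i)) = c x y (\<theta> x i) \<odot> c (x \<otimes> y) z (\<theta> x i)"
    using c1 c2 s x y tiE A.assoc[of "c x y s" "\<theta> x i" "c (x \<otimes> y) z (\<theta> x i)"] by (simp add: c_closed)
  ultimately show ?thesis using c_cocycle[OF x(1) y z i(2-4,1)] by simp
qed

lemma C_sieben: "sieben_tms C M A mA lmAlpha L F"
proof -
  have r1: "M (M p e) (sinv C M p) = C.rg (M p e)" if "p \<in> C" "e \<in> idems C M" for p e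
    using that by (simp add: C.rg_mult)
  have r2: "M (M e p) (sinv C M p) = C.rg (M e p)" if "p \<in> C" "e \<in> idems C M" for p e
    using that by (simp add: C.rg_idem_mult C.assoc) (simp add: C.rg_def)
  have r3: "M (M (M p q) (sinv C M q)) (sinv C M p) = C.rg (M p q)" if "p \<in> C" "q \<in> C" for p q
    using that by (simp add: C.rg_def C.iv_mult C.assoc)
  have al: "lmAlpha (C.rg p) = fst p" if "p \<in> C" for p using that by (simp add: rg_C lmAlpha_def)
  have S: "F p e = lmAlpha (M (M p e) (sinv C M p)) \<and> F e p = lmAlpha (M (M e p) (sinv C M p))"
    if "p \<in> C" "e \<in> idems C M" for p e
    using that by (simp add: r1 r2 al F_one)
  have "tms C M A mA lmAlpha L F" unfolding tms_def
  proof (intro conjI ballI)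
    show "bij_betw lmAlpha (idems C M) A.E"
      unfolding idems_C by (rule bij_betw_imageI) (auto simp: lmAlpha_def inj_on_def image_image)
    show "lmAlpha (M e e') = lmAlpha e \<odot> lmAlpha e'" if "e \<in> idems C M" "e' \<in> idems C M" for e e'
      using that by (auto simp: idems_C lmAlpha_def M_eq L_one)
    show "rel_invertible A mA (L p)" if "p \<in> C" for p using that by (rule L_rel_invertible)
    show "F p q \<in> Agrp A mA (lmAlpha (M (M (M p q) (sinv C M q)) (sinv C M p)))" if "p \<in> C" "q \<in> C" for p q
      using that by (simp add: r3 al A.Agrp_iff F_closed rg_F)
    show "L e a = lmAlpha e \<odot> a" if "e \<in> idems C M" "a \<in> A" for e a
      using that by (auto simp: idems_C lmAlpha_def L_one)
    show "L p (lmAlpha e) = lmAlpha (M (M p e) (sinv C M p))" if "p \<in> C" "e \<in> idems C M" for p e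
      using that by (simp add: r1 al) (simp add: lmAlpha_def M_eq)
    show "L p (L q a) = F p q \<odot> L (M p q) a \<odot> A.iv (F p q)" if "p \<in> C" "q \<in> C" "a \<in> A" for p q a
      using that by (rule L_L)
    show "F (M p e) e = lmAlpha (M (M p e) (sinv C M p))" if "p \<in> C" "e \<in> idems C M" for p e
    proof -
      have "M (M p e) e = M p e" using that by (simp add: C.assoc)
      then show ?thesis using that by (simp add: r1 al F_one)
    qed
    show "F e (M e p) = lmAlpha (M (M e p) (sinv C M p))" if "p \<in> C" "e \<in> idems C M" for p e
    proof -
      have "M e (M e p) = M e p" using that by (simp flip: C.assoc)
      then show ?thesis using that by (simp add: r2 al F_one)
    qed
    show "L p (F q r) \<odot> F p (M q r) = F p q \<odot> F (M p q) r" if "p \<in> C" "q \<in> C" "r \<in> C" for p q r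
      using that by (rule F_cocycle)
  qed
  then show ?thesis unfolding sieben_tms_def using S by blast
qed

section \<open>Recovering the group and the twisted partial action from the crossed product\<close>

sublocale \<Lambda>: sieben A mA C M lmAlpha L F
  by unfold_locales (fact C_sieben)

text \<open>The fibre of the crossed product over \<open>x\<close>; \<open>cls_C\<close> identifies
  these fibres with the classes of the minimum group congruence.\<close>

definition mu :: "'g \<Rightarrow> ('b \<times> 'g) set" where "mu x = (\<lambda>e. (e, x)) ` (D x \<inter> A.E)"

lemma mem_mu: "p \<in> mu x \<longleftrightarrow> snd p = x \<and> fst p \<in> D x \<and> fst p \<in> A.E"
  by (auto simp: mu_def image_iff prod_eq_iff)

lemma mu_nonempty: "x \<in> carrier G \<Longrightarrow> \<exists>e. (e, x) \<in> mu x"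
proof -
  assume x: "x \<in> carrier G"
  then obtain a where "a \<in> D x" using D_ideal unfolding A.ideal_def is_ideal_def by blast
  then have "A.rg a \<in> D x" "A.rg a \<in> A.E" using x D_rg_iff D_closed by blast+
  then show ?thesis unfolding mem_mu by auto
qed

lemma mu_C: "x \<in> carrier G \<Longrightarrow> p \<in> mu x \<Longrightarrow> p \<in> C"
  by (auto simp: mem_mu mem_C_iff)

lemma cls_C:
  assumes p: "p \<in> C" shows "C.cls p = mu (snd p)"
proof (intro equalityI subsetI)
  fix q assume "q \<in> C.cls p"
  then obtain e where e: "q \<in> C" "e \<in> C.E" "M e p = M e q" by (auto simp: C.mem_cls_iff)
  then have "\<one> \<otimes> snd p = \<one> \<otimes> snd q" by (auto simp: idems_C M_eq)
  then have "snd q = snd p" using p e by (simp add: mem_C_iff)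
  then show "q \<in> mu (snd p)" using e by (simp add: mem_mu mem_C_iff)
next
  fix q assume "q \<in> mu (snd p)"
  then have q: "snd q = snd p" "q \<in> C" using p by (auto simp: mem_mu mem_C_iff)
  \<comment> \<open>Left multiplication by an idempotent affects only the first coordinate, and this
    product absorbs the first coordinates of both \<open>p\<close> and \<open>q\<close>.\<close>
  define e where "e = (fst p \<odot> fst q, \<one>)"
  have E: "fst p \<in> A.E" "fst q \<in> A.E" "snd p \<in> carrier G" using p q by (auto simp: mem_C_iff)
  have "fst p \<odot> fst q \<odot> fst p = fst p \<odot> fst q \<odot> fst q"
    using E by (metis A.assoc A.idem_closed A.idem_comm A.idem_mult_self)
  then have "M e p = M e q" using E q by (simp add: e_def M_eq L_one)
  moreover have "e \<in> C.E" using E by (auto simp: idems_C e_def)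
  ultimately show "q \<in> C.cls p" unfolding C.mem_cls_iff using q by blast
qed

lemma mu_carrier:
  assumes x: "x \<in> carrier G" shows "mu x \<in> carrier C.G"
proof -
  obtain e where e: "(e, x) \<in> mu x" using mu_nonempty x by blast
  then have "mu x = C.cls (e, x)" using mu_C[OF x e] cls_C[of "(e, x)"] by simp
  then show ?thesis using mu_C[OF x e] C.cls_carrier by simp
qed

lemma mu_mult:
  assumes x: "x \<in> carrier G" and y: "y \<in> carrier G"
  shows "mu (x \<otimes> y) = mu x \<otimes>\<^bsub>C.G\<^esub> mu y"
proof -
  obtain e f where ef: "(e, x) \<in> mu x" "(f, y) \<in> mu y" using mu_nonempty x y by blast
  then have C: "(e, x) \<in> C" "(f, y) \<in> C" using mu_C x y by blast+
  have "mu x \<otimes>\<^bsub>C.G\<^esub> mu y = C.cls (M (e, x) (f, y))"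
    using ef x y by (intro C.mult_eq_cls) (auto simp: mu_carrier)
  also have "\<dots> = mu (x \<otimes> y)" using C by (simp add: cls_C M_closed) (simp add: M_eq)
  finally show ?thesis by simp
qed

lemma mu_iso: "mu \<in> iso G C.G"
  unfolding iso_def mem_Collect_eq
proof
  show "mu \<in> hom G C.G" by (auto simp: hom_def mu_carrier mu_mult)
  show "bij_betw mu (carrier G) (carrier C.G)"
  proof (rule bij_betw_imageI)
    show "inj_on mu (carrier G)"
    proof (rule inj_onI)
      fix x y assume "x \<in> carrier G" "y \<in> carrier G" "mu x = mu y"
      then show "x = y" using mu_nonempty[of x] by (auto simp: mem_mu)
    qed
    show "mu ` carrier G = carrier C.G"
    proof (intro equalityI subsetI)
      fix X assume "X \<in> carrier C.G"
      then obtain p where "p \<in> C" "X = C.cls p" unfolding C.carrier_G by blast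
      then show "X \<in> mu ` carrier G" using cls_C by (auto simp: mem_C_iff)
    qed (auto simp: mu_carrier)
  qed
qed

lemma mu_comp_eq: "tpa_comp_eq G mA D \<theta> w \<Lambda>.D \<Lambda>.\<theta> \<Lambda>.W mu"
  unfolding tpa_comp_eq_def
proof (intro ballI conjI)
  fix x assume x: "x \<in> carrier G"
  have "(\<exists>s\<in>mu x. lmAlpha (C.rg s) = A.rg a) \<longleftrightarrow> A.rg a \<in> D x" if "a \<in> A" for a
  proof -
    have "lmAlpha (C.rg s) = fst s" if "s \<in> mu x" for s
      using mu_C[OF x that] by (simp add: rg_C lmAlpha_def)
    then have "(\<exists>s\<in>mu x. lmAlpha (C.rg s) = A.rg a) \<longleftrightarrow> (\<exists>s\<in>mu x. fst s = A.rg a)" by auto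
    also have "\<dots> \<longleftrightarrow> A.rg a \<in> D x" using that by (auto simp: mu_def)
    finally show ?thesis .
  qed
  then show "D x = \<Lambda>.D (mu x)" unfolding set_eq_iff \<Lambda>.D_iff using D_rg_iff[OF x] D_closed[OF x] by blast
next
  fix x a assume x: "x \<in> carrier G" and a: "a \<in> D (inv x)"
  have aA: "a \<in> A" using D_closed[of "inv x"] x a by simp
  have r: "A.rg a \<in> D (inv x)" "A.rg a \<in> A.E" using x a aA D_rg_iff[of "inv x" a] by simp_all
  \<comment> \<open>The member of the fibre over \<open>x\<close> whose domain is the range of
    \<open>a\<close>, hence the one by which the reconstructed map acts on \<open>a\<close>.\<close>
  define s where "s = (\<theta> x (A.rg a), x)"
  have s: "s \<in> mu x" using x r by (simp add: s_def mem_mu theta_mem theta_idem)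
  have "lmAlpha (C.dm s) = A.rg a"
    using mu_C[OF x s] x r by (simp add: dm_C lmAlpha_def) (simp add: s_def ti_theta)
  then have "\<Lambda>.\<theta> (mu x) a = L s a" using mu_carrier[OF x] s aA by (intro \<Lambda>.theta_eq_dm)
  also have "\<dots> = \<theta> x a" using x r aA by (simp add: L_eq s_def ti_theta)
  finally show "\<theta> x a = \<Lambda>.\<theta> (mu x) a" by simp
next
  fix x y a assume x: "x \<in> carrier G" and y: "y \<in> carrier G" and "a \<in> setprod mA (D x) (D (x \<otimes> y))"
  then have a: "a \<in> D x" "a \<in> D (x \<otimes> y)" by (simp_all add: setprod_D)
  have aA: "a \<in> A" using D_closed x a by blast
  have r: "A.rg a \<in> D x" "A.rg a \<in> D (x \<otimes> y)" "A.rg a \<in> A.E"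
    using x y a aA D_rg_iff[of x a] D_rg_iff[of "x \<otimes> y" a] by simp_all
  \<comment> \<open>The composable pair over \<open>a\<close> in the fibres of \<open>x\<close> and
    \<open>y\<close>; \<open>F\<close> at this pair is the original twist at the range of
    \<open>a\<close>.\<close>
  define u v where "u = (A.rg a, x)" and "v = (ti x (A.rg a), y)"
  have u: "u \<in> mu x" using r by (simp add: u_def mem_mu)
  have "ti x (A.rg a) \<in> D y"
    using theta_mem_mult_iff[of x y "ti x (A.rg a)"] x y r by (simp add: ti_mem theta_ti)
  then have v: "v \<in> mu y" using x r by (simp add: v_def mem_mu ti_idem)
  have C: "u \<in> C" "v \<in> C" using mu_C u v x y by blast+
  have d: "C.dm u = C.rg v" "lmAlpha (C.rg u) = A.rg a"
    using C by (simp_all add: dm_C rg_C lmAlpha_def) (simp_all add: u_def v_def)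
  have "F u v = c x y (A.rg a)"
    using x r by (simp add: F_eq L_eq u_def v_def ti_idem theta_ti)
  then have W: "fst (\<Lambda>.W (mu x) (mu y)) a = c x y (A.rg a) \<odot> a" "snd (\<Lambda>.W (mu x) (mu y)) a = a \<odot> c x y (A.rg a)"
    using \<Lambda>.W_eq[OF mu_carrier[OF x] mu_carrier[OF y] u v d] by simp_all
  show "fst (w x y) a = fst (\<Lambda>.W (mu x) (mu y)) a"
    using W A.mult_rep_fst[OF w_rep[OF x y]] a by simp
  show "snd (w x y) a = snd (\<Lambda>.W (mu x) (mu y)) a"
    using W A.mult_rep_snd[OF w_rep[OF x y]] a by simp
qed

text \<open>Since \<open>\<theta>'\<close> and \<open>\<theta>\<close> agree on idempotents, so do
  their inverses there, and the crossed product depends on nothing else. The equivalence of modules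
  is witnessed by the values of the multipliers \<open>\<epsilon> x\<close> at idempotents.\<close>

lemma tms_equiv_of_tpa_equiv:
  assumes "tpact A mA G D' \<theta>' w'" and eq: "tpa_equiv G A mA D \<theta> w D' \<theta>' w'"
  shows "cross_car G mA D' = C" (is ?car)
    and "\<forall>p\<in>C. \<forall>q\<in>C. cross_mult G mA D' \<theta>' p q = M p q" (is ?mult)
    and "tms_equiv C M A mA lmAlpha L F lmAlpha (lmLam G mA D' \<theta>') (lmF G mA D' \<theta>' w')" (is ?equiv)
proof -
  interpret T': tpact A mA G D' \<theta>' w' by fact
  have D': "D' x = D x" if "x \<in> carrier G" for x using eq that by (simp add: tpa_equiv_def)
  obtain \<epsilon> where \<epsilon>: "\<forall>x\<in>carrier G. is_unit_multiplier (D x) mA (\<epsilon> x) \<and>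
        (\<forall>s\<in>D (inv x). \<theta>' x s = snd (minv (D x) mA (\<epsilon> x)) (fst (\<epsilon> x) (\<theta> x s))) \<and>
        (\<forall>y\<in>carrier G. \<forall>s\<in>setprod mA (D (inv x)) (D y).
           snd (\<epsilon> (x \<otimes> y)) (snd (w' x y) (\<theta>' x s)) =
           snd (w x y) (fst (\<epsilon> x) (\<theta> x (snd (\<epsilon> y) s))))"
    using eq unfolding tpa_equiv_def by blast
  define d where "d x = snd (\<epsilon> x)" for x
  have rep: "A.mult_rep (D x) (\<epsilon> x) (d x)" if "x \<in> carrier G" for x
    unfolding d_def using \<epsilon> that by (intro A.unit_mult_rep D_ideal) auto
  have dA: "d x e \<in> A" and rgd: "A.rg (d x e) = e" if "x \<in> carrier G" "e \<in> D x" "e \<in> A.E" for x e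
    using that A.mult_rep_closed[OF rep] A.mult_rep_rg[OF rep] by blast+
  have dr: "d x (e \<odot> g) = d x e \<odot> g" if "x \<in> carrier G" "e \<in> D x" "e \<in> A.E" "g \<in> A.E" for x e g
    using that A.mult_rep_restrict[OF rep] by blast
  have th: "\<theta>' x a = d x (A.rg (\<theta> x a)) \<odot> \<theta> x a \<odot> A.iv (d x (A.rg (\<theta> x a)))"
    if "x \<in> carrier G" "a \<in> D (inv x)" for x a
    using \<epsilon> that A.snd_minv_fst[OF D_ideal rep, of x "\<theta> x a"] theta_mem[of x a] by simp
  have thE: "\<theta>' x e = \<theta> x e" if "x \<in> carrier G" "e \<in> D (inv x)" "e \<in> A.E" for x e
  proof -
    have t: "\<theta> x e \<in> A.E" "\<theta> x e \<in> D x" using that by (simp_all add: theta_idem theta_mem)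
    then have "d x (\<theta> x e) \<odot> \<theta> x e \<odot> A.iv (d x (\<theta> x e)) = \<theta> x e"
      using that by (intro A.conj_idem_eq) (simp_all add: dA rgd)
    then show ?thesis using th[of x e] that t by simp
  qed
  have tiE: "T'.ti x e = ti x e" if "x \<in> carrier G" "e \<in> D x" "e \<in> A.E" for x e
  proof -
    have "\<theta>' x (ti x e) = e" using that by (simp add: thE ti_mem ti_idem theta_ti)
    moreover have "ti x e \<in> D' (inv x)" using that by (simp add: D' ti_mem)
    ultimately show ?thesis using T'.ti_theta[of x "ti x e"] that by simp
  qed
  show ?car by (auto simp: pair_mem_C_iff T'.pair_mem_C_iff D')
  have L': "T'.L p a = d (snd p) (fst p) \<odot> L p a \<odot> A.iv (d (snd p) (fst p))" if p: "p \<in> C" and a: "a \<in> A" for p a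
  proof -
    define x e where "x = snd p" and "e = fst p"
    have x: "x \<in> carrier G" "e \<in> D x" "e \<in> A.E" using p by (simp_all add: x_def e_def mem_C_iff)
    define b where "b = L p a"
    have b: "b \<in> A" "e \<odot> b = b" using L_closed[OF p a] L_absorb[OF p a] by (simp_all add: b_def e_def)
    have "ti x e \<odot> a \<in> D (inv x)" using x a by (simp add: D_right ti_mem)
    then have "T'.L p a = d x (A.rg b) \<odot> b \<odot> A.iv (d x (A.rg b))"
      using x tiE[OF x] th[of x "ti x e \<odot> a"] by (simp add: T'.L_eq b_def L_eq flip: x_def e_def)
    also have "A.rg b = e \<odot> A.rg b" using b x by (simp add: A.rg_absorb)
    also have "d x (e \<odot> A.rg b) = d x e \<odot> A.rg b" using x b by (simp add: dr)
    also have "d x e \<odot> A.rg b \<odot> b \<odot> A.iv (d x e \<odot> A.rg b) = d x e \<odot> b \<odot> A.iv (d x e)"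
      using x b by (intro A.conj_restrict) (simp_all add: dA)
    finally show ?thesis by (simp add: b_def x_def e_def)
  qed
  have LE: "T'.L p g = L p g" if p: "p \<in> C" and g: "g \<in> A.E" for p g
  proof -
    have x: "snd p \<in> carrier G" "fst p \<in> D (snd p)" "fst p \<in> A.E" using p by (simp_all add: mem_C_iff)
    then have "ti (snd p) (fst p) \<odot> g \<in> D (inv (snd p))" "ti (snd p) (fst p) \<odot> g \<in> A.E"
      using g by (simp_all add: D_right ti_mem ti_idem)
    then show ?thesis using x tiE[OF x] thE by (simp add: T'.L_eq L_eq)
  qed
  show ?mult using LE by (simp add: T'.M_eq M_eq mem_C_iff)
  \<comment> \<open>At the pair \<open>(e, x)\<close> the witness takes the element that represents
    \<open>\<epsilon> x\<close> at \<open>e\<close>.\<close>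
  show ?equiv unfolding tms_equiv_def C.rg_def[symmetric]
  proof (intro conjI ballI exI[of _ "\<lambda>p. d (snd p) (fst p)"])
    fix p assume p: "p \<in> C"
    then show "d (snd p) (fst p) \<in> Agrp A mA (lmAlpha (C.rg p))"
      by (simp add: A.Agrp_iff rg_C lmAlpha_def mem_C_iff dA rgd)
    show "T'.L p a = d (snd p) (fst p) \<odot> L p a \<odot> A.iv (d (snd p) (fst p))" if "a \<in> A" for a
      using L'[OF p that] .
    fix q assume q: "q \<in> C"
    obtain e x f y where pq: "p = (e, x)" "q = (f, y)" by (cases p, cases q)
    have x: "x \<in> carrier G" "e \<in> D x" "e \<in> A.E" and y: "y \<in> carrier G" "f \<in> D y" "f \<in> A.E"
      using p q by (simp_all add: pq pair_mem_C_iff)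
    have k: "ti x e \<in> A.E" "ti x e \<in> D (inv x)" using x by (simp_all add: ti_idem ti_mem)
    \<comment> \<open>The equivalence identity is evaluated at this meet of the domain of
      \<open>p\<close> with the range of \<open>q\<close>, since \<open>\<theta> x h\<close> is the
      first coordinate of \<open>M p q\<close>.\<close>
    define h where "h = ti x e \<odot> f"
    have h: "h \<in> A.E" "h \<in> D (inv x)" "h \<in> D y" using x y k by (simp_all add: h_def D_left D_right)
    define r where "r = \<theta> x h"
    have r: "r \<in> A.E" "r \<in> D x" "r \<in> D (x \<otimes> y)"
      using x y h by (simp_all add: r_def theta_idem theta_mem theta_mem_mult)
    have Lr: "L p f = r" by (simp add: L_eq pq r_def h_def)
    have er: "e \<odot> r = r" using L_absorb[OF p, of f] y Lr by (simp add: pq)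
    have Mpq: "M p q = (r, x \<otimes> y)" using Lr by (simp add: M_eq pq(2)) (simp add: pq)
    have eqn: "snd (\<epsilon> (x \<otimes> y)) (snd (w' x y) (\<theta>' x h)) = snd (w x y) (fst (\<epsilon> x) (\<theta> x (snd (\<epsilon> y) h)))"
      using \<epsilon> x(1) y(1) h setprod_D[of "inv x" y] by blast
    define F' where "F' = T'.F p q"
    have F'eq: "F' = snd (w' x y) r"
      using LE[OF p y(3)] Lr by (simp add: F'_def T'.F_eq pq(2)) (simp add: pq(1))
    have F': "F' \<in> A" "A.rg F' = r"
      using x y r T'.c_closed[of x y r] T'.rg_c[of x y r] by (simp_all add: F'eq D')
    then have "F' \<in> D (x \<otimes> y)" using D_rg_iff[of "x \<otimes> y" F'] r x y by simp
    then have lhs: "snd (\<epsilon> (x \<otimes> y)) (snd (w' x y) (\<theta>' x h)) = F' \<odot> d (x \<otimes> y) r"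
      using A.mult_rep_snd[OF rep, of "x \<otimes> y" F'] x y F' thE[OF x(1) h(2,1)] by (simp add: F'eq r_def)
    define j where "j = d y h"
    have j: "j \<in> A" "A.rg j = h" using y h by (simp_all add: j_def dA rgd)
    then have jD: "j \<in> D (inv x)" "j \<in> D y" using D_rg_iff[of "inv x" j] D_rg_iff[of y j] x y h by simp_all
    define b where "b = \<theta> x j"
    have b: "b \<in> D x" "b \<in> D (x \<otimes> y)" "b \<in> A" "A.rg b = r"
      using x y jD j by (simp_all add: b_def theta_mem theta_mem_mult theta_closed theta_rg r_def)
    have dxr: "d x r \<in> A" "A.rg (d x r) = r" using x r by (simp_all add: dA rgd)
    have rgb: "A.rg (d x r \<odot> b) = r" using dxr b r by (simp add: A.rg_mult_distrib)
    have "fst (\<epsilon> x) b = d x r \<odot> b" using A.mult_rep_fst[OF rep b(1)] x b by simp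
    moreover have "snd (w x y) (d x r \<odot> b) = d x r \<odot> b \<odot> c x y r"
      using A.mult_rep_snd[OF w_rep[of x y], of "d x r \<odot> b"] x y b dxr rgb by (simp add: D_left)
    ultimately have rhs: "snd (w x y) (fst (\<epsilon> x) (\<theta> x (snd (\<epsilon> y) h))) = d x r \<odot> b \<odot> c x y r"
      by (simp add: b_def j_def d_def)
    have "L p (d y f) = b"
    proof -
      have "ti x e \<odot> d y f = d y f \<odot> ti x e" using k y by (intro A.idem_central) (simp_all add: dA)
      also have "\<dots> = j" using dr[of y f "ti x e"] y k by (simp add: j_def h_def A.idem_comm)
      finally show ?thesis by (simp add: L_eq pq b_def)
    qed
    \<comment> \<open>The identity gives \<open>\<epsilon> x\<close> at the range \<open>r\<close>
      of \<open>b\<close>, the witness uses the larger idempotent \<open>e\<close>; the restricting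
      factor \<open>r\<close> is absorbed by \<open>b\<close>.\<close>
    moreover have "d x r \<odot> b = d x e \<odot> b"
    proof -
      have "d x r = d x e \<odot> r" using dr[of x e r] x r er by simp
      then have "d x r \<odot> b = d x e \<odot> (r \<odot> b)" using x r b by (simp add: A.assoc dA)
      also have "r \<odot> b = b" using A.rg_mult_self[OF b(3)] b by simp
      finally show ?thesis .
    qed
    moreover have "F p q = c x y r" using Lr by (simp add: F_eq pq(2)) (simp add: pq)
    ultimately have "F' \<odot> d (x \<otimes> y) r = d x e \<odot> L p (d y f) \<odot> F p q" using eqn lhs rhs by simp
    then show "T'.F p q \<odot> d (snd (M p q)) (fst (M p q)) = d (snd p) (fst p) \<odot> L p (d (snd q) (fst q)) \<odot> F p q"
      by (simp add: Mpq F'_def) (simp add: pq)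
  qed simp
qed

end

section \<open>The correspondence\<close>

theorem theorem9p3:
  fixes A :: "'b set" and mA :: "'b \<Rightarrow> 'b \<Rightarrow> 'b"
  assumes "semilattice_of_groups A mA"
  shows
    \<comment> \<open>Lambda \<mapsto> Theta^Lambda lands in twisted partial actions, and Lambda = Lambda^(Theta^Lambda) \<circ> \<nu>\<close>
    "(\<forall>(S :: 'a set) m \<alpha> lam f.
        inverse_semigroup S m \<and> E_unitary S m \<and> sieben_tms S m A mA \<alpha> lam f \<longrightarrow>
          tpa (maxgrp S m) A mA (thD S m A mA \<alpha>) (thTheta S m A mA \<alpha> lam) (thW S m A mA \<alpha> f) \<and>
          (\<exists>\<nu>. sg_iso \<nu> S m
                 (cross_car (maxgrp S m) mA (thD S m A mA \<alpha>))
                 (cross_mult (maxgrp S m) mA (thD S m A mA \<alpha>) (thTheta S m A mA \<alpha> lam)) \<and>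
               tms_comp_eq S m A \<alpha> lam f
                 lmAlpha
                 (lmLam (maxgrp S m) mA (thD S m A mA \<alpha>) (thTheta S m A mA \<alpha> lam))
                 (lmF (maxgrp S m) mA (thD S m A mA \<alpha>) (thTheta S m A mA \<alpha> lam) (thW S m A mA \<alpha> f))
                 \<nu>)) \<and>
     \<comment> \<open>Theta \<mapsto> Lambda^Theta lands in Sieben structures over E-unitary inverse semigroups,
         and Theta = Theta^(Lambda^Theta) \<circ> \<nu>\<close>
     (\<forall>(G :: 'g monoid) D \<theta> w.
        tpa G A mA D \<theta> w \<longrightarrow>
          inverse_semigroup (cross_car G mA D) (cross_mult G mA D \<theta>) \<and>
          E_unitary (cross_car G mA D) (cross_mult G mA D \<theta>) \<and>
          sieben_tms (cross_car G mA D) (cross_mult G mA D \<theta>) A mA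
             lmAlpha (lmLam G mA D \<theta>) (lmF G mA D \<theta> w) \<and>
          (\<exists>\<nu>. \<nu> \<in> iso G (maxgrp (cross_car G mA D) (cross_mult G mA D \<theta>)) \<and>
               tpa_comp_eq G mA D \<theta> w
                 (thD (cross_car G mA D) (cross_mult G mA D \<theta>) A mA lmAlpha)
                 (thTheta (cross_car G mA D) (cross_mult G mA D \<theta>) A mA lmAlpha (lmLam G mA D \<theta>))
                 (thW (cross_car G mA D) (cross_mult G mA D \<theta>) A mA lmAlpha (lmF G mA D \<theta> w))
                 \<nu>)) \<and>
     \<comment> \<open>equivalent twisted partial actions give equivalent Sieben twisted modules
         (over the same semigroup E(A) *_\<theta> G = E(A) *_\<theta>' G)\<close>
     (\<forall>(G :: 'g monoid) D \<theta> w D' \<theta>' w'.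
        tpa G A mA D \<theta> w \<and> tpa G A mA D' \<theta>' w' \<and> tpa_equiv G A mA D \<theta> w D' \<theta>' w' \<longrightarrow>
          cross_car G mA D' = cross_car G mA D \<and>
          (\<forall>p\<in>cross_car G mA D. \<forall>q\<in>cross_car G mA D.
             cross_mult G mA D' \<theta>' p q = cross_mult G mA D \<theta> p q) \<and>
          tms_equiv (cross_car G mA D) (cross_mult G mA D \<theta>) A mA
             lmAlpha (lmLam G mA D \<theta>) (lmF G mA D \<theta> w)
             lmAlpha (lmLam G mA D' \<theta>') (lmF G mA D' \<theta>' w')) \<and>
     \<comment> \<open>equivalent Sieben twisted modules give equivalent twisted partial actions\<close>
     (\<forall>(S :: 'a set) m \<alpha> lam f \<alpha>' lam' f'.
        inverse_semigroup S m \<and> E_unitary S m \<and>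
        sieben_tms S m A mA \<alpha> lam f \<and> sieben_tms S m A mA \<alpha>' lam' f' \<and>
        tms_equiv S m A mA \<alpha> lam f \<alpha>' lam' f' \<longrightarrow>
          tpa_equiv (maxgrp S m) A mA
             (thD S m A mA \<alpha>) (thTheta S m A mA \<alpha> lam) (thW S m A mA \<alpha> f)
             (thD S m A mA \<alpha>') (thTheta S m A mA \<alpha>' lam') (thW S m A mA \<alpha>' f'))"
proof -
  interpret A: clifford A mA using assms by (rule clifford_of_semilattice_of_groups)
  have sieben: "sieben A mA S m \<alpha> lam f"
    if "inverse_semigroup S m" "E_unitary S m" "sieben_tms S m A mA \<alpha> lam f"
    for S :: "'a set" and m \<alpha> lam f
    using that by unfold_locales
  have tpact: "tpact A mA G D \<theta> w" if "tpa G A mA D \<theta> w" for G :: "'g monoid" and D \<theta> w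
    using that by unfold_locales
  show ?thesis
  proof (intro conjI allI impI)
    fix S :: "'a set" and m \<alpha> lam f
    assume *: "inverse_semigroup S m \<and> E_unitary S m \<and> sieben_tms S m A mA \<alpha> lam f"
    then interpret sieben A mA S m \<alpha> lam f by (intro sieben) auto
    show "tpa (maxgrp S m) A mA (thD S m A mA \<alpha>) (thTheta S m A mA \<alpha> lam) (thW S m A mA \<alpha> f)"
      by (rule tpa_of_sieben)
    show "\<exists>\<nu>. sg_iso \<nu> S m (cross_car (maxgrp S m) mA (thD S m A mA \<alpha>))
                 (cross_mult (maxgrp S m) mA (thD S m A mA \<alpha>) (thTheta S m A mA \<alpha> lam)) \<and>
               tms_comp_eq S m A \<alpha> lam f lmAlpha
                 (lmLam (maxgrp S m) mA (thD S m A mA \<alpha>) (thTheta S m A mA \<alpha> lam))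
                 (lmF (maxgrp S m) mA (thD S m A mA \<alpha>) (thTheta S m A mA \<alpha> lam) (thW S m A mA \<alpha> f)) \<nu>"
      using nu_iso nu_comp_eq by blast
  next
    fix G :: "'g monoid" and D \<theta> w
    assume "tpa G A mA D \<theta> w"
    then interpret tpact A mA G D \<theta> w by (rule tpact)
    show "inverse_semigroup (cross_car G mA D) (cross_mult G mA D \<theta>)" by (rule C_inverse_semigroup)
    show "E_unitary (cross_car G mA D) (cross_mult G mA D \<theta>)" by (rule C_E_unitary)
    show "sieben_tms (cross_car G mA D) (cross_mult G mA D \<theta>) A mA
             lmAlpha (lmLam G mA D \<theta>) (lmF G mA D \<theta> w)" by (rule C_sieben)
    show "\<exists>\<nu>. \<nu> \<in> iso G (maxgrp (cross_car G mA D) (cross_mult G mA D \<theta>)) \<and>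
               tpa_comp_eq G mA D \<theta> w
                 (thD (cross_car G mA D) (cross_mult G mA D \<theta>) A mA lmAlpha)
                 (thTheta (cross_car G mA D) (cross_mult G mA D \<theta>) A mA lmAlpha (lmLam G mA D \<theta>))
                 (thW (cross_car G mA D) (cross_mult G mA D \<theta>) A mA lmAlpha (lmF G mA D \<theta> w)) \<nu>"
      using mu_iso mu_comp_eq by blast
  next
    fix G :: "'g monoid" and D \<theta> w D' \<theta>' w'
    assume *: "tpa G A mA D \<theta> w \<and> tpa G A mA D' \<theta>' w' \<and> tpa_equiv G A mA D \<theta> w D' \<theta>' w'"
    then interpret tpact A mA G D \<theta> w by (intro tpact) auto
    have T': "tpact A mA G D' \<theta>' w'" and eq: "tpa_equiv G A mA D \<theta> w D' \<theta>' w'"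
      using * by (auto intro: tpact)
    show "cross_car G mA D' = cross_car G mA D"
      by (rule tms_equiv_of_tpa_equiv(1)[OF T' eq])
    show "\<forall>p\<in>cross_car G mA D. \<forall>q\<in>cross_car G mA D. cross_mult G mA D' \<theta>' p q = cross_mult G mA D \<theta> p q"
      by (rule tms_equiv_of_tpa_equiv(2)[OF T' eq])
    show "tms_equiv (cross_car G mA D) (cross_mult G mA D \<theta>) A mA
             lmAlpha (lmLam G mA D \<theta>) (lmF G mA D \<theta> w)
             lmAlpha (lmLam G mA D' \<theta>') (lmF G mA D' \<theta>' w')"
      by (rule tms_equiv_of_tpa_equiv(3)[OF T' eq])
  next
    fix S :: "'a set" and m \<alpha> lam f \<alpha>' lam' f'
    assume *: "inverse_semigroup S m \<and> E_unitary S m \<and> sieben_tms S m A mA \<alpha> lam f \<and>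
      sieben_tms S m A mA \<alpha>' lam' f' \<and> tms_equiv S m A mA \<alpha> lam f \<alpha>' lam' f'"
    then interpret sieben A mA S m \<alpha> lam f by (intro sieben) auto
    have "sieben A mA S m \<alpha>' lam' f'" using * by (intro sieben) auto
    then show "tpa_equiv (maxgrp S m) A mA
             (thD S m A mA \<alpha>) (thTheta S m A mA \<alpha> lam) (thW S m A mA \<alpha> f)
             (thD S m A mA \<alpha>') (thTheta S m A mA \<alpha>' lam') (thW S m A mA \<alpha>' f')"
      using * by (intro tpa_equiv_of_tms_equiv) auto
  qed
qed

end
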